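(* Let $\mathbf{a}=(a_n)_{n\in\mathbb{Z}}\in\mathcal{M}$, let $N^+,N^-\in\mathbb{N}$, and let $\mathbf{b}^{+}=(b^{+}_n)_{n\in\mathbb{Z}}\in\mathcal{S}_{N^{+}}$ and $\mathbf{b}^{-}=(b^{-}_n)_{n\in\mathbb{Z}}\in\mathcal{S}_{N^{-}}$. Suppose there are integers $K^-<K^+$ such that $a_n=b_n^+$ for all $n\ge K^++1$ and $a_n=b_n^-$ for all $n\le K^--1$. Then there exist periodic solutions $\gamma^{+}\in\mathcal{O}^{\mathrm{per}}_{N^{+}}(\mathbf{b}^{+})$ and $\gamma^{-}\in\mathcal{O}^{\mathrm{per}}_{N^{-}}(\mathbf{b}^{-})$ and a solution $y\in\mathcal{O}(\mathbf{a})$ which is a connecting orbit from $\gamma^-$ to $\gamma^+$. Moreover, for every $n\in\mathbb{Z}$ with $a_na_{n+1}=1$ there is no $t\in(n,n+1)$ with $y(t)=0$, and for every $n\in\mathbb{Z}$ with $a_na_{n+1}=-1$ there is a unique $t\in(n,n+1)$ with $y(t)=0$.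
   Context: Let $x:\mathbb{R}\to[0,\infty)$ be the continuous $1$-periodic function with $x(t)=0$ for $t\in\mathbb{Z}$, $x(t)>0$ for $t\in\mathbb{R}\setminus\mathbb{Z}$, and $\ddot x=-\frac{1}{8x^2}$ on $\mathbb{R}\setminus\mathbb{Z}$ (the collisions at integer times are regularized as elastic bounces). A solution of the (planar) Sitnikov problem is a function $y$ satisfying $\ddot y=-\dfrac{y}{(x(t)^2+y^2)^{3/2}}$. $\mathcal{M}\subset\{-1,1\}^{\mathbb{Z}}$ is the set of bi-infinite sequences in which every maximal block of consecutive equal entries has length at least $3$; more precisely, the sequence is a concatenation of alternating blocks of $-1$'s and $+1$'s of lengths $k_j$ ($j\in\mathbb{Z}$), where $(k_j)$ is a bounded sequence with $k_j\ge 3$ for all $j$. Let $\mathbf{e}^{\pm}$ be the constant sequences with value $\pm1$. For $N\in\mathbb{N}$, $$\mathcal{P}_N=\{\mathbf{a}\in\mathcal{M}\setminus\{\mathbf{e}^{+},\mathbf{e}^-\}\mid a_n=a_{n+N}\ (n\in\mathbb{Z})\},\qquad \mathcal{S}_N=\{\mathbf{a}\in\mathcal{P}_N\mid a_n=a_{-n}\ (n\in\mathbb{Z})\}.$$ For $\mathbf{a}\in\mathcal{M}$, $$\Omega(\mathbf{a})=\{y\in H^1_{\mathrm{loc}}(\mathbb{R},\mathbb{R})\mid a_ny(n)>0\ (n\in\mathbb{Z})\},$$ $$\mathcal{O}(\mathbf{a})=\{y\in\Omega(\mathbf{a})\mid y\text{ is a solution of the Sitnikov problem}\},\qquad \mathcal{O}^{\mathrm{per}}_N(\mathbf{a})=\{y\in\mathcal{O}(\mathbf{a})\mid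 y\text{ is }N\text{-periodic}\}.$$ A function $y$ is a connecting orbit from $\gamma^-$ to $\gamma^+$ if $\|y-\gamma^-\|_{L^2([i,i+1])}\to0$ as $i\to-\infty$ and $\|y-\gamma^+\|_{L^2([i,i+1])}\to0$ as $i\to+\infty$ ($i\in\mathbb{Z}$). The case $\mathbf{b}^+=\mathbf{b}^-$ and $\gamma^+=\gamma^-$ is allowed. *)

theory Defs
  imports "HOL-Analysis.Analysis"
begin

(* The continuous 1-periodic x is determined uniquely by these conditions: the period between
   collisions fixes the energy. Nothing is required of its derivatives at the integers. *)
definition primaries :: "(real \<Rightarrow> real) \<Rightarrow> bool" where
  "primaries x \<longleftrightarrow>
     continuous_on UNIV x \<and>
     (\<forall>t. x (t + 1) = x t) \<and>
     (\<forall>t\<in>\<int>. x t = 0) \<and>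
     (\<forall>t. t \<notin> \<int> \<longrightarrow> x t > 0) \<and>
     (\<exists>v. \<forall>t. t \<notin> \<int> \<longrightarrow>
        (x has_real_derivative v t) (at t) \<and>
        (v has_real_derivative - 1 / (8 * (x t)\<^sup>2)) (at t))"

(* The first conjunct says that the right-hand side of the equation is defined at t (no triple
   collision); without it the singular value would silently be read as 0. *)
definition sitnikov_solution :: "(real \<Rightarrow> real) \<Rightarrow> (real \<Rightarrow> real) \<Rightarrow> bool" where
  "sitnikov_solution x y \<longleftrightarrow>
     (\<forall>t. (x t)\<^sup>2 + (y t)\<^sup>2 \<noteq> 0) \<and>
     (\<exists>v. \<forall>t.
        (y has_real_derivative v t) (at t) \<and>
        (v has_real_derivative - y t / ((x t)\<^sup>2 + (y t)\<^sup>2) powr (3 / 2)) (at t))"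

(* The j-th block occupies the positions p j, ..., p (j + 1) - 1 and has length k j. As k j >= 3,
   the blocks cover all integers, so a takes only the values -1 and 1. *)
definition seqs_M :: "(int \<Rightarrow> int) set" where
  "seqs_M = {a. \<exists>(k :: int \<Rightarrow> nat) (p :: int \<Rightarrow> int). \<exists>c\<in>{-1, 1}.
     bdd_above (range k) \<and>
     (\<forall>j. k j \<ge> 3) \<and>
     (\<forall>j. p (j + 1) = p j + int (k j)) \<and>
     (\<forall>j. \<forall>n\<in>{p j..<p (j + 1)}. a n = (if even j then c else - c))}"

definition seqs_P :: "nat \<Rightarrow> (int \<Rightarrow> int) set" where
  "seqs_P N = {a \<in> seqs_M - {(\<lambda>_. 1), (\<lambda>_. -1)}. \<forall>n. a n = a (n + int N)}"

definition seqs_S :: "nat \<Rightarrow> (int \<Rightarrow> int) set" where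
  "seqs_S N = {a \<in> seqs_P N. \<forall>n. a n = a (- n)}"

definition L2_loc :: "(real \<Rightarrow> real) set" where
  "L2_loc = {f \<in> borel_measurable borel. \<forall>a b. set_integrable lborel {a..b} (\<lambda>t. (f t)\<^sup>2)}"

definition test_function :: "(real \<Rightarrow> real) \<Rightarrow> bool" where
  "test_function \<phi> \<longleftrightarrow>
     (\<forall>m t. (deriv ^^ m) \<phi> differentiable (at t)) \<and>
     (\<exists>R. \<forall>t. \<bar>t\<bar> > R \<longrightarrow> \<phi> t = 0)"

definition weak_derivative :: "(real \<Rightarrow> real) \<Rightarrow> (real \<Rightarrow> real) \<Rightarrow> bool" where
  "weak_derivative y g \<longleftrightarrow>
     (\<forall>\<phi>. test_function \<phi> \<longrightarrow>
        (LINT t|lborel. y t * deriv \<phi> t) = - (LINT t|lborel. g t * \<phi> t))"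

(* Elements of the Sobolev space are identified with their continuous representatives, so that
   point values such as y(n) make sense. *)
definition H1_loc :: "(real \<Rightarrow> real) set" where
  "H1_loc = {y \<in> L2_loc. continuous_on UNIV y \<and> (\<exists>g\<in>L2_loc. weak_derivative y g)}"

definition Omega :: "(int \<Rightarrow> int) \<Rightarrow> (real \<Rightarrow> real) set" where
  "Omega a = {y \<in> H1_loc. \<forall>n. real_of_int (a n) * y (real_of_int n) > 0}"

definition orbits :: "(real \<Rightarrow> real) \<Rightarrow> (int \<Rightarrow> int) \<Rightarrow> (real \<Rightarrow> real) set" where
  "orbits x a = {y \<in> Omega a. sitnikov_solution x y}"

definition periodic_orbits ::
    "(real \<Rightarrow> real) \<Rightarrow> nat \<Rightarrow> (int \<Rightarrow> int) \<Rightarrow> (real \<Rightarrow> real) set" where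
  "periodic_orbits x N a = {y \<in> orbits x a. \<forall>t. y (t + real N) = y t}"

(* Meaningful for square-integrable f only: the integral of a non-integrable function is 0. *)
definition L2_norm_on :: "real set \<Rightarrow> (real \<Rightarrow> real) \<Rightarrow> real" where
  "L2_norm_on S f = sqrt (LINT t:S|lborel. (f t)\<^sup>2)"

definition connecting_orbit ::
    "(real \<Rightarrow> real) \<Rightarrow> (real \<Rightarrow> real) \<Rightarrow> (real \<Rightarrow> real) \<Rightarrow> bool" where
  "connecting_orbit y \<gamma>m \<gamma>p \<longleftrightarrow>
     ((\<lambda>i::int. L2_norm_on {real_of_int i..real_of_int i + 1} (\<lambda>t. y t - \<gamma>m t)) \<longlongrightarrow> 0) at_bot \<and>
     ((\<lambda>i::int. L2_norm_on {real_of_int i..real_of_int i + 1} (\<lambda>t. y t - \<gamma>p t)) \<longlongrightarrow> 0) at_top"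

end

(* The solutions are local minimisers of the Lagrangian action among curves whose values at the
   integers have the prescribed signs, zero being allowed. Such a minimiser satisfies the equation of
   motion away from triple collisions. At a triple collision the curve may
   be folded so as to have constant sign on either side, and it does not vanish identically on a side
   because the collinear configuration is unstable. If the two signs agree, cutting off the dip at the
   collision decreases the action. If not, the sign prescribed at the collision is that of one side,
   the curve is asymptotic to the equilateral configurations y = sqrt 3 x and y = - sqrt 3 x, and a
   change of time that lets it cross away from the collision decreases the action.
   Hence all signs are strict and the minimiser is an orbit.

   Let c be the minimal action over one period of b, without any condition at the end points. By the
   reflection symmetry of b it is attained by a curve with equal end values, so that iterating this
   curve gives a periodic local minimiser. The connecting orbit minimises the renormalised action, the
   supremum over growing windows of the action minus the multiples of c for the periods covered; the
   action over each period in the tails therefore tends to c. Two minimisers that meet twice coincide,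
   so that the orbit and its translate by a period are eventually ordered. The translates thus converge
   monotonically, and the limit is periodic with action c over a period, hence a local minimiser. *)
theory Submission
  imports Defs "HOL-Complex_Analysis.Great_Picard"
begin

text \<open>What can escape in the direct method is the curve itself: far from the primaries the
  potential is small, so a minimising sequence might run off to infinity. Every period of a
  nonconstant sequence contains a change of sign, hence a bounded value, which together with the
  kinetic energy bounds the curve. Minimising without end conditions makes the renormalisation work:
  each period of any curve then costs at least c, whatever its end values, so the renormalised
  action is nondecreasing in the window. The price is that a free minimiser need not close up. Here
  the evenness of b enters: either half of it, continued by reflection in the midpoint, has action
  at least c, and the two add up to 2c. The value sqrt 3 belongs to the homothetic solution y = sqrt
  3 x, for which x^2 + y^2 = (2x)^2 and both equations read u'' = - u/(8 x^3). Since x^(3/2) is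
  asymptotic to 3t/4, the natural scale at a collision is q^3 in time, q^2 in space and q in action.
  The estimates that exclude a crossing are all multiples of q, so that only numerical constants
  have to be compared.\<close>

subsection \<open>Curves with an energy majorant\<close>

text \<open>A majorant E of the kinetic energy of a curve y. The smallest one increases by the
  integral of the squared derivative of y, so a finite majorant expresses that y is an H1 curve.
  The condition is preserved by pointwise limits and by gluing, so that no weak derivatives are
  needed for the direct method.\<close>

definition energy_bound :: "(real \<Rightarrow> real) \<Rightarrow> (real \<Rightarrow> real) \<Rightarrow> real \<Rightarrow> real \<Rightarrow> bool" where
  "energy_bound y E s t \<longleftrightarrow>
     (\<forall>a b. s \<le> a \<longrightarrow> a \<le> b \<longrightarrow> b \<le> t \<longrightarrow> (y b - y a)\<^sup>2 \<le> (b - a) * (E b - E a))"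

lemma energy_boundI:
  assumes "\<And>a b. s \<le> a \<Longrightarrow> a < b \<Longrightarrow> b \<le> t \<Longrightarrow> (y b - y a)\<^sup>2 \<le> (b - a) * (E b - E a)"
  shows "energy_bound y E s t"
  unfolding energy_bound_def
proof (intro allI impI)
  fix a b assume "s \<le> a" "a \<le> b" "b \<le> t"
  then show "(y b - y a)\<^sup>2 \<le> (b - a) * (E b - E a)"
    using assms[of a b] by (cases "a = b") auto
qed

lemma energy_boundD:
  "energy_bound y E s t \<Longrightarrow> s \<le> a \<Longrightarrow> a \<le> b \<Longrightarrow> b \<le> t \<Longrightarrow> (y b - y a)\<^sup>2 \<le> (b - a) * (E b - E a)"
  unfolding energy_bound_def by blast

lemma energy_bound_subset:
  "energy_bound y E s t \<Longrightarrow> s \<le> s' \<Longrightarrow> t' \<le> t \<Longrightarrow> energy_bound y E s' t'"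
  unfolding energy_bound_def by fastforce

lemma energy_bound_mono:
  assumes "energy_bound y E s t" "s \<le> a" "a \<le> b" "b \<le> t"
  shows "E a \<le> E b"
proof (cases "a = b")
  case False
  have "0 \<le> (b - a) * (E b - E a)"
    using energy_boundD[OF assms] zero_le_power2 order_trans by blast
  then show ?thesis using False assms(3) by (simp add: zero_le_mult_iff)
qed simp

lemma energy_bound_le:
  assumes "energy_bound y E s t" "s \<le> a" "a \<le> b" "b \<le> t"
  shows "(y b - y a)\<^sup>2 \<le> (b - a) * (E t - E s)"
proof -
  have "E b - E a \<le> E t - E s"
    using energy_bound_mono[OF assms(1), of s a] energy_bound_mono[OF assms(1), of b t] assms by simp
  then have "(b - a) * (E b - E a) \<le> (b - a) * (E t - E s)"
    using assms by (intro mult_left_mono) auto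
  then show ?thesis using energy_boundD[OF assms] by linarith
qed

lemma energy_bound_le_abs:
  assumes "energy_bound y E s t" "a \<in> {s..t}" "b \<in> {s..t}"
  shows "(y b - y a)\<^sup>2 \<le> \<bar>b - a\<bar> * (E t - E s)"
  using energy_bound_le[OF assms(1), of a b] energy_bound_le[OF assms(1), of b a] assms(2,3)
  by (cases "a \<le> b") (auto simp: power2_commute[of "y b"])

lemma energy_bound_continuous:
  assumes "energy_bound y E s t"
  shows "continuous_on {s..t} y"
proof -
  have "\<exists>d>0. \<forall>b\<in>{s..t}. dist b a < d \<longrightarrow> dist (y b) (y a) < e" if "a \<in> {s..t}" "e > 0" for a e
  proof -
    define M where "M = E t - E s + 1"
    have M: "M > 0" using energy_bound_mono[OF assms, of s t] that(1) unfolding M_def by simp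
    have "dist (y b) (y a) < e" if b: "b \<in> {s..t}" "dist b a < e\<^sup>2 / M" for b
    proof -
      have "(y b - y a)\<^sup>2 \<le> \<bar>b - a\<bar> * (E t - E s)"
        using energy_bound_le_abs[OF assms \<open>a \<in> {s..t}\<close> b(1)] .
      also have "\<dots> \<le> \<bar>b - a\<bar> * M" unfolding M_def by (intro mult_left_mono) auto
      also have "\<dots> < e\<^sup>2" using b(2) M by (simp add: dist_real_def field_simps)
      finally have "\<bar>y b - y a\<bar> < e"
        using \<open>e > 0\<close> power2_less_imp_less[of "\<bar>y b - y a\<bar>" e] by simp
      then show ?thesis by (simp add: dist_real_def)
    qed
    then show ?thesis using M \<open>e > 0\<close> by (intro exI[of _ "e\<^sup>2 / M"]) auto
  qed
  then show ?thesis unfolding continuous_on_iff by blast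
qed

text \<open>Cauchy-Schwarz for two summands, with the square roots multiplied out. It combines the
  increments on two adjacent intervals.\<close>

lemma square_sum_le:
  fixes u v p q P Q :: real
  assumes "u\<^sup>2 \<le> p * P" "v\<^sup>2 \<le> q * Q" "0 \<le> p" "0 \<le> q" "0 \<le> P" "0 \<le> Q"
  shows "(u + v)\<^sup>2 \<le> (p + q) * (P + Q)"
proof -
  have "(u * v)\<^sup>2 \<le> (p * P) * (q * Q)"
    unfolding power_mult_distrib using assms by (intro mult_mono) auto
  moreover have "4 * ((p * P) * (q * Q)) \<le> (p * Q + q * P)\<^sup>2"
    using zero_le_power2[of "p * Q - q * P"] by (simp add: power2_eq_square algebra_simps)
  ultimately have "(2 * (u * v))\<^sup>2 \<le> (p * Q + q * P)\<^sup>2" by (simp add: power_mult_distrib)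
  moreover have "0 \<le> p * Q + q * P" using assms by simp
  ultimately have "2 * (u * v) \<le> p * Q + q * P" by (rule power2_le_imp_le)
  then show ?thesis using assms(1,2) by (simp add: power2_eq_square algebra_simps)
qed

lemma energy_bound_combine:
  assumes "energy_bound y E s m" "energy_bound y E m t"
  shows "energy_bound y E s t"
proof (rule energy_boundI)
  fix a b assume ab: "s \<le> a" "a < b" "b \<le> t"
  consider "b \<le> m" | "m \<le> a" | "a < m" "m < b" by linarith
  then show "(y b - y a)\<^sup>2 \<le> (b - a) * (E b - E a)"
  proof cases
    case 3
    have "((y m - y a) + (y b - y m))\<^sup>2 \<le> ((m - a) + (b - m)) * ((E m - E a) + (E b - E m))"
      using 3 ab energy_boundD[OF assms(1), of a m] energy_boundD[OF assms(2), of m b]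
        energy_bound_mono[OF assms(1), of a m] energy_bound_mono[OF assms(2), of m b]
      by (intro square_sum_le) auto
    then show ?thesis by simp
  qed (use ab energy_boundD[OF assms(1), of a b] energy_boundD[OF assms(2), of a b] in auto)
qed

lemma energy_bound_cong:
  assumes "energy_bound y E s t" "\<And>r. s \<le> r \<Longrightarrow> r \<le> t \<Longrightarrow> z r = y r"
    "\<And>r. s \<le> r \<Longrightarrow> r \<le> t \<Longrightarrow> F r = E r + c"
  shows "energy_bound z F s t"
  using assms unfolding energy_bound_def by simp

section \<open>Gluing and transforming curves\<close>

definition join :: "real \<Rightarrow> (real \<Rightarrow> real) \<Rightarrow> (real \<Rightarrow> real) \<Rightarrow> real \<Rightarrow> real" where
  "join m f g r = (if r \<le> m then f r else g r)"

text \<open>The second energy is lifted so as to continue the first; only increments of a majorant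
  have a meaning.\<close>

definition join_energy :: "real \<Rightarrow> (real \<Rightarrow> real) \<Rightarrow> (real \<Rightarrow> real) \<Rightarrow> real \<Rightarrow> real" where
  "join_energy m F G r = (if r \<le> m then F r else F m + (G r - G m))"

lemma join_left: "r \<le> m \<Longrightarrow> join m f g r = f r"
  and join_right: "m \<le> r \<Longrightarrow> f m = g m \<Longrightarrow> join m f g r = g r"
  by (auto simp: join_def)

lemma join_energy_left: "r \<le> m \<Longrightarrow> join_energy m F G r = F r"
  and join_energy_right: "m \<le> r \<Longrightarrow> join_energy m F G r = F m + (G r - G m)"
  by (auto simp: join_energy_def)

lemma energy_bound_join:
  assumes "energy_bound y F s m" "energy_bound z G m t" "y m = z m"
  shows "energy_bound (join m y z) (join_energy m F G) s t"
proof (rule energy_bound_combine)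
  show "energy_bound (join m y z) (join_energy m F G) s m"
    by (rule energy_bound_cong[OF assms(1), where c = 0]) (auto simp: join_left join_energy_left)
  show "energy_bound (join m y z) (join_energy m F G) m t"
    by (rule energy_bound_cong[OF assms(2), where c = "F m - G m"])
      (auto simp: join_right join_energy_right assms(3))
qed

lemma energy_bound_shift:
  assumes "energy_bound y E (s + d) (t + d)"
  shows "energy_bound (\<lambda>r. y (r + d)) (\<lambda>r. E (r + d)) s t"
proof (rule energy_boundI)
  fix a b assume "s \<le> a" "a < b" "b \<le> t"
  then show "(y (b + d) - y (a + d))\<^sup>2 \<le> (b - a) * (E (b + d) - E (a + d))"
    using energy_boundD[OF assms, of "a + d" "b + d"] by simp
qed

lemma energy_bound_reflect:
  assumes "energy_bound y E s t"
  shows "energy_bound (\<lambda>r. y (- r)) (\<lambda>r. - E (- r)) (- t) (- s)"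
proof (rule energy_boundI)
  fix a b assume "- t \<le> a" "a < b" "b \<le> - s"
  then have "(y (- a) - y (- b))\<^sup>2 \<le> (- a - (- b)) * (E (- a) - E (- b))"
    by (intro energy_boundD[OF assms]) auto
  then show "(y (- b) - y (- a))\<^sup>2 \<le> (b - a) * (- E (- b) - - E (- a))"
    by (simp add: power2_commute[of "y (- b)"] algebra_simps)
qed

text \<open>Any map of the values that does not increase distances, such as folding to one sign or
  truncating from below, costs no kinetic energy.\<close>

lemma energy_bound_contraction:
  assumes "energy_bound y E s t"
    and "\<And>a b. s \<le> a \<Longrightarrow> a \<le> b \<Longrightarrow> b \<le> t \<Longrightarrow> \<bar>z b - z a\<bar> \<le> \<bar>y b - y a\<bar>"
  shows "energy_bound z E s t"
proof (rule energy_boundI)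
  fix a b assume ab: "s \<le> a" "a < b" "b \<le> t"
  have "(z b - z a)\<^sup>2 \<le> (y b - y a)\<^sup>2"
    using assms(2)[of a b] ab by (simp add: abs_le_square_iff)
  then show "(z b - z a)\<^sup>2 \<le> (b - a) * (E b - E a)"
    using energy_boundD[OF assms(1), of a b] ab by linarith
qed

text \<open>The new energy is an integral of (y' + c)^2 = y'^2 + 2 c y' + c^2, so that the cost of
  adding an affine function is explicit.\<close>

lemma energy_bound_add_affine:
  assumes "energy_bound y E s t"
  shows "energy_bound (\<lambda>r. y r + c * (r - m) + d) (\<lambda>r. E r + 2 * c * y r + c\<^sup>2 * r) s t"
proof (rule energy_boundI)
  fix a b assume ab: "s \<le> a" "a < b" "b \<le> t"
  have "(y b + c * (b - m) + d - (y a + c * (a - m) + d))\<^sup>2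
      = (y b - y a)\<^sup>2 + 2 * c * (b - a) * (y b - y a) + c\<^sup>2 * (b - a)\<^sup>2"
    by (simp add: power2_eq_square algebra_simps)
  also have "\<dots> \<le> (b - a) * (E b - E a) + 2 * c * (b - a) * (y b - y a) + c\<^sup>2 * (b - a)\<^sup>2"
    using energy_boundD[OF assms, of a b] ab by simp
  also have "\<dots> = (b - a) * (E b + 2 * c * y b + c\<^sup>2 * b - (E a + 2 * c * y a + c\<^sup>2 * a))"
    by (simp add: power2_eq_square algebra_simps)
  finally show "(y b + c * (b - m) + d - (y a + c * (a - m) + d))\<^sup>2
      \<le> (b - a) * (E b + 2 * c * y b + c\<^sup>2 * b - (E a + 2 * c * y a + c\<^sup>2 * a))" .
qed

lemma energy_bound_const: "energy_bound (\<lambda>r. c) (\<lambda>r. e) s t"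
  by (simp add: energy_bound_def)

lemma energy_bound_affine: "energy_bound (\<lambda>r. c * (r - m) + d) (\<lambda>r. c\<^sup>2 * r) s t"
  using energy_bound_add_affine[OF energy_bound_const[of 0 0 s t], of c m d] by simp

text \<open>The squared derivative of the composed curve integrates to that of y weighted by the
  slope of \<tau>, which is at most L.\<close>

lemma energy_bound_warp:
  assumes "energy_bound y E (\<tau> s) (\<tau> t)"
    and mono: "\<And>a b. s \<le> a \<Longrightarrow> a \<le> b \<Longrightarrow> b \<le> t \<Longrightarrow> \<tau> a \<le> \<tau> b"
    and lip: "\<And>a b. s \<le> a \<Longrightarrow> a \<le> b \<Longrightarrow> b \<le> t \<Longrightarrow> \<tau> b - \<tau> a \<le> L * (b - a)"
  shows "energy_bound (\<lambda>r. y (\<tau> r)) (\<lambda>r. L * E (\<tau> r)) s t"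
proof (rule energy_boundI)
  fix a b assume ab: "s \<le> a" "a < b" "b \<le> t"
  then have le: "\<tau> s \<le> \<tau> a" "\<tau> a \<le> \<tau> b" "\<tau> b \<le> \<tau> t" using mono by auto
  have "(y (\<tau> b) - y (\<tau> a))\<^sup>2 \<le> (\<tau> b - \<tau> a) * (E (\<tau> b) - E (\<tau> a))"
    by (rule energy_boundD[OF assms(1) le])
  also have "\<dots> \<le> (L * (b - a)) * (E (\<tau> b) - E (\<tau> a))"
    using lip[of a b] ab energy_bound_mono[OF assms(1) le] by (intro mult_right_mono) auto
  finally show "(y (\<tau> b) - y (\<tau> a))\<^sup>2 \<le> (b - a) * (L * E (\<tau> b) - L * E (\<tau> a))"
    by (simp add: algebra_simps)
qed

subsection \<open>Integrals on intervals\<close>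

text \<open>The exceptional points will be the collision times of the primaries, where 1/x takes the
  default value 0 and pointwise comparisons may fail.\<close>

lemma integral_le_off_finite:
  fixes f g :: "real \<Rightarrow> real"
  assumes "finite S" "f integrable_on T" "g integrable_on T" "\<And>r. r \<in> T - S \<Longrightarrow> f r \<le> g r"
  shows "integral T f \<le> integral T g"
proof -
  define f' where "f' r = (if r \<in> S then g r else f r)" for r
  have "(f' has_integral integral T f) T"
    by (rule has_integral_spike_finite[OF assms(1) _ integrable_integral[OF assms(2)]])
      (auto simp: f'_def)
  then show ?thesis
    by (rule has_integral_le[OF _ integrable_integral[OF assms(3)]])
      (auto simp: f'_def intro: assms(4))
qed

lemma has_integral_affine_real:
  fixes f :: "real \<Rightarrow> real"
  assumes "f integrable_on {m * s + c..m * t + c}" "m > 0"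
  shows "((\<lambda>r. f (m * r + c)) has_integral integral {m * s + c..m * t + c} f / m) {s..t}"
proof -
  have "((\<lambda>r. f (m *\<^sub>R r + c)) has_integral (integral {m * s + c..m * t + c} f /\<^sub>R m ^ DIM(real)))
     (cbox ((m * s + c - c) /\<^sub>R m) ((m * t + c - c) /\<^sub>R m))"
    using assms by (intro has_integral_affinity') (auto simp: box_real)
  moreover have "cbox ((m * s + c - c) /\<^sub>R m) ((m * t + c - c) /\<^sub>R m) = {s..t}"
    using assms(2) by simp
  ultimately have "((\<lambda>r. f (m *\<^sub>R r + c)) has_integral
      (integral {m * s + c..m * t + c} f /\<^sub>R m ^ DIM(real))) {s..t}" by (simp only:)
  then show ?thesis by (simp add: divide_inverse mult.commute)
qed

lemma finite_Ints_Icc: "finite (\<int> \<inter> {s..t::real})"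
proof -
  have "\<int> \<inter> {s..t} \<subseteq> of_int ` {\<lceil>s\<rceil>..\<lfloor>t\<rfloor>}"
    by (auto elim!: Ints_cases simp: ceiling_le_iff le_floor_iff)
  then show ?thesis using finite_surj by blast
qed

lemma real_mvt:
  fixes f f' :: "real \<Rightarrow> real"
  assumes "a < b" "continuous_on {a..b} f"
    and "\<And>t. a < t \<Longrightarrow> t < b \<Longrightarrow> (f has_real_derivative f' t) (at t)"
  obtains c where "a < c" "c < b" "f b - f a = (b - a) * f' c"
proof -
  obtain l z where z: "a < z" "z < b" "(f has_real_derivative l) (at z)" "f b - f a = (b - a) * l"
    using MVT[OF assms(1,2)] assms(3) real_differentiable_def by blast
  then have "l = f' z" using assms(3) DERIV_unique by blast
  then show ?thesis using z that by blast
qed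

subsection \<open>The motion of the primaries\<close>

locale sitnikov =
  fixes x :: "real \<Rightarrow> real"
  assumes primaries: "primaries x"
begin

lemma x_continuous: "continuous_on S x"
  using primaries continuous_on_subset unfolding primaries_def by blast

lemma x_isCont: "isCont x t"
  using x_continuous[of UNIV] by (simp add: continuous_on_eq_continuous_at)

lemma x_Ints: "t \<in> \<int> \<Longrightarrow> x t = 0"
  and x_pos: "t \<notin> \<int> \<Longrightarrow> 0 < x t"
  using primaries unfolding primaries_def by auto

lemma x_nonneg: "0 \<le> x t"
  using x_Ints x_pos by (cases "t \<in> \<int>") (auto simp: less_imp_le)

lemma x_zero [simp]: "x 0 = 0" and x_one [simp]: "x 1 = 0"
  using x_Ints by auto

lemma not_Ints_unit: "0 < t \<Longrightarrow> t < 1 \<Longrightarrow> t \<notin> (\<int> :: real set)"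
  by (auto elim!: Ints_cases)

lemma x_add_nat: "x (t + real n) = x t"
proof (induction n)
  case (Suc n)
  have "x (t + real n + 1) = x (t + real n)" using primaries unfolding primaries_def by blast
  then show ?case using Suc by (simp add: add_ac)
qed simp

lemma x_add_int: "x (t + of_int n) = x t"
proof (cases "n \<ge> 0")
  case True
  then show ?thesis using x_add_nat[of t "nat n"] by simp
next
  case False
  then show ?thesis using x_add_nat[of "t + of_int n" "nat (- n)"] by simp
qed

definition dx :: "real \<Rightarrow> real" where
  "dx = (SOME v. \<forall>t. t \<notin> \<int> \<longrightarrow> (x has_real_derivative v t) (at t) \<and>
     (v has_real_derivative - 1 / (8 * (x t)\<^sup>2)) (at t))"

lemma dx_props: "\<forall>t. t \<notin> \<int> \<longrightarrow> (x has_real_derivative dx t) (at t) \<and>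
     (dx has_real_derivative - 1 / (8 * (x t)\<^sup>2)) (at t)"
proof -
  have "\<exists>v. \<forall>t. t \<notin> \<int> \<longrightarrow> (x has_real_derivative v t) (at t) \<and>
     (v has_real_derivative - 1 / (8 * (x t)\<^sup>2)) (at t)"
    using primaries unfolding primaries_def by blast
  from someI_ex[OF this] show ?thesis unfolding dx_def .
qed

lemma x_deriv: "t \<notin> \<int> \<Longrightarrow> (x has_real_derivative dx t) (at t)"
  and dx_deriv: "t \<notin> \<int> \<Longrightarrow> (dx has_real_derivative - 1 / (8 * (x t)\<^sup>2)) (at t)"
  using dx_props by auto

lemmas x_chain = x_deriv[THEN DERIV_chain2] and dx_chain = dx_deriv[THEN DERIV_chain2]

text \<open>Maximum principle: at a positive maximum of x(s) - x(1 - s) the second derivative, 1/(8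
  x(1 - s)^2) - 1/(8 x(s)^2), would be positive.\<close>

lemma x_reflect_le: "t \<in> {0..1} \<Longrightarrow> x t \<le> x (1 - t)"
proof (rule ccontr)
  assume t: "t \<in> {0..1}" and "\<not> x t \<le> x (1 - t)"
  define d where "d s = x s - x (1 - s)" for s
  define d' where "d' s = dx s + dx (1 - s)" for s
  have "continuous_on {0..1} d" unfolding d_def
    by (intro continuous_intros x_continuous continuous_on_compose2[OF x_continuous[of UNIV]]) auto
  then obtain m where m: "m \<in> {0..1}" "\<And>s. s \<in> {0..1} \<Longrightarrow> d s \<le> d m"
    using continuous_attains_sup[of "{0..1::real}" d] by auto
  have "d m > 0" using m(2)[OF t] \<open>\<not> x t \<le> x (1 - t)\<close> unfolding d_def by simp
  moreover have "d 0 = 0" "d 1 = 0" by (auto simp: d_def)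
  ultimately have "m \<noteq> 0" "m \<noteq> 1" by auto
  then have m01: "0 < m" "m < 1" using m(1) by auto
  have der: "(d has_real_derivative d' s) (at s)" if "0 < s" "s < 1" for s
    unfolding d_def d'_def using that
    by (auto intro!: derivative_eq_intros x_chain simp: not_Ints_unit)
  have der': "(d' has_real_derivative (- 1 / (8 * (x m)\<^sup>2) + 1 / (8 * (x (1 - m))\<^sup>2))) (at m)"
    unfolding d'_def using m01
    by (auto intro!: derivative_eq_intros dx_chain simp: not_Ints_unit)
  have "d' m = 0"
    using DERIV_local_max[OF der[OF m01], of "min m (1 - m)"] m m01 by (auto simp: abs_less_iff)
  have "0 < x (1 - m)" using m01 not_Ints_unit[of "1 - m"] by (intro x_pos) auto
  moreover have "x (1 - m) < x m" using \<open>d m > 0\<close> unfolding d_def by simp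
  ultimately have "- 1 / (8 * (x m)\<^sup>2) + 1 / (8 * (x (1 - m))\<^sup>2) > 0"
    by (simp add: frac_less2 power_strict_mono)
  from DERIV_pos_inc_right[OF der' this] \<open>d' m = 0\<close>
  obtain e where e: "e > 0" "\<And>h. 0 < h \<Longrightarrow> h < e \<Longrightarrow> 0 < d' (m + h)" by auto
  define h where "h = min (e / 2) ((1 - m) / 2)"
  have h: "0 < h" "h < e" "m + h < 1" using e m01 unfolding h_def by (auto simp: min_def field_simps)
  have "d m < d (m + h)"
  proof (rule DERIV_pos_imp_increasing_open[of m "m + h" d])
    show "m < m + h" using h by simp
    show "\<exists>y. (d has_real_derivative y) (at s) \<and> 0 < y" if "m < s" "s < m + h" for s
      using der[of s] e(2)[of "s - m"] that h m01 by auto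
    show "continuous_on {m..m + h} d"
      by (rule DERIV_atLeastAtMost_imp_continuous_on) (use der h m01 in \<open>meson le_less_trans less_le_trans\<close>)
  qed
  moreover have "d (m + h) \<le> d m" using h m01 by (intro m(2)) auto
  ultimately show False by simp
qed

lemma x_reflect_unit: "t \<in> {0..1} \<Longrightarrow> x (1 - t) = x t"
  using x_reflect_le[of t] x_reflect_le[of "1 - t"] by auto

lemma x_minus: "x (- t) = x t"
proof -
  have fr: "frac t \<in> {0..1}" using frac_lt_1[of t] by (auto simp: less_imp_le)
  have "x (- t) = x (1 - frac t + of_int (- \<lfloor>t\<rfloor> - 1))" by (simp add: frac_def)
  also have "\<dots> = x (frac t)" using x_add_int x_reflect_unit[OF fr] by metis
  also have "\<dots> = x t" using x_add_int[of "frac t" "\<lfloor>t\<rfloor>"] by (simp add: frac_def)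
  finally show ?thesis .
qed

lemma x_int_minus: "x (of_int n - t) = x t"
  using x_add_int[of "- t" n] x_minus by (simp add: add.commute)

section \<open>Energy of the primaries and their behaviour near a collision\<close>

definition x_energy :: real where "x_energy = - 1 / (8 * x (1/2))"

lemma half_not_Ints: "(1/2 :: real) \<notin> \<int>"
  by (rule not_Ints_unit) auto

lemma x_half_pos: "0 < x (1/2)"
  by (rule x_pos[OF half_not_Ints])

lemma x_energy_neg: "x_energy < 0"
  using x_half_pos by (simp add: x_energy_def)

lemma dx_half: "dx (1/2) = 0"
proof -
  have "((\<lambda>t. x (1 - t)) has_real_derivative dx (1 - 1/2) * (0 - 1)) (at (1/2))"
    using half_not_Ints by (intro x_chain derivative_intros) auto
  then have der: "((\<lambda>t. x (1 - t)) has_real_derivative - dx (1/2)) (at (1/2))" by simp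
  have "\<forall>\<^sub>F t in nhds (1/2::real). x (1 - t) = x t"
    unfolding eventually_nhds
    by (rule exI[of _ "{0<..<1}"]) (use x_reflect_unit in auto)
  from DERIV_cong_ev[OF refl this refl, THEN iffD1, OF der]
  have "(x has_real_derivative - dx (1/2)) (at (1/2))" .
  then have "- dx (1/2) = dx (1/2)" using x_deriv[OF half_not_Ints] DERIV_unique by blast
  then show ?thesis by simp
qed

text \<open>Conservation of the Kepler energy; its value is read off at s = 1/2, where the velocity
  vanishes by symmetry.\<close>

lemma x_energy_eq:
  assumes "0 < s" "s < 1"
  shows "(dx s)\<^sup>2 / 2 - 1 / (8 * x s) = x_energy"
proof -
  define h where "h s = (dx s)\<^sup>2 / 2 - 1 / (8 * x s)" for s
  have "\<exists>c. \<forall>r\<in>{0<..<1}. h r = c"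
  proof (rule has_field_derivative_zero_constant)
    show "(h has_real_derivative 0) (at r within {0<..<1})" if "r \<in> {0<..<1}" for r
    proof -
      have r: "r \<notin> \<int>" "x r > 0" using not_Ints_unit x_pos that by auto
      have "(h has_real_derivative 0) (at r)"
        unfolding h_def using r
        by (auto intro!: derivative_eq_intros x_deriv dx_deriv simp: field_simps power2_eq_square)
      then show ?thesis by (rule has_field_derivative_at_within)
    qed
  qed auto
  then obtain c where c: "\<And>r. r \<in> {0<..<1} \<Longrightarrow> h r = c" by blast
  have "h (1/2) = x_energy" by (simp add: h_def dx_half x_energy_def)
  then show ?thesis using c[of s] c[of "1/2"] assms unfolding h_def by simp
qed

lemma x_dx_sq: "0 < s \<Longrightarrow> s < 1 \<Longrightarrow> x s * (dx s)\<^sup>2 = 1 / 4 + 2 * x_energy * x s"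
  using x_energy_eq[of s] x_pos[OF not_Ints_unit, of s] by (simp add: field_simps)

lemma sqrt_x_dx:
  assumes "0 < s" "s < 1"
  shows "sqrt (x s) * \<bar>dx s\<bar> = sqrt (1 / 4 + 2 * x_energy * x s)"
  unfolding x_dx_sq[OF assms, symmetric] by (simp add: real_sqrt_mult)

lemma sqrt_x_dx_le:
  assumes "0 < s" "s < 1"
  shows "sqrt (x s) * \<bar>dx s\<bar> \<le> 1 / 2"
proof -
  have "2 * x_energy * x s \<le> 0"
    using x_energy_neg x_nonneg[of s] by (simp add: mult_nonpos_nonneg)
  then have "1 / 4 + 2 * x_energy * x s \<le> (1/2)\<^sup>2" by (simp add: power2_eq_square)
  then show ?thesis unfolding sqrt_x_dx[OF assms] by (rule real_le_lsqrt[rotated]) auto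
qed

lemma dx_decreasing:
  assumes "0 < a" "a < b" "b < 1"
  shows "dx b < dx a"
proof (rule DERIV_neg_imp_decreasing[OF assms(2), of dx])
  fix s assume "a \<le> s" "s \<le> b"
  then have s: "0 < s" "s < 1" using assms by auto
  have "- 1 / (8 * (x s)\<^sup>2) < 0" using x_pos[OF not_Ints_unit[OF s]] by simp
  then show "\<exists>y. (dx has_real_derivative y) (at s) \<and> y < 0"
    using dx_deriv[OF not_Ints_unit[OF s]] by blast
qed

lemma dx_pos: "0 < s \<Longrightarrow> s < 1/2 \<Longrightarrow> 0 < dx s"
  using dx_decreasing[of s "1/2"] dx_half by simp

lemma x_increasing:
  assumes "0 \<le> a" "a < b" "b \<le> 1/2"
  shows "x a < x b"
proof (rule DERIV_pos_imp_increasing_open[OF assms(2), of x])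
  show "\<exists>y. (x has_real_derivative y) (at s) \<and> 0 < y" if "a < s" "s < b" for s
    using x_deriv[OF not_Ints_unit, of s] dx_pos[of s] assms that by auto
qed (rule x_continuous)

lemma x_dx_le: "0 < s \<Longrightarrow> s < 1 \<Longrightarrow> s * dx s \<le> x s"
proof -
  assume s: "0 < s" "s < 1"
  obtain c where c: "0 < c" "c < s" "x s - x 0 = (s - 0) * dx c"
    using real_mvt[OF s(1) x_continuous, of dx] s x_deriv not_Ints_unit
    by (metis less_trans)
  then show ?thesis using dx_decreasing[of c s] s by simp
qed

text \<open>By energy conservation sqrt x times x' has the limit 1/2 at the collision. Hence x^(3/2)
  is asymptotic to 3s/4, and x itself to a multiple of s^(2/3).\<close>

lemma x_sqrt_x_deriv:
  assumes "0 < s" "s < 1/2"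
  shows "((\<lambda>s. x s * sqrt (x s)) has_real_derivative 3 / 2 * sqrt (1 / 4 + 2 * x_energy * x s)) (at s)"
proof -
  have s: "s \<notin> \<int>" "0 < x s" using not_Ints_unit x_pos assms by auto
  have "sqrt (x s) * dx s = sqrt (1 / 4 + 2 * x_energy * x s)"
    using sqrt_x_dx[of s] dx_pos[of s] assms by simp
  moreover have "((\<lambda>s. x s * sqrt (x s)) has_real_derivative 3 / 2 * (sqrt (x s) * dx s)) (at s)"
    using s by (auto intro!: derivative_eq_intros x_deriv simp: field_simps)
  ultimately show ?thesis by simp
qed

lemma x_sqrt_x_bounds:
  assumes "0 < s" "s \<le> 1/2"
  shows "x s * sqrt (x s) \<le> 3 / 4 * s" "3 / 2 * sqrt (1 / 4 + 2 * x_energy * x s) * s \<le> x s * sqrt (x s)"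
proof -
  have "continuous_on {0..s} (\<lambda>s. x s * sqrt (x s))"
    by (intro continuous_intros x_continuous)
  from real_mvt[OF assms(1) this x_sqrt_x_deriv]
  obtain c where c: "0 < c" "c < s" "x s * sqrt (x s) = s * (3 / 2 * sqrt (1 / 4 + 2 * x_energy * x c))"
    using assms(2) by auto
  have "x_energy * x c \<le> 0" "x_energy * x s \<le> x_energy * x c"
    using x_energy_neg x_nonneg[of c] x_increasing[of c s] c assms
    by (auto simp: mult_nonpos_nonneg mult_left_mono_neg)
  then have "sqrt (1 / 4 + 2 * x_energy * x c) \<le> sqrt ((1/2)\<^sup>2)"
    "sqrt (1 / 4 + 2 * x_energy * x s) \<le> sqrt (1 / 4 + 2 * x_energy * x c)"
    by (auto simp: power2_eq_square)
  then show "x s * sqrt (x s) \<le> 3 / 4 * s" "3 / 2 * sqrt (1 / 4 + 2 * x_energy * x s) * s \<le> x s * sqrt (x s)"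
    unfolding c(3) using assms by (auto simp: mult.commute)
qed

lemma x_cube_le:
  assumes "\<bar>s\<bar> \<le> 1/2"
  shows "x s ^ 3 \<le> 9 / 16 * s\<^sup>2"
proof (cases "s = 0")
  case False
  have "x \<bar>s\<bar> * sqrt (x \<bar>s\<bar>) \<le> 3 / 4 * \<bar>s\<bar>"
    using x_sqrt_x_bounds(1)[of "\<bar>s\<bar>"] False assms by simp
  then have "(x \<bar>s\<bar> * sqrt (x \<bar>s\<bar>))\<^sup>2 \<le> (3 / 4 * \<bar>s\<bar>)\<^sup>2"
    using x_nonneg by (intro power_mono) auto
  moreover have "(x \<bar>s\<bar> * sqrt (x \<bar>s\<bar>))\<^sup>2 = x \<bar>s\<bar> ^ 3"
    using x_nonneg[of "\<bar>s\<bar>"] by (simp add: power_mult_distrib power2_eq_square power3_eq_cube)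
  moreover have "x \<bar>s\<bar> = x s" using x_minus by (simp add: abs_if)
  ultimately show ?thesis by (simp add: power_mult_distrib power2_eq_square)
qed simp

lemma x_cube_ge_near_0:
  "\<exists>r>0. r \<le> 1/2 \<and> (\<forall>s. \<bar>s\<bar> \<le> r \<longrightarrow> s\<^sup>2 / 8 \<le> x s ^ 3)"
proof -
  have lim: "(\<lambda>s. sqrt (1 / 4 + 2 * x_energy * x s)) \<midarrow>0\<rightarrow> sqrt (1 / 4 + 2 * x_energy * x 0)"
    using x_isCont[of 0, unfolded isCont_def] by (intro tendsto_intros)
  \<comment> \<open>The limit is 1/2. The smaller value 1/3 gives s^2/4 as a lower bound for x^3,
    weakened below to s^2/8, whose cube root is half of s^(2/3).\<close>
  have "1/3 < sqrt (1 / 4 + 2 * x_energy * x 0)"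
    by (rule real_less_rsqrt) (simp add: power2_eq_square)
  with lim have "\<forall>\<^sub>F s in at 0. sqrt (1 / 4 + 2 * x_energy * x s) > 1/3"
    by (rule order_tendstoD(1))
  then obtain r where r: "r > 0" "\<And>s. s \<noteq> 0 \<Longrightarrow> \<bar>s\<bar> < r \<Longrightarrow> sqrt (1 / 4 + 2 * x_energy * x s) > 1/3"
    unfolding eventually_at by (auto simp: dist_real_def)
  have "s\<^sup>2 / 8 \<le> x s ^ 3" if s: "\<bar>s\<bar> \<le> min (r / 2) (1/2)" for s
  proof (cases "s = 0")
    case False
    have "1 / 2 * \<bar>s\<bar> \<le> 3 / 2 * sqrt (1 / 4 + 2 * x_energy * x \<bar>s\<bar>) * \<bar>s\<bar>"
      using r(2)[of "\<bar>s\<bar>"] False s r(1) by (intro mult_right_mono) auto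
    also have "\<dots> \<le> x \<bar>s\<bar> * sqrt (x \<bar>s\<bar>)" using False s by (intro x_sqrt_x_bounds(2)) auto
    finally have "(1 / 2 * \<bar>s\<bar>)\<^sup>2 \<le> (x \<bar>s\<bar> * sqrt (x \<bar>s\<bar>))\<^sup>2" by (intro power_mono) auto
    moreover have "(x \<bar>s\<bar> * sqrt (x \<bar>s\<bar>))\<^sup>2 = x \<bar>s\<bar> ^ 3"
      using x_nonneg[of "\<bar>s\<bar>"] by (simp add: power_mult_distrib power2_eq_square power3_eq_cube)
    moreover have "x \<bar>s\<bar> = x s" using x_minus by (simp add: abs_if)
    ultimately have "s\<^sup>2 / 4 \<le> x s ^ 3" by (simp add: power_mult_distrib power2_eq_square)
    then show ?thesis using zero_le_power2[of s] by linarith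
  qed simp
  then show ?thesis using r(1) by (intro exI[of _ "min (r / 2) (1/2)"]) auto
qed

subsection \<open>The action\<close>

text \<open>Since (x x')' = 1/(8x) + 2h with the energy h, the function 8 x x' - 16 h s is a
  primitive of 1/x. It is continuous up to the collisions because sqrt x times x' is
  bounded.\<close>

lemma inverse_x_integrable_unit: "(\<lambda>s. 1 / x s) integrable_on {0..1}"
proof -
  define g where "g s = 8 * x s * (if s \<in> \<int> then 0 else dx s)" for s
  have g_le: "\<bar>g s\<bar> \<le> 4 * sqrt (x s)" if "s \<in> {0..1}" for s
  proof (cases "s = 0 \<or> s = 1")
    case False
    then have s: "0 < s" "s < 1" using that by auto
    have "\<bar>g s\<bar> = 8 * sqrt (x s) * (sqrt (x s) * \<bar>dx s\<bar>)"
      using x_nonneg[of s] not_Ints_unit[OF s] by (simp add: g_def abs_mult)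
    also have "\<dots> \<le> 8 * sqrt (x s) * (1/2)"
      using sqrt_x_dx_le[OF s] x_nonneg[of s] by (intro mult_left_mono) auto
    finally show ?thesis by simp
  qed (auto simp: g_def)
  have cont_end: "continuous (at a within {0..1}) g" if "a = 0 \<or> a = 1" for a
  proof -
    have "((\<lambda>s. 4 * sqrt (x s)) \<longlongrightarrow> 4 * sqrt (x a)) (at a within {0..1})"
      using x_continuous[of "{0..1}"] that by (intro tendsto_intros) (auto simp: continuous_on_def)
    moreover have "x a = 0" "g a = 0" using that by (auto simp: g_def)
    ultimately show ?thesis unfolding continuous_within
      by (auto intro!: Lim_null_comparison[of g "\<lambda>s. 4 * sqrt (x s)"]
          simp: eventually_at_filter g_le)
  qed
  have der: "((\<lambda>s. g s - 16 * x_energy * s) has_real_derivative 1 / x s) (at s)"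
    if "0 < s" "s < 1" for s
  proof -
    have s: "s \<notin> \<int>" "0 < x s" using not_Ints_unit x_pos that by auto
    have e: "x s * (dx s)\<^sup>2 = 1 / 4 + 2 * x_energy * x s" by (rule x_dx_sq[OF that])
    have d: "((\<lambda>s. 8 * x s * dx s) has_real_derivative 1 / x s + 16 * x_energy) (at s)"
      using s e by (auto intro!: derivative_eq_intros x_deriv dx_deriv simp: field_simps power2_eq_square)
    have "\<forall>\<^sub>F r in nhds s. 8 * x r * dx r = g r"
      unfolding eventually_nhds
      by (rule exI[of _ "{0<..<1}"]) (use that not_Ints_unit in \<open>auto simp: g_def\<close>)
    from DERIV_cong_ev[OF refl this refl, THEN iffD1, OF d]
    have "(g has_real_derivative 1 / x s + 16 * x_energy) (at s)" .
    then show ?thesis by (auto intro!: derivative_eq_intros)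
  qed
  have "continuous_on {0..1} (\<lambda>s. g s - 16 * x_energy * s)"
  proof -
    have "continuous (at s within {0..1}) g" if "s \<in> {0..1}" for s
    proof (cases "s = 0 \<or> s = 1")
      case False
      have "isCont (\<lambda>s. g s - 16 * x_energy * s) s"
        using der[of s] False that DERIV_isCont by fastforce
      from isCont_add[OF this, of "\<lambda>s. 16 * x_energy * s"] have "isCont g s" by simp
      then show ?thesis by (simp add: continuous_at_imp_continuous_within)
    qed (use cont_end in auto)
    then have "continuous_on {0..1} g" by (simp add: continuous_on_eq_continuous_within)
    then show ?thesis by (intro continuous_intros)
  qed
  then have "((\<lambda>s. 1 / x s) has_integral (g 1 - 16 * x_energy * 1) - (g 0 - 16 * x_energy * 0)) {0..1}"
    by (intro fundamental_theorem_of_calculus_interior)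
      (auto simp: has_real_derivative_iff_has_vector_derivative[symmetric] der)
  then show ?thesis by blast
qed

lemma inverse_x_integrable: "(\<lambda>s. 1 / x s) integrable_on {s..t}"
proof -
  have unit: "(\<lambda>s. 1 / x s) integrable_on {of_int n..of_int n + 1}" for n :: int
  proof -
    have "((\<lambda>r. 1 / x (1 * r + of_int (- n))) has_integral integral {0..1} (\<lambda>s. 1 / x s) / 1) {of_int n..of_int n + 1}"
      using has_integral_affine_real[of "\<lambda>s. 1 / x s" 1 "of_int n" "of_int (- n)" "of_int n + 1"]
        inverse_x_integrable_unit by simp
    then show ?thesis unfolding x_add_int by auto
  qed
  have "(\<lambda>s. 1 / x s) integrable_on {of_int n..of_int n + real k}" for n k
  proof (induction k)
    case (Suc k)
    show ?case
      by (rule Henstock_Kurzweil_Integration.integrable_combine[OF _ _ Suc])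
        (use unit[of "n + int k"] in \<open>auto simp: algebra_simps\<close>)
  qed (use integrable_on_refl[of _ "of_int n"] in simp)
  from this[of "\<lfloor>s\<rfloor>" "nat (\<lceil>t\<rceil> - \<lfloor>s\<rfloor>)"] show ?thesis
    by (rule integrable_on_subinterval) (use le_of_int_ceiling[of t] in \<open>auto simp: of_nat_nat; linarith\<close>)
qed

text \<open>The factor 2 goes with a kinetic term without the factor 1/2: the action is twice the
  integral of the Lagrangian. At a triple collision the value is 0, the default for
  division.\<close>

definition pot :: "(real \<Rightarrow> real) \<Rightarrow> real \<Rightarrow> real" where
  "pot y r = 2 / sqrt ((x r)\<^sup>2 + (y r)\<^sup>2)"

lemma pot_nonneg: "0 \<le> pot y r"
  by (simp add: pot_def)

lemma pot_le: "r \<notin> \<int> \<Longrightarrow> pot y r \<le> 2 / x r"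
  unfolding pot_def using x_pos[of r] real_sqrt_gt_zero[of "(x r)\<^sup>2 + (y r)\<^sup>2"]
  by (intro divide_left_mono) (auto intro: real_le_rsqrt simp: add_pos_nonneg)

lemma pot_cong: "\<bar>y r\<bar> = \<bar>z r\<bar> \<Longrightarrow> pot y r = pot z r"
  by (metis pot_def power2_abs)

lemma pot_mono:
  assumes "\<bar>y r\<bar> \<le> \<bar>z r\<bar>" "r \<notin> \<int>"
  shows "pot z r \<le> pot y r"
proof -
  have "0 < (x r)\<^sup>2" using x_pos[OF assms(2)] by simp
  moreover have "(y r)\<^sup>2 \<le> (z r)\<^sup>2" using assms(1) by (simp add: abs_le_square_iff)
  ultimately show ?thesis unfolding pot_def
    by (intro divide_left_mono mult_pos_pos) (auto intro: add_pos_nonneg)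
qed

lemma pot_strict_mono:
  assumes "\<bar>y r\<bar> < \<bar>z r\<bar>" "r \<notin> \<int>"
  shows "pot z r < pot y r"
proof -
  have "0 < (x r)\<^sup>2" using x_pos[OF assms(2)] by simp
  moreover have "(y r)\<^sup>2 < (z r)\<^sup>2" using power_strict_mono[OF assms(1), of 2] by simp
  ultimately show ?thesis unfolding pot_def
    by (intro divide_strict_left_mono mult_pos_pos) (auto intro: add_pos_nonneg)
qed

lemma pot_continuous:
  assumes "continuous_on S y" "\<And>r. r \<in> S \<Longrightarrow> (x r)\<^sup>2 + (y r)\<^sup>2 \<noteq> 0"
  shows "continuous_on S (pot y)"
proof -
  have "continuous_on S (\<lambda>r. 2 / sqrt ((x r)\<^sup>2 + (y r)\<^sup>2))"
    using assms by (intro continuous_intros x_continuous) auto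
  then show ?thesis by (simp add: pot_def[abs_def])
qed

text \<open>Whatever y is, 2/x dominates off the integers, and 1/x is integrable across the
  collisions of the primaries.\<close>

lemma pot_integrable:
  assumes "continuous_on {s..t} y"
  shows "pot y integrable_on {s..t}"
proof (rule measurable_bounded_by_integrable_imp_integrable)
  define g where "g r = (if r \<in> \<int> then pot y r else 2 * (1 / x r))" for r
  have "(\<lambda>r. 2 * (1 / x r)) integrable_on {s..t}"
    by (rule integrable_on_mult_right[OF inverse_x_integrable])
  then show "g integrable_on {s..t}"
    by (rule integrable_spike_finite[OF finite_Ints_Icc[of s t], rotated]) (auto simp: g_def)
  have meas: "x \<in> borel_measurable (lebesgue_on {s..t})" "y \<in> borel_measurable (lebesgue_on {s..t})"
    using assms x_continuous by (auto intro!: continuous_imp_measurable_on_sets_lebesgue)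
  have "(\<lambda>r. 2 / sqrt ((x r)\<^sup>2 + (y r)\<^sup>2)) \<in> borel_measurable (lebesgue_on {s..t})"
    by (intro borel_measurable_divide borel_measurable_const borel_measurable_add
        borel_measurable_power meas measurable_compose[OF _ borel_measurable_sqrt])
  then show "pot y \<in> borel_measurable (lebesgue_on {s..t})" by (simp add: pot_def[abs_def])
  show "norm (pot y r) \<le> g r" for r
    using pot_nonneg pot_le by (auto simp: g_def)
qed auto

lemma pot_integral_mono:
  assumes "continuous_on {s..t} y" "continuous_on {s..t} z"
    and "\<And>r. s \<le> r \<Longrightarrow> r \<le> t \<Longrightarrow> \<bar>y r\<bar> \<le> \<bar>z r\<bar>"
  shows "integral {s..t} (pot z) \<le> integral {s..t} (pot y)"
  by (rule integral_le_off_finite[OF finite_Ints_Icc[of s t]])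
    (auto intro!: pot_integrable assms pot_mono)

lemma pot_integral_strict_mono:
  assumes cont: "continuous_on {s..t} y" "continuous_on {s..t} z"
    and le: "\<And>r. s \<le> r \<Longrightarrow> r \<le> t \<Longrightarrow> \<bar>y r\<bar> \<le> \<bar>z r\<bar>"
    and r0: "s < r0" "r0 < t" "\<bar>y r0\<bar> < \<bar>z r0\<bar>" "r0 \<notin> \<int>"
  shows "integral {s..t} (pot z) < integral {s..t} (pot y)"
proof -
  have "isCont (\<lambda>r. \<bar>z r\<bar> - \<bar>y r\<bar>) r0"
    using cont r0(1,2) by (intro continuous_intros continuous_on_interior) auto
  then have "\<forall>\<^sub>F r in at r0. 0 < \<bar>z r\<bar> - \<bar>y r\<bar>"
    unfolding isCont_def by (rule order_tendstoD(1)) (use r0 in auto)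
  moreover have "\<forall>\<^sub>F r in at r0. 0 < x r"
    using x_isCont unfolding isCont_def by (rule order_tendstoD(1)) (use x_pos r0 in auto)
  ultimately have "\<forall>\<^sub>F r in at r0. 0 < \<bar>z r\<bar> - \<bar>y r\<bar> \<and> 0 < x r" by (rule eventually_conj)
  then obtain d where d: "d > 0" "\<And>r. r \<noteq> r0 \<Longrightarrow> \<bar>r - r0\<bar> < d \<Longrightarrow> 0 < \<bar>z r\<bar> - \<bar>y r\<bar> \<and> 0 < x r"
    unfolding eventually_at by (auto simp: dist_real_def)
  define e where "e = min (d / 2) (min (r0 - s) (t - r0))"
  define p q where "p = r0 - e" and "q = r0 + e"
  have e: "e > 0" "e < d" "s \<le> p" "p < q" "q \<le> t"
    using d(1) r0 unfolding e_def p_def q_def by (auto simp: min_def)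
  have str: "\<bar>y r\<bar> < \<bar>z r\<bar> \<and> r \<notin> \<int>" if "p \<le> r" "r \<le> q" for r
  proof (cases "r = r0")
    case False
    then have "0 < \<bar>z r\<bar> - \<bar>y r\<bar> \<and> 0 < x r"
      using that e unfolding p_def q_def by (intro d(2)) auto
    then show ?thesis using x_Ints by fastforce
  qed (use r0 in auto)
  have sub: "continuous_on {p..q} y" "continuous_on {p..q} z"
    using cont e by (auto intro: continuous_on_subset)
  have nz: "x r \<noteq> 0" if "p \<le> r" "r \<le> q" for r
    using x_pos str that by (metis less_irrefl)
  have "integral {p..q} (pot z) < integral {p..q} (pot y)"
    using e sub nz str by (intro integral_less_real pot_continuous pot_strict_mono) auto
  moreover have "integral {s..p} (pot z) \<le> integral {s..p} (pot y)" "integral {q..t} (pot z) \<le> integral {q..t} (pot y)"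
    using e le by (auto intro!: pot_integral_mono continuous_on_subset[OF cont(1)] continuous_on_subset[OF cont(2)])
  moreover have "integral {s..t} (pot w) = integral {s..p} (pot w) + integral {p..q} (pot w) + integral {q..t} (pot w)"
    if "continuous_on {s..t} w" for w
  proof -
    have "integral {s..p} (pot w) + integral {p..t} (pot w) = integral {s..t} (pot w)"
      using e that by (intro Henstock_Kurzweil_Integration.integral_combine pot_integrable) auto
    moreover have "integral {p..q} (pot w) + integral {q..t} (pot w) = integral {p..t} (pot w)"
      using e continuous_on_subset[OF that, of "{p..t}"]
      by (intro Henstock_Kurzweil_Integration.integral_combine pot_integrable) auto
    ultimately show ?thesis by simp
  qed
  ultimately show ?thesis using cont by simp
qed

lemma pot_integral_tendsto:
  assumes cont: "\<And>k. continuous_on {s..t} (Y k)"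
    and lim: "\<And>r. s \<le> r \<Longrightarrow> r \<le> t \<Longrightarrow> (\<lambda>k. Y k r) \<longlonglongrightarrow> y r"
  shows "(\<lambda>k. integral {s..t} (pot (Y k))) \<longlonglongrightarrow> integral {s..t} (pot y)"
proof -
  \<comment> \<open>At the integers neither the majorant 2/x nor continuity of the potential in y is
    available, because division by 0 gives 0; the integrands are set to 0 there.\<close>
  define cut where "cut f r = (if r \<in> \<int> then 0 else f r)" for f :: "real \<Rightarrow> real" and r
  have cut: "integral {s..t} (cut f) = integral {s..t} f" for f
    by (rule integral_spike[of "\<int> \<inter> {s..t}"]) (auto simp: cut_def finite_Ints_Icc)
  have cutint: "cut f integrable_on {s..t}" if "f integrable_on {s..t}" for f
    using that by (rule integrable_spike_finite[OF finite_Ints_Icc[of s t], rotated]) (auto simp: cut_def)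
  have "(\<lambda>k. integral {s..t} (cut (pot (Y k)))) \<longlonglongrightarrow> integral {s..t} (cut (pot y))"
  proof (rule dominated_convergence(2))
    show "cut (pot (Y k)) integrable_on {s..t}" for k
      by (intro cutint pot_integrable cont)
    have "(\<lambda>r. 2 * (1 / x r)) integrable_on {s..t}"
      by (rule integrable_on_mult_right[OF inverse_x_integrable])
    then show "cut (\<lambda>r. 2 * (1 / x r)) integrable_on {s..t}" by (rule cutint)
    show "norm (cut (pot (Y k)) r) \<le> cut (\<lambda>r. 2 * (1 / x r)) r" for k r
      using pot_nonneg pot_le by (auto simp: cut_def)
    show "(\<lambda>k. cut (pot (Y k)) r) \<longlonglongrightarrow> cut (pot y) r" if "r \<in> {s..t}" for r
    proof (cases "r \<in> \<int>")
      case False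
      have "(\<lambda>k. 2 / sqrt ((x r)\<^sup>2 + (Y k r)\<^sup>2)) \<longlonglongrightarrow> 2 / sqrt ((x r)\<^sup>2 + (y r)\<^sup>2)"
        using lim[of r] that x_pos[OF False]
        by (intro tendsto_intros) (auto simp: add_pos_nonneg less_imp_neq[THEN not_sym])
      then show ?thesis using False by (simp add: cut_def pot_def)
    qed (simp add: cut_def)
  qed
  then show ?thesis by (simp add: cut)
qed

text \<open>The kinetic part is measured by an arbitrary majorant. A majorant with slack only raises
  the action, so that minimising over pairs of a curve and a majorant amounts to minimising over
  curves.\<close>

definition act :: "(real \<Rightarrow> real) \<Rightarrow> (real \<Rightarrow> real) \<Rightarrow> real \<Rightarrow> real \<Rightarrow> real" where
  "act y E s t = E t - E s + integral {s..t} (pot y)"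

lemma act_refl [simp]: "act y E s s = 0"
  by (simp add: act_def)

lemma pot_integral_nonneg: "continuous_on {s..t} y \<Longrightarrow> 0 \<le> integral {s..t} (pot y)"
  by (intro integral_nonneg pot_integrable) (auto simp: pot_nonneg)

lemma energy_le_act:
  assumes "energy_bound y E s t"
  shows "E t - E s \<le> act y E s t"
  using pot_integral_nonneg[OF energy_bound_continuous[OF assms]] by (simp add: act_def)

lemma act_nonneg:
  assumes "energy_bound y E s t" "s \<le> t"
  shows "0 \<le> act y E s t"
  using energy_le_act[OF assms(1)] energy_bound_mono[OF assms(1), of s t] assms(2) by simp

lemma act_combine:
  assumes "energy_bound y E s t" "s \<le> m" "m \<le> t"
  shows "act y E s m + act y E m t = act y E s t"
  using Henstock_Kurzweil_Integration.integral_combine[OF assms(2,3)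
      pot_integrable[OF energy_bound_continuous[OF assms(1)]]]
  by (simp add: act_def)

lemma act_cong:
  assumes "\<And>r. s \<le> r \<Longrightarrow> r \<le> t \<Longrightarrow> z r = y r" "F t - F s = E t - E s"
  shows "act z F s t = act y E s t"
proof -
  have "integral {s..t} (pot z) = integral {s..t} (pot y)"
    by (rule integral_cong) (auto simp: pot_def assms(1))
  then show ?thesis using assms(2) by (simp add: act_def)
qed

lemma act_join:
  assumes "energy_bound y F s m" "energy_bound z G m t" "y m = z m" "s \<le> m" "m \<le> t"
  shows "act (join m y z) (join_energy m F G) s t = act y F s m + act z G m t"
proof -
  have "act (join m y z) (join_energy m F G) s m = act y F s m"
    by (rule act_cong) (auto simp: join_left join_energy_left assms)
  moreover have "act (join m y z) (join_energy m F G) m t = act z G m t"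
    by (rule act_cong) (auto simp: join_right join_energy_right assms)
  ultimately show ?thesis
    using act_combine[OF energy_bound_join[OF assms(1-3)] assms(4,5)] by simp
qed

lemma act_shift:
  assumes "energy_bound y E (s + of_int n) (t + of_int n)"
  shows "act (\<lambda>r. y (r + of_int n)) (\<lambda>r. E (r + of_int n)) s t = act y E (s + of_int n) (t + of_int n)"
proof -
  have "((\<lambda>r. pot y (1 * r + of_int n)) has_integral
      integral {1 * s + of_int n..1 * t + of_int n} (pot y) / 1) {s..t}"
    using pot_integrable[OF energy_bound_continuous[OF assms]]
    by (intro has_integral_affine_real) auto
  moreover have "pot (\<lambda>r. y (r + of_int n)) = (\<lambda>r. pot y (1 * r + of_int n))"
    by (simp add: pot_def x_add_int fun_eq_iff)
  ultimately show ?thesis by (simp add: act_def integral_unique)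
qed

lemma act_reflect: "act (\<lambda>r. y (- r)) (\<lambda>r. - E (- r)) (- t) (- s) = act y E s t"
proof -
  have "pot (\<lambda>r. y (- r)) = (\<lambda>r. pot y (- r))"
    by (simp add: pot_def x_minus fun_eq_iff)
  then show ?thesis by (simp add: act_def integral_reflect_real)
qed

subsection \<open>Local minimisers with prescribed signs\<close>

definition signed :: "(int \<Rightarrow> int) \<Rightarrow> (real \<Rightarrow> real) \<Rightarrow> real \<Rightarrow> real \<Rightarrow> bool" where
  "signed a y s t \<longleftrightarrow> (\<forall>n. s \<le> of_int n \<longrightarrow> of_int n \<le> t \<longrightarrow> 0 \<le> of_int (a n) * y (of_int n))"

definition admissible :: "(int \<Rightarrow> int) \<Rightarrow> (real \<Rightarrow> real) \<Rightarrow> (real \<Rightarrow> real) \<Rightarrow> real \<Rightarrow> real \<Rightarrow> bool" where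
  "admissible a y E s t \<longleftrightarrow> energy_bound y E s t \<and> signed a y s t"

definition locmin :: "(int \<Rightarrow> int) \<Rightarrow> (real \<Rightarrow> real) \<Rightarrow> (real \<Rightarrow> real) \<Rightarrow> bool" where
  "locmin a y E \<longleftrightarrow> (\<forall>s t. admissible a y E s t) \<and>
     (\<forall>s t z F. s \<le> t \<longrightarrow> admissible a z F s t \<longrightarrow> z s = y s \<longrightarrow> z t = y t \<longrightarrow>
        act y E s t \<le> act z F s t)"

lemma locmin_admissible: "locmin a y E \<Longrightarrow> admissible a y E s t"
  and locmin_act_le: "locmin a y E \<Longrightarrow> s \<le> t \<Longrightarrow> admissible a z F s t \<Longrightarrow> z s = y s \<Longrightarrow> z t = y t \<Longrightarrow>
     act y E s t \<le> act z F s t"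
  unfolding locmin_def by auto

lemma locmin_energy_bound: "locmin a y E \<Longrightarrow> energy_bound y E s t"
  and locmin_signed: "locmin a y E \<Longrightarrow> signed a y s t"
  using locmin_admissible[of a y E s t] by (auto simp: admissible_def)

lemma locmin_continuous: "locmin a y E \<Longrightarrow> continuous_on {s..t} y"
  using energy_bound_continuous locmin_energy_bound by blast

lemma continuous_on_UNIV_realI:
  fixes y :: "real \<Rightarrow> real"
  assumes "\<And>s t. continuous_on {s..t} y"
  shows "continuous_on UNIV y"
proof -
  have "isCont y t" for t
    using continuous_on_interior[OF assms[of "t - 1" "t + 1"], of t] by simp
  then show ?thesis by (simp add: continuous_on_eq_continuous_at)
qed

lemma locmin_continuous_UNIV: "locmin a y E \<Longrightarrow> continuous_on UNIV y"
  by (rule continuous_on_UNIV_realI) (rule locmin_continuous)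

lemma locmin_sign: "locmin a y E \<Longrightarrow> 0 \<le> of_int (a n) * y (of_int n)"
  using locmin_signed[of a y E "of_int n" "of_int n"] by (simp add: signed_def)

lemma admissible_subset: "admissible a y E s t \<Longrightarrow> s \<le> s' \<Longrightarrow> t' \<le> t \<Longrightarrow> admissible a y E s' t'"
  unfolding admissible_def signed_def by (auto intro: energy_bound_subset)

lemma admissible_join:
  assumes "admissible a y F s m" "admissible a z G m t" "y m = z m"
  shows "admissible a (join m y z) (join_energy m F G) s t"
  unfolding admissible_def
proof
  show "energy_bound (join m y z) (join_energy m F G) s t"
    using assms by (intro energy_bound_join) (auto simp: admissible_def)
  show "signed a (join m y z) s t"
    using assms unfolding admissible_def signed_def join_def
    by (metis linorder_not_less order_less_imp_le)
qed

section \<open>Replacing an arc of a curve\<close>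

definition patch :: "real \<Rightarrow> real \<Rightarrow> (real \<Rightarrow> real) \<Rightarrow> (real \<Rightarrow> real) \<Rightarrow> real \<Rightarrow> real" where
  "patch s t y z = join s y (join t z y)"

definition patch_energy :: "real \<Rightarrow> real \<Rightarrow> (real \<Rightarrow> real) \<Rightarrow> (real \<Rightarrow> real) \<Rightarrow> real \<Rightarrow> real" where
  "patch_energy s t E F = join_energy s E (join_energy t F E)"

context
  fixes a :: "int \<Rightarrow> int" and y E z F :: "real \<Rightarrow> real" and s t :: real
  assumes ends: "z s = y s" "z t = y t" "s \<le> t"
begin

lemma patch_inside: "s \<le> r \<Longrightarrow> r \<le> t \<Longrightarrow> patch s t y z r = z r"
  and patch_outside: "r \<le> s \<or> t \<le> r \<Longrightarrow> patch s t y z r = y r"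
  using ends by (auto simp: patch_def join_def)

lemma admissible_patch:
  assumes "admissible a y E s' s" "admissible a z F s t" "admissible a y E t t'"
  shows "admissible a (patch s t y z) (patch_energy s t E F) s' t'"
  unfolding patch_def patch_energy_def
  by (intro admissible_join assms) (use ends in \<open>auto simp: join_def\<close>)

lemma act_patch:
  assumes "admissible a y E s' s" "admissible a z F s t" "admissible a y E t t'" "s' \<le> s" "t \<le> t'"
  shows "act (patch s t y z) (patch_energy s t E F) s' t' = act y E s' s + act z F s t + act y E t t'"
proof -
  have "act (patch s t y z) (patch_energy s t E F) s' t' =
      act y E s' s + act (join t z y) (join_energy t F E) s t'"
    unfolding patch_def patch_energy_def
    by (intro act_join energy_bound_join) (use assms ends in \<open>auto simp: admissible_def join_def\<close>)
  also have "act (join t z y) (join_energy t F E) s t' = act z F s t + act y E t t'"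
    by (intro act_join) (use assms ends in \<open>auto simp: admissible_def\<close>)
  finally show ?thesis by simp
qed

end

text \<open>On a window that contains both intervals, a competitor of the patched curve yields a
  competitor of y, and there the patched curve has at most the action of y. The use: an exchange of
  arcs at no cost gives another minimiser, which cannot have corners.\<close>

lemma locmin_patch:
  assumes lm: "locmin a y E" and adm: "admissible a z F s0 t0"
    and ends: "z s0 = y s0" "z t0 = y t0" and le: "act z F s0 t0 \<le> act y E s0 t0" and "s0 \<le> t0"
  shows "locmin a (patch s0 t0 y z) (patch_energy s0 t0 E F)"
proof -
  define z' F' where "z' = patch s0 t0 y z" and "F' = patch_energy s0 t0 E F"
  have adm': "admissible a z' F' s t" for s t
    unfolding z'_def F'_def
    using admissible_patch[OF ends \<open>s0 \<le> t0\<close>, of a E s F t] lm adm locmin_admissible by blast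
  have "act z' F' s t \<le> act w H s t"
    if "s \<le> t" and w: "admissible a w H s t" "w s = z' s" "w t = z' t" for s t w H
  proof -
    define s' t' where "s' = min s s0" and "t' = max t t0"
    have le': "s' \<le> s" "s' \<le> s0" "t \<le> t'" "t0 \<le> t'" by (auto simp: s'_def t'_def)
    define W where "W = patch s t z' w"
    define H' where "H' = patch_energy s t F' H"
    have admW: "admissible a W H' s' t'"
      unfolding W_def H'_def using admissible_patch[OF w(2,3) \<open>s \<le> t\<close>, of a F' s' H t'] w adm' by blast
    have "W s' = y s'" "W t' = y t'"
      using patch_outside[OF w(2,3) \<open>s \<le> t\<close>] patch_outside[OF ends \<open>s0 \<le> t0\<close>] le'
      by (auto simp: W_def z'_def)
    then have "act y E s' t' \<le> act W H' s' t'"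
      using \<open>s \<le> t\<close> le' by (intro locmin_act_le[OF lm _ admW]) auto
    also have "\<dots> = act z' F' s' s + act w H s t + act z' F' t t'"
      unfolding W_def H'_def using act_patch[OF w(2,3) \<open>s \<le> t\<close>] w adm' le' by blast
    finally have 1: "act y E s' t' \<le> act z' F' s' s + act w H s t + act z' F' t t'" .
    have "act z' F' s' t' = act y E s' s0 + act z F s0 t0 + act y E t0 t'"
      unfolding z'_def F'_def using act_patch[OF ends \<open>s0 \<le> t0\<close>] adm locmin_admissible[OF lm] le' by blast
    also have "\<dots> \<le> act y E s' s0 + act y E s0 t0 + act y E t0 t'" using le by simp
    also have "\<dots> = act y E s' t'"
      using act_combine[OF locmin_energy_bound[OF lm], of s' s0 t0]
        act_combine[OF locmin_energy_bound[OF lm], of s' t0 t'] le' \<open>s0 \<le> t0\<close> by simp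
    finally have 2: "act z' F' s' t' \<le> act y E s' t'" .
    have eb: "energy_bound z' F' u v" for u v using adm' by (simp add: admissible_def)
    have "act z' F' s' t' = act z' F' s' s + act z' F' s t + act z' F' t t'"
      using act_combine[OF eb, of s' s t] act_combine[OF eb, of s' t t'] le' \<open>s \<le> t\<close> by simp
    then show ?thesis using 1 2 by simp
  qed
  then show ?thesis using adm' unfolding locmin_def z'_def F'_def by blast
qed

text \<open>It suffices to test minimality on windows that are large enough.\<close>

lemma locminI_large:
  assumes adm: "\<And>s t. admissible a y E s t"
    and min: "\<And>s t z F. s \<le> t \<Longrightarrow> admissible a z F s t \<Longrightarrow> z s = y s \<Longrightarrow> z t = y t \<Longrightarrow>
      \<exists>s' t'. s' \<le> s \<and> t \<le> t' \<and> act y E s' t' \<le> act (patch s t y z) (patch_energy s t E F) s' t'"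
  shows "locmin a y E"
  unfolding locmin_def
proof (intro conjI allI impI adm)
  fix s t z F assume h: "s \<le> t" "admissible a z F s t" "z s = y s" "z t = y t"
  obtain s' t' where le: "s' \<le> s" "t \<le> t'"
    and "act y E s' t' \<le> act (patch s t y z) (patch_energy s t E F) s' t'"
    using min[OF h] by blast
  then have "act y E s' t' \<le> act y E s' s + act z F s t + act y E t t'"
    using act_patch[OF h(3,4,1) adm h(2) adm] by simp
  moreover have eb: "energy_bound y E u v" for u v using adm by (simp add: admissible_def)
  moreover have "act y E s' t' = act y E s' s + act y E s t + act y E t t'"
    using act_combine[OF eb, of s' s t] act_combine[OF eb, of s' t t'] le h(1) by simp
  ultimately show "act y E s t \<le> act z F s t" by simp
qed

lemma admissible_shift:
  assumes "admissible a y E (s + of_int n) (t + of_int n)"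
  shows "admissible (\<lambda>k. a (k + n)) (\<lambda>r. y (r + of_int n)) (\<lambda>r. E (r + of_int n)) s t"
  using assms unfolding admissible_def signed_def
  by (auto intro!: energy_bound_shift) (metis add_le_cancel_right of_int_add)

lemma admissible_reflect:
  assumes "admissible a y E s t"
  shows "admissible (\<lambda>k. a (- k)) (\<lambda>r. y (- r)) (\<lambda>r. - E (- r)) (- t) (- s)"
  using assms unfolding admissible_def signed_def
  by (auto intro!: energy_bound_reflect) (metis minus_le_iff le_minus_iff of_int_minus)

lemma locmin_reflect:
  assumes "locmin a y E"
  shows "locmin (\<lambda>k. a (- k)) (\<lambda>r. y (- r)) (\<lambda>r. - E (- r))"
  unfolding locmin_def
proof (intro conjI allI impI)
  show "admissible (\<lambda>k. a (- k)) (\<lambda>r. y (- r)) (\<lambda>r. - E (- r)) s t" for s t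
    using admissible_reflect[OF locmin_admissible[OF assms], of "- s" "- t"] by simp
  fix s t z F
  assume h: "s \<le> t" "admissible (\<lambda>k. a (- k)) z F s t" "z s = y (- s)" "z t = y (- t)"
  have "admissible a (\<lambda>r. z (- r)) (\<lambda>r. - F (- r)) (- t) (- s)"
    using admissible_reflect[OF h(2)] by simp
  then have "act y E (- t) (- s) \<le> act (\<lambda>r. z (- r)) (\<lambda>r. - F (- r)) (- t) (- s)"
    using h by (intro locmin_act_le[OF assms]) auto
  then show "act (\<lambda>r. y (- r)) (\<lambda>r. - E (- r)) s t \<le> act z F s t"
    using act_reflect[of y E "- s" "- t"] by (simp add: act_reflect)
qed

lemma locmin_shift:
  assumes "locmin a y E"
  shows "locmin (\<lambda>k. a (k + n)) (\<lambda>r. y (r + of_int n)) (\<lambda>r. E (r + of_int n))"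
  unfolding locmin_def
proof (intro conjI allI impI)
  show "admissible (\<lambda>k. a (k + n)) (\<lambda>r. y (r + of_int n)) (\<lambda>r. E (r + of_int n)) s t" for s t
    by (rule admissible_shift[OF locmin_admissible[OF assms]])
  fix s t z F
  assume h: "s \<le> t" "admissible (\<lambda>k. a (k + n)) z F s t" "z s = y (s + of_int n)" "z t = y (t + of_int n)"
  have "admissible a (\<lambda>r. z (r + of_int (- n))) (\<lambda>r. F (r + of_int (- n))) (s + of_int n) (t + of_int n)"
    using admissible_shift[of "\<lambda>k. a (k + n)" z F "s + of_int n" "- n" "t + of_int n"] h(2) by simp
  then have "act y E (s + of_int n) (t + of_int n)
      \<le> act (\<lambda>r. z (r + of_int (- n))) (\<lambda>r. F (r + of_int (- n))) (s + of_int n) (t + of_int n)"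
    using h by (intro locmin_act_le[OF assms]) auto
  also have "\<dots> = act z F s t"
    using act_shift[of z F "s + of_int n" "- n" "t + of_int n"] h(2) by (simp add: admissible_def)
  finally show "act (\<lambda>r. y (r + of_int n)) (\<lambda>r. E (r + of_int n)) s t \<le> act z F s t"
    by (simp add: act_shift locmin_energy_bound[OF assms])
qed

end

subsection \<open>The equation of motion\<close>

text \<open>Second order Taylor estimate of u^(-1/2) from u = a^2 to u = b^2, from above because it
  will bound the potential of a competitor. The exact remainder is (b - a)^2 (b + 2a) / (2 b
  a^3).\<close>

lemma inverse_sqrt_quadratic_bound:
  fixes a b \<rho> :: real
  assumes "0 < \<rho>" "\<rho> \<le> a" "\<rho> \<le> b"
  shows "1 / b \<le> 1 / a - (b\<^sup>2 - a\<^sup>2) / (2 * a ^ 3) + (b\<^sup>2 - a\<^sup>2)\<^sup>2 / (2 * \<rho> ^ 5)"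
proof -
  have pos: "0 < a" "0 < b" using assms by auto
  have "\<rho> * \<rho> ^ 3 \<le> b * a ^ 3"
    using assms pos by (intro mult_mono power_mono) auto
  moreover have "\<rho> * (b + 2 * a) \<le> (a + b) * (a + b)"
  proof -
    have "\<rho> * (b + 2 * a) \<le> \<rho> * (2 * (a + b))" using assms pos by (intro mult_left_mono) auto
    also have "\<dots> \<le> (a + b) * (a + b)"
      using mult_right_mono[of "2 * \<rho>" "a + b" "a + b"] assms pos by (simp add: algebra_simps)
    finally show ?thesis .
  qed
  moreover have "0 \<le> b * a ^ 3" "0 \<le> \<rho> * (b + 2 * a)" using assms pos by auto
  ultimately have "(\<rho> * \<rho> ^ 3) * (\<rho> * (b + 2 * a)) \<le> (b * a ^ 3) * ((a + b) * (a + b))"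
    by (rule mult_mono)
  then have le: "(b + 2 * a) * \<rho> ^ 5 \<le> (a + b)\<^sup>2 * (b * a ^ 3)"
    by (simp add: power2_eq_square eval_nat_numeral mult_ac)
  have "1 / b - 1 / a + (b\<^sup>2 - a\<^sup>2) / (2 * a ^ 3) = (b - a)\<^sup>2 * ((b + 2 * a) / (2 * (b * a ^ 3)))"
    using pos by (simp add: field_simps power2_eq_square eval_nat_numeral)
  also have "(b + 2 * a) / (2 * (b * a ^ 3)) \<le> (a + b)\<^sup>2 / (2 * \<rho> ^ 5)"
    using le pos assms(1) by (simp add: field_simps)
  then have "(b - a)\<^sup>2 * ((b + 2 * a) / (2 * (b * a ^ 3))) \<le> (b - a)\<^sup>2 * ((a + b)\<^sup>2 / (2 * \<rho> ^ 5))"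
    by (rule mult_left_mono) simp
  also have "\<dots> = (b\<^sup>2 - a\<^sup>2)\<^sup>2 / (2 * \<rho> ^ 5)"
    by (simp add: power2_eq_square algebra_simps)
  finally show ?thesis by simp
qed

lemma eq_zero_if_quadratic_nonneg:
  fixes q C e :: real
  assumes "0 < e" and nonneg: "\<And>\<epsilon>. \<bar>\<epsilon>\<bar> \<le> e \<Longrightarrow> 0 \<le> \<epsilon> * q + \<epsilon>\<^sup>2 * C"
  shows "q = 0"
proof (rule ccontr)
  assume "q \<noteq> 0"
  define D where "D = \<bar>C\<bar> + 1"
  have D: "D > 0" "C < D" by (auto simp: D_def)
  \<comment> \<open>Small enough for the quadratic term to be at most half of the linear one, which
    is made negative by the choice of sign.\<close>
  define \<delta> where "\<delta> = min e (\<bar>q\<bar> / (2 * D))"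
  have \<delta>: "0 < \<delta>" "\<delta> \<le> e" "\<delta> * D \<le> \<bar>q\<bar> / 2"
    using assms(1) \<open>q \<noteq> 0\<close> D unfolding \<delta>_def by (auto simp: min_def field_simps)
  have "\<bar>- \<delta> * sgn q\<bar> \<le> e" using \<delta> by (simp add: abs_mult abs_sgn_eq)
  from nonneg[OF this] have "0 \<le> - \<delta> * (sgn q * q) + \<delta>\<^sup>2 * (sgn q)\<^sup>2 * C"
    by (simp add: power_mult_distrib mult_ac)
  then have "\<delta> * \<bar>q\<bar> \<le> \<delta>\<^sup>2 * C"
    using \<open>q \<noteq> 0\<close> by (simp add: sgn_real_def abs_if split: if_splits)
  also have "\<dots> \<le> \<delta>\<^sup>2 * D" using D by (intro mult_left_mono) auto
  also have "\<dots> = \<delta> * (\<delta> * D)" by (simp add: power2_eq_square)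
  also have "\<dots> \<le> \<delta> * (\<bar>q\<bar> / 2)" using \<delta> by (intro mult_left_mono) auto
  finally show False using \<delta>(1) \<open>q \<noteq> 0\<close> by simp
qed

context sitnikov
begin

definition force :: "(real \<Rightarrow> real) \<Rightarrow> real \<Rightarrow> real" where
  "force y r = y r / sqrt ((x r)\<^sup>2 + (y r)\<^sup>2) ^ 3"

lemma force_continuous:
  assumes "continuous_on S y" "\<And>r. r \<in> S \<Longrightarrow> (x r)\<^sup>2 + (y r)\<^sup>2 \<noteq> 0"
  shows "continuous_on S (force y)"
proof -
  have "continuous_on S (\<lambda>r. y r / sqrt ((x r)\<^sup>2 + (y r)\<^sup>2) ^ 3)"
    using assms by (intro continuous_intros x_continuous) auto
  then show ?thesis by (simp add: force_def[abs_def])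
qed

lemma pot_upper_bound:
  assumes "0 < \<rho>" "\<rho>\<^sup>2 \<le> (x r)\<^sup>2 + (y r)\<^sup>2" "\<rho>\<^sup>2 \<le> (x r)\<^sup>2 + (z r)\<^sup>2"
    and z: "z r = y r + d" and "\<bar>y r\<bar> \<le> R" "\<bar>d\<bar> \<le> 1"
  shows "pot z r \<le> pot y r - 2 * d * force y r + (2 * R + 1)\<^sup>2 / \<rho> ^ 5 * d\<^sup>2"
proof -
  define a b where "a = sqrt ((x r)\<^sup>2 + (y r)\<^sup>2)" and "b = sqrt ((x r)\<^sup>2 + (z r)\<^sup>2)"
  have ab: "\<rho> \<le> a" "\<rho> \<le> b" unfolding a_def b_def using assms by (auto intro: real_le_rsqrt)
  have sq: "a\<^sup>2 = (x r)\<^sup>2 + (y r)\<^sup>2" "b\<^sup>2 = (x r)\<^sup>2 + (z r)\<^sup>2" by (simp_all add: a_def b_def)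
  have diff: "b\<^sup>2 - a\<^sup>2 = 2 * y r * d + d\<^sup>2" unfolding sq z by (simp add: power2_eq_square algebra_simps)
  have "\<bar>2 * y r * d + d\<^sup>2\<bar> \<le> 2 * \<bar>y r\<bar> * \<bar>d\<bar> + \<bar>d\<bar> * \<bar>d\<bar>"
    by (rule order_trans[OF abs_triangle_ineq]) (simp add: abs_mult power2_eq_square)
  also have "\<dots> \<le> 2 * R * \<bar>d\<bar> + 1 * \<bar>d\<bar>"
    using assms by (intro add_mono mult_right_mono) auto
  finally have "\<bar>b\<^sup>2 - a\<^sup>2\<bar> \<le> \<bar>(2 * R + 1) * d\<bar>"
    unfolding diff using assms(5) by (simp add: abs_mult algebra_simps)
  then have "(b\<^sup>2 - a\<^sup>2)\<^sup>2 \<le> ((2 * R + 1) * d)\<^sup>2" by (simp add: abs_le_square_iff)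
  then have 1: "(b\<^sup>2 - a\<^sup>2)\<^sup>2 / \<rho> ^ 5 \<le> (2 * R + 1)\<^sup>2 / \<rho> ^ 5 * d\<^sup>2"
    using assms(1) by (simp add: divide_right_mono power_mult_distrib)
  have 2: "(b\<^sup>2 - a\<^sup>2) / a ^ 3 = 2 * d * (y r / a ^ 3) + d\<^sup>2 / a ^ 3"
    unfolding diff by (simp add: add_divide_distrib)
  have 3: "0 \<le> d\<^sup>2 / a ^ 3" using ab assms(1) by simp
  have "2 * (1 / b) \<le> 2 * (1 / a - (b\<^sup>2 - a\<^sup>2) / (2 * a ^ 3) + (b\<^sup>2 - a\<^sup>2)\<^sup>2 / (2 * \<rho> ^ 5))"
    by (rule mult_left_mono[OF inverse_sqrt_quadratic_bound[OF assms(1) ab]]) simp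
  also have "\<dots> = 2 / a - (b\<^sup>2 - a\<^sup>2) / a ^ 3 + (b\<^sup>2 - a\<^sup>2)\<^sup>2 / \<rho> ^ 5"
    unfolding distrib_left right_diff_distrib by (simp only: times_divide_eq_right mult_divide_mult_cancel_left_if) simp
  finally show ?thesis using 1 2 3 unfolding pot_def force_def a_def[symmetric] b_def[symmetric]
    by simp
qed

definition hat :: "real \<Rightarrow> real \<Rightarrow> real \<Rightarrow> real \<Rightarrow> real" where
  "hat s m t r = (if r \<le> m then (r - s) / (m - s) else (t - r) / (t - m))"

lemma hat_range: "s < m \<Longrightarrow> m < t \<Longrightarrow> s \<le> r \<Longrightarrow> r \<le> t \<Longrightarrow> hat s m t r \<in> {0..1}"
  by (auto simp: hat_def)

lemma hat_continuous:
  assumes "s < m" "m < t"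
  shows "continuous_on {s..t} (hat s m t)"
proof -
  have "continuous_on ({s..m} \<union> {m..t}) (\<lambda>r. if r \<le> m then (r - s) / (m - s) else (t - r) / (t - m))"
    using assms by (intro continuous_on_cases) (auto intro!: continuous_intros)
  moreover have "{s..m} \<union> {m..t} = {s..t}" using assms by auto
  ultimately show ?thesis by (simp add: hat_def[abs_def])
qed

text \<open>The weak equation is obtained by perturbing with a piecewise affine hat: the energy majorant
  of the perturbed curve is then explicit.\<close>

lemma locmin_weak_equation:
  assumes lm: "locmin a y E" and smt: "s < m" "m < t" and "0 < \<rho>"
    and far: "\<And>r. s \<le> r \<Longrightarrow> r \<le> t \<Longrightarrow> \<rho> \<le> x r \<or> 2 * \<rho> \<le> \<bar>y r\<bar>"
  shows "(y m - y s) / (m - s) - (y t - y m) / (t - m) = integral {s..t} (\<lambda>r. force y r * hat s m t r)"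
proof -
  define c1 c2 where "c1 = 1 / (m - s)" and "c2 = - 1 / (t - m)"
  define Q where "Q = c1 * (y m - y s) + c2 * (y t - y m)"
  define I where "I = integral {s..t} (\<lambda>r. force y r * hat s m t r)"
  have cont: "continuous_on {s..t} y" by (rule locmin_continuous[OF lm])
  have "bounded (y ` {s..t})"
    by (rule compact_imp_bounded[OF compact_continuous_image[OF cont compact_Icc]])
  then obtain R where R: "\<And>r. r \<in> {s..t} \<Longrightarrow> \<bar>y r\<bar> \<le> R"
    unfolding bounded_iff by (metis imageI real_norm_def)
  define K where "K = (2 * R + 1)\<^sup>2 / \<rho> ^ 5"
  have K: "0 \<le> K" using \<open>0 < \<rho>\<close> by (simp add: K_def)
  have rho: "\<rho>\<^sup>2 \<le> (x r)\<^sup>2 + w\<^sup>2" if "\<rho> \<le> x r \<or> \<rho> \<le> \<bar>w\<bar>" for r w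
    using that
  proof
    assume "\<rho> \<le> x r"
    then have "\<rho>\<^sup>2 \<le> (x r)\<^sup>2" using \<open>0 < \<rho>\<close> by (intro power_mono) auto
    then show ?thesis using zero_le_power2[of w] by linarith
  next
    assume "\<rho> \<le> \<bar>w\<bar>"
    then have "\<rho>\<^sup>2 \<le> \<bar>w\<bar>\<^sup>2" using \<open>0 < \<rho>\<close> by (intro power_mono) auto
    then have "\<rho>\<^sup>2 \<le> w\<^sup>2" by simp
    then show ?thesis using zero_le_power2[of "x r"] by linarith
  qed
  have yrho: "\<rho>\<^sup>2 \<le> (x r)\<^sup>2 + (y r)\<^sup>2" if "s \<le> r" "r \<le> t" for r
    using far[OF that] \<open>0 < \<rho>\<close> by (intro rho) auto
  have fcont: "continuous_on {s..t} (force y)"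
  proof (rule force_continuous[OF cont])
    show "(x r)\<^sup>2 + (y r)\<^sup>2 \<noteq> 0" if "r \<in> {s..t}" for r
      using yrho[of r] that zero_less_power[OF \<open>0 < \<rho>\<close>, of 2] by auto
  qed
  have fint: "(\<lambda>r. force y r * hat s m t r) integrable_on {s..t}"
    by (intro integrable_continuous_real continuous_intros fcont hat_continuous smt)
  have "0 \<le> \<epsilon> * (2 * (Q - I)) + \<epsilon>\<^sup>2 * (c1 - c2 + K * (t - s))" if \<epsilon>: "\<bar>\<epsilon>\<bar> \<le> min 1 \<rho>" for \<epsilon>
  proof -
    define z1 where "z1 r = y r + (\<epsilon> * c1) * (r - s) + 0" for r
    define z2 where "z2 r = y r + (\<epsilon> * c2) * (r - t) + 0" for r
    define F1 where "F1 r = E r + 2 * (\<epsilon> * c1) * y r + (\<epsilon> * c1)\<^sup>2 * r" for r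
    define F2 where "F2 r = E r + 2 * (\<epsilon> * c2) * y r + (\<epsilon> * c2)\<^sup>2 * r" for r
    have eb1: "energy_bound z1 F1 s m" and eb2: "energy_bound z2 F2 m t"
      unfolding z1_def F1_def z2_def F2_def
      by (intro energy_bound_add_affine locmin_energy_bound[OF lm])+
    have c: "c1 * (r - s) = (r - s) / (m - s)" "c2 * (r - t) = (t - r) / (t - m)" for r
    proof -
      have "c2 * (r - t) = (- 1 * (r - t)) / (t - m)" by (simp only: c2_def times_divide_eq_left)
      also have "- 1 * (r - t) = t - r" by simp
      finally show "c2 * (r - t) = (t - r) / (t - m)" .
    qed (simp add: c1_def)
    have ends: "z1 s = y s" "z2 t = y t" "z1 m = z2 m"
      using c(1)[of m] c(2)[of m] smt by (simp_all add: z1_def z2_def mult.assoc)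
    define z F where "z = join m z1 z2" and "F = join_energy m F1 F2"
    have eb: "energy_bound z F s t"
      unfolding z_def F_def by (rule energy_bound_join[OF eb1 eb2 ends(3)])
    have z: "z r = y r + \<epsilon> * hat s m t r" for r
      using c[of r] by (simp add: z_def join_def z1_def z2_def hat_def mult.assoc)
    have small: "\<bar>\<epsilon> * hat s m t r\<bar> \<le> \<bar>\<epsilon>\<bar>" if "s \<le> r" "r \<le> t" for r
      using hat_range[OF smt that] by (simp add: abs_mult mult_left_le)
    \<comment> \<open>At an integer x vanishes, so y is at least 2 \<rho> in absolute value, and a
      perturbation of size at most \<rho> keeps the prescribed sign.\<close>
    have "0 \<le> of_int (a n) * z (of_int n)" if "s \<le> of_int n" "of_int n \<le> t" for n
    proof -
      have "2 * \<rho> \<le> \<bar>y (of_int n)\<bar>" using far[OF that] x_Ints[of "of_int n"] \<open>0 < \<rho>\<close> by auto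
      then show ?thesis
        using small[OF that] \<epsilon> locmin_sign[OF lm, of n] \<open>0 < \<rho>\<close> unfolding z zero_le_mult_iff
        by auto
    qed
    then have "admissible a z F s t" using eb by (simp add: admissible_def signed_def)
    then have le: "act y E s t \<le> act z F s t"
      using smt ends by (intro locmin_act_le[OF lm]) (auto simp: z_def join_def)
    have sq: "(\<epsilon> * c1)\<^sup>2 * (m - s) = \<epsilon>\<^sup>2 * c1" "(\<epsilon> * c2)\<^sup>2 * (t - m) = - (\<epsilon>\<^sup>2 * c2)"
    proof -
      have "c1 * (m - s) = 1" "c2 * (t - m) = - 1" using smt by (simp_all add: c1_def c2_def)
      moreover have "(\<epsilon> * c1)\<^sup>2 * (m - s) = \<epsilon>\<^sup>2 * c1 * (c1 * (m - s))"
        "(\<epsilon> * c2)\<^sup>2 * (t - m) = \<epsilon>\<^sup>2 * c2 * (c2 * (t - m))"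
        by (simp_all only: power2_eq_square mult_ac)
      ultimately show "(\<epsilon> * c1)\<^sup>2 * (m - s) = \<epsilon>\<^sup>2 * c1" "(\<epsilon> * c2)\<^sup>2 * (t - m) = - (\<epsilon>\<^sup>2 * c2)"
        by simp_all
    qed
    have "F t - F s = (F1 m - F1 s) + (F2 t - F2 m)"
      using smt by (simp add: F_def join_energy_def)
    also have "\<dots> = E t - E s + 2 * \<epsilon> * Q + ((\<epsilon> * c1)\<^sup>2 * (m - s) + (\<epsilon> * c2)\<^sup>2 * (t - m))"
      by (simp add: F1_def F2_def Q_def algebra_simps)
    finally have dF: "F t - F s = E t - E s + 2 * \<epsilon> * Q + \<epsilon>\<^sup>2 * (c1 - c2)"
      unfolding sq by (simp add: right_diff_distrib)
    have bound: "pot z r \<le> pot y r - 2 * \<epsilon> * (force y r * hat s m t r) + K * \<epsilon>\<^sup>2"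
      if r: "s \<le> r" "r \<le> t" for r
    proof -
      have "\<rho> \<le> x r \<or> \<rho> \<le> \<bar>z r\<bar>"
        using far[OF r] small[OF r] \<epsilon> unfolding z by auto
      then have "pot z r \<le> pot y r - 2 * (\<epsilon> * hat s m t r) * force y r + K * (\<epsilon> * hat s m t r)\<^sup>2"
        unfolding K_def using small[OF r] \<epsilon> R[of r] r
        by (intro pot_upper_bound[OF \<open>0 < \<rho>\<close> yrho rho z]) auto
      moreover have "K * (\<epsilon> * hat s m t r)\<^sup>2 \<le> K * \<epsilon>\<^sup>2"
        using small[OF r] K by (intro mult_left_mono) (auto simp: abs_le_square_iff)
      ultimately show ?thesis by (simp add: mult_ac)
    qed
    have "integral {s..t} (pot z)
        \<le> integral {s..t} (\<lambda>r. pot y r - 2 * \<epsilon> * (force y r * hat s m t r) + K * \<epsilon>\<^sup>2)"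
      by (intro integral_le pot_integrable energy_bound_continuous[OF eb] integrable_add integrable_diff
          integrable_on_mult_right fint cont integrable_const_ivl)
        (use bound in auto)
    also have "\<dots> = integral {s..t} (pot y) - 2 * \<epsilon> * I + K * \<epsilon>\<^sup>2 * (t - s)"
      using smt unfolding I_def
      by (subst integral_add integral_diff,
          auto intro!: pot_integrable cont integrable_diff integrable_on_mult_right fint)+
    finally have "0 \<le> 2 * \<epsilon> * Q + \<epsilon>\<^sup>2 * (c1 - c2) - 2 * \<epsilon> * I + K * \<epsilon>\<^sup>2 * (t - s)"
      using le dF unfolding act_def by simp
    then show ?thesis by (simp add: algebra_simps)
  qed
  then have "2 * (Q - I) = 0" using \<open>0 < \<rho>\<close> by (intro eq_zero_if_quadratic_nonneg[of "min 1 \<rho>"]) auto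
  then have "Q = I" by simp
  then show ?thesis unfolding Q_def I_def c1_def c2_def by (simp add: field_class.field_divide_inverse mult.commute)
qed

text \<open>Subtracting a second primitive of the force turns the weak equation into affinity.\<close>

lemma locmin_equation_interval:
  assumes lm: "locmin a y E" and "s < t" "0 < \<rho>"
    and far: "\<And>r. s \<le> r \<Longrightarrow> r \<le> t \<Longrightarrow> \<rho> \<le> x r \<or> 2 * \<rho> \<le> \<bar>y r\<bar>"
  shows "\<exists>v. \<forall>r. s < r \<longrightarrow> r < t \<longrightarrow>
    (y has_real_derivative v r) (at r) \<and> (v has_real_derivative - force y r) (at r)"
proof -
  define g1 where "g1 r = integral {s..r} (force y)" for r
  define g2 where "g2 r = integral {s..r} g1" for r
  have fcont: "continuous_on {s..t} (force y)"
  proof (rule force_continuous[OF locmin_continuous[OF lm]])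
    fix r assume "r \<in> {s..t}"
    then have "x r \<noteq> 0 \<or> y r \<noteq> 0" using far[of r] \<open>0 < \<rho>\<close> by auto
    then show "(x r)\<^sup>2 + (y r)\<^sup>2 \<noteq> 0" by (simp add: sum_power2_eq_zero_iff)
  qed
  have d1: "(g1 has_real_derivative force y r) (at r within {s..t})" if "r \<in> {s..t}" for r
    unfolding g1_def[abs_def] by (rule integral_has_real_derivative[OF fcont that])
  then have "continuous_on {s..t} g1" using DERIV_continuous_on by blast
  then have d2: "(g2 has_real_derivative g1 r) (at r within {s..t})" if "r \<in> {s..t}" for r
    unfolding g2_def[abs_def] using that by (rule integral_has_real_derivative)
  have g0: "g1 s = 0" "g2 s = 0" by (auto simp: g1_def g2_def)
  define k where "k = (y t + g2 t - y s) / (t - s)"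
  have y_eq: "y m = y s + k * (m - s) - g2 m" if m: "s < m" "m < t" for m
  proof -
    \<comment> \<open>Integration by parts: on either side of m the force times the hat has a
      primitive explicit in \<open>g1\<close> and \<open>g2\<close>. In the sum the values of
      \<open>g1\<close> at m cancel.\<close>
    have i1: "((\<lambda>r. force y r * ((r - s) / (m - s))) has_integral
        (g1 m * (m - s) - g2 m) / (m - s) - (g1 s * (s - s) - g2 s) / (m - s)) {s..m}"
    proof (rule fundamental_theorem_of_calculus)
      fix r assume r: "r \<in> {s..m}"
      have d1': "(g1 has_real_derivative force y r) (at r within {s..m})"
        and d2': "(g2 has_real_derivative g1 r) (at r within {s..m})"
        using d1[of r] d2[of r] r m by (auto intro: DERIV_subset)
      have "((\<lambda>r. (g1 r * (r - s) - g2 r) / (m - s)) has_real_derivative force y r * ((r - s) / (m - s)))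
          (at r within {s..m})"
        using m by (auto intro!: derivative_eq_intros d1' d2')
      then show "((\<lambda>r. (g1 r * (r - s) - g2 r) / (m - s)) has_vector_derivative force y r * ((r - s) / (m - s)))
          (at r within {s..m})"
        by (simp add: has_real_derivative_iff_has_vector_derivative)
    qed (use m in simp)
    have i2: "((\<lambda>r. force y r * ((t - r) / (t - m))) has_integral
        (g1 t * (t - t) + g2 t) / (t - m) - (g1 m * (t - m) + g2 m) / (t - m)) {m..t}"
    proof (rule fundamental_theorem_of_calculus)
      fix r assume r: "r \<in> {m..t}"
      have d1': "(g1 has_real_derivative force y r) (at r within {m..t})"
        and d2': "(g2 has_real_derivative g1 r) (at r within {m..t})"
        using d1[of r] d2[of r] r m by (auto intro: DERIV_subset)
      have "((\<lambda>r. (g1 r * (t - r) + g2 r) / (t - m)) has_real_derivative force y r * ((t - r) / (t - m)))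
          (at r within {m..t})"
        using m by (auto intro!: derivative_eq_intros d1' d2')
      then show "((\<lambda>r. (g1 r * (t - r) + g2 r) / (t - m)) has_vector_derivative force y r * ((t - r) / (t - m)))
          (at r within {m..t})"
        by (simp add: has_real_derivative_iff_has_vector_derivative)
    qed (use m in simp)
    have j1: "((\<lambda>r. force y r * hat s m t r) has_integral
        (g1 m * (m - s) - g2 m) / (m - s) - (g1 s * (s - s) - g2 s) / (m - s)) {s..m}"
      by (rule has_integral_eq[OF _ i1]) (simp add: hat_def)
    have j2: "((\<lambda>r. force y r * hat s m t r) has_integral
        (g1 t * (t - t) + g2 t) / (t - m) - (g1 m * (t - m) + g2 m) / (t - m)) {m..t}"
      by (rule has_integral_eq[OF _ i2]) (use m in \<open>auto simp: hat_def\<close>)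
    have "integral {s..t} (\<lambda>r. force y r * hat s m t r)
        = (g1 m * (m - s) - g2 m) / (m - s) - (g1 s * (s - s) - g2 s) / (m - s)
          + ((g1 t * (t - t) + g2 t) / (t - m) - (g1 m * (t - m) + g2 m) / (t - m))"
      using m by (intro integral_unique has_integral_combine[OF _ _ j1 j2]) auto
    also have "\<dots> = (g2 t - g2 m) / (t - m) - g2 m / (m - s)"
      using m g0 by (simp add: diff_divide_distrib add_divide_distrib)
    finally have "(y m - y s) / (m - s) - (y t - y m) / (t - m) = (g2 t - g2 m) / (t - m) - g2 m / (m - s)"
      using locmin_weak_equation[OF lm m \<open>0 < \<rho>\<close> far] by simp
    then have "(y m + g2 m - y s) / (m - s) = (y t + g2 t - (y m + g2 m)) / (t - m)"
      by (simp add: diff_divide_distrib add_divide_distrib)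
    then have "(y m + g2 m - y s) * (t - m) = (y t + g2 t - (y m + g2 m)) * (m - s)"
      using m by (simp add: frac_eq_eq)
    then have "(y m + g2 m - y s) * (t - s) = (y t + g2 t - y s) * (m - s)"
      by (simp add: algebra_simps)
    then show ?thesis using m by (simp add: k_def field_simps)
  qed
  define v where "v r = k - g1 r" for r
  have "(y has_real_derivative v r) (at r) \<and> (v has_real_derivative - force y r) (at r)"
    if r: "s < r" "r < t" for r
  proof
    have at: "at r within {s..t} = at r" by (rule at_within_Icc_at[OF r])
    have d1': "(g1 has_real_derivative force y r) (at r)" and d2': "(g2 has_real_derivative g1 r) (at r)"
      using d1[of r] d2[of r] r at by auto
    have d: "((\<lambda>m. y s + k * (m - s) - g2 m) has_real_derivative v r) (at r)"
      unfolding v_def by (auto intro!: derivative_eq_intros d2')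
    have "\<forall>\<^sub>F m in nhds r. y s + k * (m - s) - g2 m = y m"
      unfolding eventually_nhds by (rule exI[of _ "{s<..<t}"]) (use r y_eq in auto)
    from DERIV_cong_ev[OF refl this refl, THEN iffD1, OF d]
    show "(y has_real_derivative v r) (at r)" .
    show "(v has_real_derivative - force y r) (at r)"
      unfolding v_def[abs_def] by (auto intro!: derivative_eq_intros d1')
  qed
  then show ?thesis by blast
qed

text \<open>The factor 2 leaves room for a perturbation of size \<rho> in the first
  variation.\<close>

lemma nonsingular_near:
  assumes "isCont y r0" "(x r0)\<^sup>2 + (y r0)\<^sup>2 \<noteq> 0"
  shows "\<exists>\<rho>>0. \<exists>d>0. \<forall>r. \<bar>r - r0\<bar> \<le> d \<longrightarrow> \<rho> \<le> x r \<or> 2 * \<rho> \<le> \<bar>y r\<bar>"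
proof -
  define g where "g r = max (x r) (\<bar>y r\<bar> / 2)" for r
  have "0 < g r0"
    using assms(2) x_nonneg[of r0] by (auto simp: g_def sum_power2_eq_zero_iff less_max_iff_disj)
  moreover have "isCont g r0" unfolding g_def by (intro continuous_intros x_isCont assms(1)) auto
  ultimately have "\<forall>\<^sub>F r in nhds r0. g r0 / 2 < g r"
    by (intro order_tendstoD(1)[of g "g r0"]) (auto simp: isCont_def tendsto_at_iff_tendsto_nhds)
  then obtain d where d: "d > 0" "\<And>r. \<bar>r - r0\<bar> < d \<Longrightarrow> g r0 / 2 < g r"
    unfolding eventually_nhds_metric by (auto simp: dist_real_def)
  have "g r0 / 2 \<le> x r \<or> 2 * (g r0 / 2) \<le> \<bar>y r\<bar>" if "\<bar>r - r0\<bar> \<le> d / 2" for r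
    using d(2)[of r] that d(1) unfolding g_def by (auto simp: max_def split: if_splits)
  then show ?thesis using d(1) \<open>0 < g r0\<close> by (intro exI[of _ "g r0 / 2"] conjI exI[of _ "d / 2"]) auto
qed

lemma locmin_equation:
  assumes lm: "locmin a y E" and "(x r)\<^sup>2 + (y r)\<^sup>2 \<noteq> 0"
  shows "(y has_real_derivative deriv y r) (at r)" "(deriv y has_real_derivative - force y r) (at r)"
proof -
  have "isCont y r"
    using locmin_continuous_UNIV[OF lm] by (simp add: continuous_on_eq_continuous_at)
  then obtain \<rho> d where \<rho>: "\<rho> > 0" "d > 0" "\<And>q. \<bar>q - r\<bar> \<le> d \<Longrightarrow> \<rho> \<le> x q \<or> 2 * \<rho> \<le> \<bar>y q\<bar>"
    using nonsingular_near[of r y] assms(2) by blast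
  obtain v where v: "\<And>q. r - d < q \<Longrightarrow> q < r + d \<Longrightarrow>
      (y has_real_derivative v q) (at q) \<and> (v has_real_derivative - force y q) (at q)"
    using locmin_equation_interval[OF lm, of "r - d" "r + d" \<rho>] \<rho> by (auto simp: abs_le_iff)
  have eq: "deriv y q = v q" if "r - d < q" "q < r + d" for q
    using v[OF that] by (auto intro: DERIV_imp_deriv)
  show "(y has_real_derivative deriv y r) (at r)" using v[of r] eq[of r] \<rho> by simp
  have "\<forall>\<^sub>F q in nhds r. v q = deriv y q"
    unfolding eventually_nhds by (rule exI[of _ "{r - d<..<r + d}"]) (use eq \<rho> in auto)
  from DERIV_cong_ev[OF refl this refl, THEN iffD1] v[of r] \<rho>
  show "(deriv y has_real_derivative - force y r) (at r)" by auto
qed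

section \<open>Uniqueness for the initial value problem\<close>

lemma force_lipschitz:
  assumes "0 < \<rho>" "\<rho> \<le> sqrt ((x r)\<^sup>2 + (y r)\<^sup>2)" "\<rho> \<le> sqrt ((x r)\<^sup>2 + (z r)\<^sup>2)"
  shows "\<bar>force y r - force z r\<bar> \<le> 4 / \<rho> ^ 3 * \<bar>y r - z r\<bar>"
proof -
  define a b where "a = sqrt ((x r)\<^sup>2 + (y r)\<^sup>2)" and "b = sqrt ((x r)\<^sup>2 + (z r)\<^sup>2)"
  have ab: "\<rho> \<le> a" "\<rho> \<le> b" using assms by (auto simp: a_def b_def)
  then have ab: "\<rho> \<le> a" "\<rho> \<le> b" "0 < a" "0 < b" using assms(1) by auto
  have "a = norm (x r, y r)" "b = norm (x r, z r)" by (auto simp: a_def b_def norm_Pair)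
  then have diff: "\<bar>b - a\<bar> \<le> \<bar>y r - z r\<bar>"
    using norm_triangle_ineq3[of "(x r, z r)" "(x r, y r)"] by (simp add: norm_Pair)
  have zb: "\<bar>z r\<bar> \<le> b" unfolding b_def by (rule real_le_rsqrt) simp
  have le: "1 / (p * q * w) \<le> 1 / \<rho> ^ 3" if "\<rho> \<le> p" "\<rho> \<le> q" "\<rho> \<le> w" for p q w
  proof -
    have "\<rho> * \<rho> * \<rho> \<le> p * q * w" "0 < p * q * w"
      using that assms(1) by (auto intro!: mult_mono mult_pos_pos)
    then show ?thesis using assms(1) by (intro divide_left_mono) (auto simp: power3_eq_cube)
  qed
  \<comment> \<open>The difference 1/a^3 - 1/b^3 telescopes into b - a times three products, and the
    factor z is absorbed by the bound b for it.\<close>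
  have "force y r - force z r = (y r - z r) * (1 / (a * a * a))
      + z r * ((b - a) * (1 / (a * b * b) + 1 / (a * a * b) + 1 / (a * a * a)) / b)"
    unfolding force_def a_def[symmetric] b_def[symmetric] using ab
    by (simp add: field_simps power3_eq_cube)
  also have "\<bar>\<dots>\<bar> \<le> \<bar>y r - z r\<bar> * (1 / (a * a * a))
      + (\<bar>z r\<bar> / b) * (\<bar>b - a\<bar> * (1 / (a * b * b) + 1 / (a * a * b) + 1 / (a * a * a)))"
    using ab by (intro order_trans[OF abs_triangle_ineq]) (simp add: abs_mult)
  also have "\<dots> \<le> \<bar>y r - z r\<bar> * (1 / \<rho> ^ 3) + 1 * (\<bar>y r - z r\<bar> * (1 / \<rho> ^ 3 + 1 / \<rho> ^ 3 + 1 / \<rho> ^ 3))"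
    using ab diff zb le by (intro add_mono mult_mono mult_nonneg_nonneg) auto
  also have "\<dots> = 4 / \<rho> ^ 3 * \<bar>y r - z r\<bar>" by simp
  finally show ?thesis .
qed

text \<open>Gronwall for the squared distance in phase space. On a compact interval both solutions
  keep a positive distance \<rho> from the singularity, which gives a Lipschitz constant for the
  force even at the collision times of the primaries.\<close>

lemma equation_unique:
  assumes y: "\<And>r. (y has_real_derivative y' r) (at r)" "\<And>r. (y' has_real_derivative - force y r) (at r)"
    and z: "\<And>r. (z has_real_derivative z' r) (at r)" "\<And>r. (z' has_real_derivative - force z r) (at r)"
    and ns: "\<And>r. (x r)\<^sup>2 + (y r)\<^sup>2 \<noteq> 0" "\<And>r. (x r)\<^sup>2 + (z r)\<^sup>2 \<noteq> 0"
    and init: "y r0 = z r0" "y' r0 = z' r0"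
  shows "y = z"
proof
  fix r1
  define p q where "p = min r0 r1" and "q = max r0 r1"
  have pq: "p \<le> r0" "r0 \<le> q" "r1 = p \<or> r1 = q" "r0 = p \<or> r0 = q" "p \<le> q"
    by (auto simp: p_def q_def min_def max_def)
  define g where "g r = min (sqrt ((x r)\<^sup>2 + (y r)\<^sup>2)) (sqrt ((x r)\<^sup>2 + (z r)\<^sup>2))" for r
  have cont: "continuous_on {p..q} y" "continuous_on {p..q} z"
    using y(1) z(1) DERIV_continuous_on has_field_derivative_at_within by blast+
  have "continuous_on {p..q} g" unfolding g_def
    by (intro continuous_intros x_continuous cont)
  then obtain m where m: "m \<in> {p..q}" "\<And>r. r \<in> {p..q} \<Longrightarrow> g m \<le> g r"
    using continuous_attains_inf[of "{p..q}" g] pq by auto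
  define \<rho> where "\<rho> = g m"
  have "0 < \<rho>" using ns[of m] by (auto simp: \<rho>_def g_def sum_power2_gt_zero_iff sum_power2_eq_zero_iff)
  define L where "L = 4 / \<rho> ^ 3"
  have "0 \<le> L" using \<open>0 < \<rho>\<close> by (simp add: L_def)
  have lip: "\<bar>force y r - force z r\<bar> \<le> L * \<bar>y r - z r\<bar>" if "p \<le> r" "r \<le> q" for r
    unfolding L_def using m(2)[of r] that \<open>0 < \<rho>\<close> by (intro force_lipschitz) (auto simp: \<rho>_def g_def)
  define W where "W r = (y r - z r)\<^sup>2 + (y' r - z' r)\<^sup>2" for r
  define W' where "W' r = 2 * (y r - z r) * (y' r - z' r) - 2 * (y' r - z' r) * (force y r - force z r)" for r
  have dW: "(W has_real_derivative W' r) (at r)" for r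
    unfolding W_def W'_def
    by (auto intro!: derivative_eq_intros y z simp: algebra_simps power2_eq_square)
  have W'_le: "\<bar>W' r\<bar> \<le> (1 + L) * W r" if "p \<le> r" "r \<le> q" for r
  proof -
    define d e where "d = y r - z r" and "e = y' r - z' r"
    have de: "2 * (\<bar>d\<bar> * \<bar>e\<bar>) \<le> W r"
      using zero_le_power2[of "\<bar>d\<bar> - \<bar>e\<bar>"] unfolding W_def d_def[symmetric] e_def[symmetric]
      by (simp add: power2_eq_square algebra_simps)
    have "\<bar>W' r\<bar> \<le> 2 * (\<bar>d\<bar> * \<bar>e\<bar>) + 2 * \<bar>e\<bar> * \<bar>force y r - force z r\<bar>"
      unfolding W'_def d_def[symmetric] e_def[symmetric]
      by (rule order_trans[OF abs_triangle_ineq4]) (simp add: abs_mult)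
    also have "\<dots> \<le> 2 * (\<bar>d\<bar> * \<bar>e\<bar>) + 2 * \<bar>e\<bar> * (L * \<bar>d\<bar>)"
      using lip[OF that] unfolding d_def by (intro add_left_mono mult_left_mono) auto
    also have "\<dots> = (1 + L) * (2 * (\<bar>d\<bar> * \<bar>e\<bar>))" by (simp add: algebra_simps)
    also have "\<dots> \<le> (1 + L) * W r" using de \<open>0 \<le> L\<close> by (intro mult_left_mono) auto
    finally show ?thesis .
  qed
  have W0: "W r0 = 0" by (simp add: W_def init)
  define K where "K = 1 + L"
  have "W r1 \<le> 0"
  proof (cases "r1 = q")
    case True
    have "W q * exp (- K * q) \<le> W r0 * exp (- K * r0)"
    proof (rule DERIV_nonpos_imp_nonincreasing[OF pq(2)])
      fix r assume r: "r0 \<le> r" "r \<le> q"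
      have "((\<lambda>r. W r * exp (- K * r)) has_real_derivative (W' r - K * W r) * exp (- K * r)) (at r)"
        by (auto intro!: derivative_eq_intros dW simp: algebra_simps)
      moreover have "(W' r - K * W r) * exp (- K * r) \<le> 0"
        using W'_le[of r] r pq by (intro mult_nonpos_nonneg) (auto simp: K_def)
      ultimately show "\<exists>d. ((\<lambda>r. W r * exp (- K * r)) has_real_derivative d) (at r) \<and> d \<le> 0" by blast
    qed
    then show ?thesis using W0 True by (simp add: mult_le_0_iff not_le[symmetric])
  next
    case False
    then have "r1 = p" using pq by auto
    have "W p * exp (K * p) \<le> W r0 * exp (K * r0)"
    proof (rule DERIV_nonneg_imp_nondecreasing[OF pq(1)])
      fix r assume r: "p \<le> r" "r \<le> r0"
      have "((\<lambda>r. W r * exp (K * r)) has_real_derivative (W' r + K * W r) * exp (K * r)) (at r)"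
        by (auto intro!: derivative_eq_intros dW simp: algebra_simps)
      moreover have "0 \<le> (W' r + K * W r) * exp (K * r)"
        using W'_le[of r] r pq by (intro mult_nonneg_nonneg) (auto simp: K_def)
      ultimately show "\<exists>d. ((\<lambda>r. W r * exp (K * r)) has_real_derivative d) (at r) \<and> 0 \<le> d" by blast
    qed
    then show ?thesis using W0 \<open>r1 = p\<close> by (simp add: mult_le_0_iff not_le[symmetric])
  qed
  moreover have "(y r1 - z r1)\<^sup>2 \<le> W r1" by (simp add: W_def)
  ultimately have "(y r1 - z r1)\<^sup>2 \<le> 0" by linarith
  then show "y r1 = z r1" by simp
qed

end

subsection \<open>Asymptotics at a triple collision\<close>

lemma last_zero_before:
  fixes f :: "real \<Rightarrow> real"
  assumes "a < c" "continuous_on {a..c} f" "f a \<le> 0" "0 < f c"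
  obtains b where "a \<le> b" "b < c" "f b = 0" "\<And>r. b < r \<Longrightarrow> r \<le> c \<Longrightarrow> 0 < f r"
proof -
  define S where "S = {a..c} \<inter> f -` {..0}"
  have "closed S" unfolding S_def using assms(2) by (intro continuous_closed_preimage) auto
  then have "compact S" unfolding S_def by (simp add: compact_eq_bounded_closed bounded_Int)
  moreover have "a \<in> S" using assms by (simp add: S_def)
  then have "S \<noteq> {}" by blast
  ultimately obtain b where b: "b \<in> S" "\<And>r. r \<in> S \<Longrightarrow> r \<le> b" using compact_attains_sup by metis
  have bc: "a \<le> b" "b < c" using b(1) assms(4) by (auto simp: S_def order_less_le)
  have pos: "0 < f r" if "b < r" "r \<le> c" for r
    using b(2)[of r] that bc by (force simp: S_def)
  have "f b = 0"
  proof (rule ccontr)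
    assume "f b \<noteq> 0"
    then have "f b < 0" using b(1) by (auto simp: S_def)
    then obtain r where "b \<le> r" "r \<le> c" "f r = 0"
      using IVT'[of f b 0 c] assms bc continuous_on_subset[OF assms(2), of "{b..c}"] by auto
    then show False using pos[of r] \<open>f b < 0\<close> by (cases "b = r") auto
  qed
  then show ?thesis using that bc pos by blast
qed

lemma first_zero_after:
  fixes f :: "real \<Rightarrow> real"
  assumes "a < c" "continuous_on {a..c} f" "0 < f a" "f c \<le> 0"
  obtains b where "a < b" "b \<le> c" "f b = 0" "\<And>r. a \<le> r \<Longrightarrow> r < b \<Longrightarrow> 0 < f r"
proof -
  have "continuous_on {- c..- a} (\<lambda>r. f (- r))"
    by (rule continuous_on_compose2[OF assms(2)]) (auto intro!: continuous_intros)
  then obtain b where b: "- c \<le> b" "b < - a" "f (- b) = 0" "\<And>r. b < r \<Longrightarrow> r \<le> - a \<Longrightarrow> 0 < f (- r)"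
    using last_zero_before[of "- c" "- a" "\<lambda>r. f (- r)"] assms by auto
  have "0 < f r" if "a \<le> r" "r < - b" for r using b(4)[of "- r"] that by simp
  then show ?thesis using that[of "- b"] b by auto
qed

lemma tendsto_at_right_0_unit:
  fixes f :: "real \<Rightarrow> real"
  assumes "(f \<longlongrightarrow> l) (at_right 0)" "0 < e" "0 < h"
  obtains d where "0 < d" "d < h" "\<And>s. 0 < s \<Longrightarrow> s \<le> d \<Longrightarrow> \<bar>f s - l\<bar> < e"
proof -
  have "\<forall>\<^sub>F s in at_right 0. \<bar>f s - l\<bar> < e"
    using tendstoD[OF assms(1,2)] by (simp add: dist_real_def)
  then obtain b where b: "b > 0" "\<And>s. 0 < s \<Longrightarrow> s < b \<Longrightarrow> \<bar>f s - l\<bar> < e"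
    unfolding eventually_at_right_field by auto
  show ?thesis
    by (rule that[of "min (b / 2) (h / 2)"]) (use b assms in auto)
qed

text \<open>In the application f is plus or minus the deviation of y/x from its value sqrt 3 in the
  equilateral configuration, W is minus or plus the Wronskian of x and y, and X is the square of x.\<close>

locale collision_pair =
  fixes f W W1 X :: "real \<Rightarrow> real" and h :: real
  assumes h: "0 < h"
    and f_deriv: "\<And>s. 0 < s \<Longrightarrow> s < h \<Longrightarrow> (f has_real_derivative - W s / X s) (at s)"
    and X_pos: "\<And>s. 0 < s \<Longrightarrow> s < h \<Longrightarrow> 0 < X s"
    and W_deriv: "\<And>s. 0 < s \<Longrightarrow> s < h \<Longrightarrow> (W has_real_derivative W1 s) (at s)"
    and W1_neg: "\<And>s. 0 < s \<Longrightarrow> s < h \<Longrightarrow> 0 < f s \<Longrightarrow> W1 s < 0"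
    and W_lim: "(W \<longlongrightarrow> 0) (at_right 0)"
begin

lemma f_continuous: "0 < a \<Longrightarrow> b < h \<Longrightarrow> continuous_on {a..b} f"
  by (rule DERIV_continuous_on[where D = "\<lambda>s. - W s / X s"],
      rule has_field_derivative_at_within, rule f_deriv) simp_all

lemma W_decreasing:
  assumes "0 < a" "a < b" "b < h" "\<And>s. a < s \<Longrightarrow> s < b \<Longrightarrow> 0 < f s"
  shows "W b < W a"
proof (rule DERIV_neg_imp_decreasing_open[OF assms(2)])
  show "\<exists>d. (W has_real_derivative d) (at s) \<and> d < 0" if "a < s" "s < b" for s
  proof -
    have s: "0 < s" "s < h" using assms(1,3) that by auto
    show ?thesis using W_deriv[OF s] W1_neg[OF s assms(4)[OF that]] by blast
  qed
  show "continuous_on {a..b} W"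
    by (rule DERIV_continuous_on[where D = W1], rule has_field_derivative_at_within, rule W_deriv)
      (use assms in simp_all)
qed

lemma f_mono:
  assumes "0 < a" "a < b" "b < h" "\<And>s. a < s \<Longrightarrow> s < b \<Longrightarrow> W s < 0"
  shows "f a < f b"
proof (rule DERIV_pos_imp_increasing_open[OF assms(2)])
  show "\<exists>d. (f has_real_derivative d) (at s) \<and> 0 < d" if "a < s" "s < b" for s
  proof -
    have s: "0 < s" "s < h" using assms(1,3) that by auto
    have "0 < - W s / X s" using assms(4)[OF that] X_pos[OF s] by (intro divide_pos_pos) auto
    then show ?thesis using f_deriv[OF s] by blast
  qed
qed (rule f_continuous[OF assms(1,3)])

lemma f_antimono:
  assumes "0 < a" "a < b" "b < h" "\<And>s. a < s \<Longrightarrow> s < b \<Longrightarrow> 0 < W s"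
  shows "f b < f a"
proof (rule DERIV_neg_imp_decreasing_open[OF assms(2)])
  show "\<exists>d. (f has_real_derivative d) (at s) \<and> d < 0" if "a < s" "s < b" for s
  proof -
    have s: "0 < s" "s < h" using assms(1,3) that by auto
    have "- W s / X s < 0" using assms(4)[OF that] X_pos[OF s] by (intro divide_neg_pos) auto
    then show ?thesis using f_deriv[OF s] by blast
  qed
qed (rule f_continuous[OF assms(1,3)])

text \<open>W decreases from its limit 0; passing through the value at s/2 makes the inequality
  strict.\<close>

lemma W_negative:
  assumes "0 < s" "s < h" "\<And>r. 0 < r \<Longrightarrow> r < s \<Longrightarrow> 0 < f r"
  shows "W s < 0"
proof (rule ccontr)
  assume "\<not> W s < 0"
  define e where "e = W (s / 2)"
  have "W s < e" unfolding e_def using assms by (intro W_decreasing) auto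
  then have "0 < e" using \<open>\<not> W s < 0\<close> by simp
  then obtain d where d: "0 < d" "d < s / 2" "\<And>r. 0 < r \<Longrightarrow> r \<le> d \<Longrightarrow> \<bar>W r - 0\<bar> < e"
    using tendsto_at_right_0_unit[OF W_lim, of e "s / 2"] assms by auto
  have "e < W d" unfolding e_def using assms d by (intro W_decreasing) auto
  then show False using d(3)[of d] d(1) by simp
qed

text \<open>If W were positive at a zero of f, then f would be positive just before it. An earlier
  zero is impossible: in between W would be larger still, so f would decrease from one zero to the
  other. Thus f would be positive all the way down to 0, which forces W to be negative.\<close>

lemma W_nonpos_at_zero:
  assumes s1: "0 < s1" "s1 < h" "f s1 = 0"
  shows "W s1 \<le> 0"
proof (rule ccontr)
  assume "\<not> W s1 \<le> 0"
  then have W: "0 < W s1" by simp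
  then have "- W s1 / X s1 < 0" using X_pos[of s1] s1 by (intro divide_neg_pos) auto
  from DERIV_neg_dec_left[OF f_deriv this] s1
  obtain d where d: "d > 0" "\<And>r. 0 < r \<Longrightarrow> r < d \<Longrightarrow> 0 < f (s1 - r)" by auto
  have all: "0 < f r" if r: "0 < r" "r < s1" for r
  proof (rule ccontr)
    assume "\<not> 0 < f r"
    define c where "c = s1 - min (d / 2) ((s1 - r) / 2)"
    have c: "r < c" "c < s1" "s1 - d < c" using d r unfolding c_def by (auto simp: min_def field_simps)
    have near: "0 < f q" if "c \<le> q" "q < s1" for q using d(2)[of "s1 - q"] that c by simp
    obtain b where b: "r \<le> b" "b < c" "f b = 0" "\<And>q. b < q \<Longrightarrow> q \<le> c \<Longrightarrow> 0 < f q"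
      using last_zero_before[OF c(1) f_continuous, of thesis] \<open>\<not> 0 < f r\<close> near[of c] r c s1 by auto
    have pos: "0 < f q" if "b < q" "q < s1" for q
      using b(4)[of q] near[of q] that by (cases "q \<le> c") auto
    have "W s1 < W q" if "b < q" "q < s1" for q
      using that b r s1 pos by (intro W_decreasing) auto
    then have "f s1 < f b"
      using b c r s1 W by (intro f_antimono) (auto intro: less_trans)
    then show False using b s1 by simp
  qed
  then show False using W_negative[OF s1(1,2)] W by auto
qed

end

text \<open>The situation is symmetric under a change of all signs, so each one-sided fact is
  available for f and for -f.\<close>

locale collision_dichotomy =
  pos: collision_pair f W W1 X h + neg: collision_pair "\<lambda>s. - f s" "\<lambda>s. - W s" "\<lambda>s. - W1 s" X h
  for f W W1 X :: "real \<Rightarrow> real" and h :: real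
begin

lemma W_zero: "0 < s \<Longrightarrow> s < h \<Longrightarrow> f s = 0 \<Longrightarrow> W s = 0"
  using pos.W_nonpos_at_zero[of s] neg.W_nonpos_at_zero[of s] by simp

text \<open>At both ends of a positive bump of f the function W vanishes, yet it decreases strictly
  across the bump.\<close>

lemma not_pos_between_zeros:
  assumes "0 < p" "p < s" "s < q" "q < h" "f p = 0" "f q = 0"
  shows "\<not> 0 < f s"
proof
  assume "0 < f s"
  obtain b where b: "p \<le> b" "b < s" "f b = 0" "\<And>r. b < r \<Longrightarrow> r \<le> s \<Longrightarrow> 0 < f r"
    using last_zero_before[OF assms(2) pos.f_continuous, of thesis] assms \<open>0 < f s\<close> by auto
  obtain c where c: "s < c" "c \<le> q" "f c = 0" "\<And>r. s \<le> r \<Longrightarrow> r < c \<Longrightarrow> 0 < f r"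
    using first_zero_after[OF assms(3) pos.f_continuous, of thesis] assms \<open>0 < f s\<close> by auto
  have "0 < f r" if "b < r" "r < c" for r using b(4)[of r] c(4)[of r] that by (cases "r \<le> s") auto
  then have "W c < W b" using b c assms by (intro pos.W_decreasing) auto
  then show False using W_zero[of b] W_zero[of c] b c assms by simp
qed

lemma dichotomy_neg: "collision_dichotomy (\<lambda>s. - f s) (\<lambda>s. - W s) (\<lambda>s. - W1 s) X h"
  by unfold_locales
    (use pos.h neg.f_deriv pos.f_deriv pos.X_pos neg.W_deriv pos.W_deriv neg.W1_neg pos.W1_neg
      neg.W_lim pos.W_lim in auto)

text \<open>If the zeros of f accumulate at 0, every point near 0 lies between two zeros, and there
  f has neither sign.\<close>

lemma constant_sign_near_0:
  "\<exists>c. 0 < c \<and> c < h \<and> ((\<forall>s. 0 < s \<longrightarrow> s < c \<longrightarrow> f s = 0) \<or> (\<forall>s. 0 < s \<longrightarrow> s < c \<longrightarrow> 0 < f s) \<or>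
     (\<forall>s. 0 < s \<longrightarrow> s < c \<longrightarrow> f s < 0))"
proof (cases "\<exists>c. 0 < c \<and> c < h \<and> (\<forall>s. 0 < s \<longrightarrow> s < c \<longrightarrow> f s \<noteq> 0)")
  case True
  then obtain c where c: "0 < c" "c < h" "\<And>s. 0 < s \<Longrightarrow> s < c \<Longrightarrow> f s \<noteq> 0" by blast
  have const: "0 < f s" if sr: "0 < s" "s < c" "0 < r" "r < c" "0 < f r" for r s
  proof (rule ccontr)
    assume "\<not> 0 < f s"
    then have le: "f s \<le> 0" by simp
    have cont: "continuous_on {a..b} f" if "0 < a" "b < c" for a b
      using pos.f_continuous[of a b] that c by simp
    show False
    proof (cases "s < r")
      case True
      obtain b where "s \<le> b" "b < r" "f b = 0"
        using last_zero_before[OF True cont le sr(5)] sr by auto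
      then show False using c(3)[of b] sr by auto
    next
      case False
      then have "r < s" using le sr(5) by (cases "r = s") auto
      obtain b where "r < b" "b \<le> s" "f b = 0"
        using first_zero_after[OF \<open>r < s\<close> cont sr(5) le] sr by auto
      then show False using c(3)[of b] sr by auto
    qed
  qed
  show ?thesis
  proof (cases "0 < f (c / 2)")
    case True
    then show ?thesis using const[of _ "c / 2"] c by (intro exI[of _ c]) auto
  next
    case False
    then have "f s < 0" if "0 < s" "s < c" for s
      using const[OF _ _ that, of "c / 2"] c(1) c(3)[OF that] False by (cases "0 < f s") auto
    then show ?thesis using c by blast
  qed
next
  case False
  then have zeros: "\<exists>s. 0 < s \<and> s < c \<and> f s = 0" if "0 < c" "c < h" for c using that by blast
  obtain q where q: "0 < q" "q < h / 2" "f q = 0" using zeros[of "h / 2"] pos.h by auto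
  interpret N: collision_dichotomy "\<lambda>s. - f s" "\<lambda>s. - W s" "\<lambda>s. - W1 s" X h by (rule dichotomy_neg)
  have "f s = 0" if s: "0 < s" "s < q" for s
  proof -
    obtain p where "0 < p" "p < s" "f p = 0" using zeros[of s] s q pos.h by auto
    then show ?thesis
      using not_pos_between_zeros[of p s q] N.not_pos_between_zeros[of p s q] s q pos.h by auto
  qed
  then show ?thesis using q pos.h by (intro exI[of _ q]) auto
qed

end

context collision_pair
begin

text \<open>If f stayed away from 0, then W would be at most a negative multiple of the cube root of s,
  and f would diverge logarithmically.\<close>

lemma f_tendsto_0:
  assumes c: "0 < c" "c < h" and pos: "\<And>s. 0 < s \<Longrightarrow> s < c \<Longrightarrow> 0 < f s"
    and X_le: "\<And>s. 0 < s \<Longrightarrow> s < c \<Longrightarrow> X s \<le> root 3 s ^ 4"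
    and W1_le: "\<And>l. 0 < l \<Longrightarrow> (\<And>s. 0 < s \<Longrightarrow> s < c \<Longrightarrow> l \<le> f s) \<Longrightarrow>
      \<exists>k c'. 0 < k \<and> 0 < c' \<and> c' < c \<and> (\<forall>s. 0 < s \<longrightarrow> s < c' \<longrightarrow> W1 s \<le> - k / root 3 s ^ 2)"
  shows "(f \<longlongrightarrow> 0) (at_right 0)"
proof -
  have Wneg: "W s < 0" if "0 < s" "s < c" for s
    using W_negative[of s] that c pos by auto
  have mono: "f r < f s" if "0 < r" "r < s" "s < c" for r s
    using that c by (intro f_mono Wneg) auto
  have small: "\<exists>s. 0 < s \<and> s < c \<and> f s < l" if l: "0 < l" for l
  proof (rule ccontr)
    assume "\<not> ?thesis"
    then obtain k c' where k: "0 < k" "0 < c'" "c' < c"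
      "\<And>s. 0 < s \<Longrightarrow> s < c' \<Longrightarrow> W1 s \<le> - k / root 3 s ^ 2"
      using W1_le[OF l] by (meson not_less)
    \<comment> \<open>The added term has derivative k s^(-2/3), which balances the bound for the
      derivative of W. So V does not increase from its limit 0, that is, W is at most -3 k
      s^(1/3).\<close>
    define V where "V s = W s + 3 * k * root 3 s" for s
    have dV: "(V has_real_derivative W1 s + k / root 3 s ^ 2) (at s)" if "0 < s" "s < c'" for s
    proof -
      have "(root 3 has_real_derivative inverse (real 3 * root 3 s ^ (3 - Suc 0))) (at s)"
        using that by (intro DERIV_odd_real_root) auto
      then show ?thesis unfolding V_def using that k c
        by (auto intro!: derivative_eq_intros W_deriv simp: field_simps)
    qed
    have Vlim: "(V \<longlongrightarrow> 0) (at_right 0)"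
    proof -
      have "(root 3 \<longlongrightarrow> root 3 0) (at_right 0)"
        by (rule tendsto_real_root) (rule tendsto_ident_at)
      then have "(V \<longlongrightarrow> 0 + 3 * k * root 3 0) (at_right 0)"
        unfolding V_def by (intro tendsto_intros W_lim)
      then show ?thesis by simp
    qed
    have V_le: "V s \<le> 0" if s: "0 < s" "s < c'" for s
    proof (rule ccontr)
      assume "\<not> V s \<le> 0"
      then obtain d where d: "0 < d" "d < s" "\<bar>V d - 0\<bar> < V s"
        using tendsto_at_right_0_unit[OF Vlim, of "V s" s] s by (metis linorder_not_less order_refl)
      have "V s \<le> V d"
      proof (rule DERIV_nonpos_imp_nonincreasing[of d s V])
        show "\<exists>D. (V has_real_derivative D) (at r) \<and> D \<le> 0" if "d \<le> r" "r \<le> s" for r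
        proof -
          have "W1 r + k / root 3 r ^ 2 \<le> 0" using k(4)[of r] that d s by simp
          then show ?thesis using dV[of r] that d s by force
        qed
      qed (use d in simp)
      then show False using d by simp
    qed
    \<comment> \<open>As -W is at least 3 k s^(1/3) and X at most s^(4/3), the derivative of f is at
      least 3 k / s; U compares f with this logarithm.\<close>
    define U where "U s = f s - 3 * k * ln s" for s
    have U: "U r \<le> U s" if rs: "0 < r" "r \<le> s" "s < c'" for r s
    proof (rule DERIV_nonneg_imp_nondecreasing[of r s U])
      fix q assume q: "r \<le> q" "q \<le> s"
      then have q': "0 < q" "q < c'" using rs by auto
      have d: "(U has_real_derivative - W q / X q - 3 * k * (1 / q)) (at q)"
        unfolding U_def using q' k c by (auto intro!: derivative_eq_intros f_deriv)
      have "3 * k * root 3 q \<le> - W q" using V_le[OF q'] by (simp add: V_def)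
      then have "3 * k * root 3 q / root 3 q ^ 4 \<le> - W q / X q"
        using X_le[of q] X_pos[of q] Wneg[of q] q' k(1-3) c by (intro frac_le) auto
      moreover have "3 * k * root 3 q / root 3 q ^ 4 = 3 * k * (1 / q)"
      proof -
        have "root 3 q ^ 4 = root 3 q * root 3 q ^ 3" by (simp add: eval_nat_numeral)
        moreover have "root 3 q ^ 3 = q" using q' by simp
        moreover have "0 < root 3 q" using q' by simp
        ultimately show ?thesis by simp
      qed
      ultimately show "\<exists>y. (U has_real_derivative y) (at q) \<and> 0 \<le> y" using d by force
    qed (rule rs(2))
    define s0 where "s0 = c' / 2"
    \<comment> \<open>So close to 0 that monotonicity of U makes f negative.\<close>
    define r where "r = min s0 (exp (- (\<bar>U s0\<bar> + 1) / (3 * k)))"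
    have s0: "0 < s0" "s0 < c'" using k by (auto simp: s0_def)
    have r: "0 < r" "r \<le> s0" "r \<le> exp (- (\<bar>U s0\<bar> + 1) / (3 * k))" using s0 by (auto simp: r_def)
    have "ln r \<le> - (\<bar>U s0\<bar> + 1) / (3 * k)"
      using r by (metis ln_exp ln_le_cancel_iff exp_gt_zero)
    then have "3 * k * ln r \<le> - (\<bar>U s0\<bar> + 1)" using k by (simp add: field_simps)
    moreover have "f r - 3 * k * ln r \<le> U s0" using U[OF r(1,2) s0(2)] by (simp add: U_def)
    moreover have "0 < f r" using pos[of r] r s0 k by simp
    ultimately show False by linarith
  qed
  show ?thesis
  proof (rule tendstoI)
    fix e :: real assume "0 < e"
    then obtain s where s: "0 < s" "s < c" "f s < e" using small by blast
    have "dist (f r) 0 < e" if "0 < r" "r < s" for r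
      using mono[of r s] pos[of r] that s by (simp add: dist_real_def)
    then show "\<forall>\<^sub>F r in at_right 0. dist (f r) 0 < e"
      unfolding eventually_at_right_field using s(1) by blast
  qed
qed

end

context sitnikov
begin

lemma x_le_root: "\<bar>s\<bar> \<le> 1/2 \<Longrightarrow> x s \<le> root 3 s ^ 2"
proof -
  assume s: "\<bar>s\<bar> \<le> 1/2"
  have "x s ^ 3 \<le> s\<^sup>2" using x_cube_le[OF s] zero_le_power2[of s] by linarith
  also have "s\<^sup>2 = (root 3 s ^ 3)\<^sup>2" by (simp add: odd_real_root_pow)
  also have "\<dots> = (root 3 s ^ 2) ^ 3" by (simp flip: power_mult)
  finally show ?thesis by (rule power_le_imp_le_base[of _ 2, simplified]) simp
qed

text \<open>The ratio u = p/x has the derivative w/x^2 with the Wronskian w, and the derivative of w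
  has the sign of u - sqrt 3, because 1/(x^2 + p^2)^(3/2) equals 1/(2x)^3 exactly in the equilateral
  configuration. So the dichotomy applies to the deviation of u from sqrt 3.\<close>

lemma collision_asymptotics:
  assumes cont: "continuous_on {0..1} p" and p0: "p 0 = 0"
    and pos: "\<And>s. 0 < s \<Longrightarrow> s < 1 \<Longrightarrow> 0 < p s"
    and dp: "\<And>s. 0 < s \<Longrightarrow> s < 1 \<Longrightarrow> (p has_real_derivative p' s) (at s)"
    and dp': "\<And>s. 0 < s \<Longrightarrow> s < 1 \<Longrightarrow> (p' has_real_derivative - force p s) (at s)"
    and hoelder: "\<And>s. 0 < s \<Longrightarrow> s < 1 \<Longrightarrow> (p s)\<^sup>2 \<le> C * s"
  shows "((\<lambda>s. p s / x s) \<longlongrightarrow> sqrt 3) (at_right 0)"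
proof -
  have xs: "0 < x s" "s \<notin> \<int>" if "0 < s" "s < 1" for s
    using x_pos[OF not_Ints_unit[OF that]] not_Ints_unit[OF that] by auto
  have p'_dec: "p' b < p' a" if "0 < a" "a < b" "b < 1" for a b
  proof (rule DERIV_neg_imp_decreasing[OF that(2)])
    fix s assume "a \<le> s" "s \<le> b"
    then have s: "0 < s" "s < 1" using that by auto
    have "0 < force p s" using pos[OF s] by (auto simp: force_def sum_power2_gt_zero_iff intro!: divide_pos_pos)
    then show "\<exists>y. (p' has_real_derivative y) (at s) \<and> y < 0" using dp'[OF s] by (intro exI) auto
  qed
  have p'_le: "p' s \<le> p s / s" if s: "0 < s" "s < 1" for s
  proof -
    obtain c where c: "0 < c" "c < s" "p s - p 0 = (s - 0) * p' c"
      using real_mvt[OF s(1) continuous_on_subset[OF cont], of p'] dp s by auto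
    then have "p s = s * p' c" using p0 by simp
    then show ?thesis using p'_dec[of c s] c s by (simp add: field_simps)
  qed
  define u where "u s = p s / x s" for s
  define w where "w s = x s * p' s - dx s * p s" for s
  define w1 where "w1 s = p s * (1 / (8 * (x s)\<^sup>2) - x s / sqrt ((x s)\<^sup>2 + (p s)\<^sup>2) ^ 3)" for s
  have du: "(u has_real_derivative w s / (x s)\<^sup>2) (at s)" if "0 < s" "s < 1" for s
    unfolding u_def w_def using xs[OF that] that
    by (auto intro!: derivative_eq_intros x_deriv dp simp: power2_eq_square mult_ac)
  have dw: "(w has_real_derivative w1 s) (at s)" if "0 < s" "s < 1" for s
    unfolding w_def w1_def using xs[OF that] that
    by (auto intro!: derivative_eq_intros x_deriv dx_deriv dp dp' simp: force_def algebra_simps)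
  \<comment> \<open>By concavity of p and of x, both terms of w are at most x p/s up to a vanishing
    term. With x at most s^(2/3) and p at most a multiple of s^(1/2) this is of order
    s^(1/6).\<close>
  have w_lim: "(w \<longlongrightarrow> 0) (at_right 0)"
  proof (rule Lim_null_comparison)
    define k where "k = \<bar>p' (1/2)\<bar>"
    have "\<bar>w s\<bar> \<le> 2 * sqrt (C * root 3 s) + x s * k" if s: "0 < s" "s < 1/2" for s
    proof -
      have "0 < p s / s" using s pos[of s] by simp
      moreover have "p' s \<le> p s / s" "p' (1/2) < p' s" using p'_le[of s] p'_dec[of s "1/2"] s by auto
      ultimately have "\<bar>p' s\<bar> \<le> p s / s + k" unfolding k_def by linarith
      then have "x s * \<bar>p' s\<bar> \<le> x s * (p s / s + k)"
        using x_nonneg by (intro mult_left_mono) auto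
      moreover have "\<bar>dx s\<bar> * p s \<le> x s / s * p s"
        using x_dx_le[of s] dx_pos[of s] s pos[of s]
        by (intro mult_right_mono) (auto simp: field_simps)
      moreover have "\<bar>w s\<bar> \<le> x s * \<bar>p' s\<bar> + \<bar>dx s\<bar> * p s"
        unfolding w_def using s pos[of s] xs[of s]
        by (intro order_trans[OF abs_triangle_ineq4]) (simp add: abs_mult)
      moreover have "x s / s * p s = x s * (p s / s)" "x s * (p s / s + k) = x s * (p s / s) + x s * k"
        by (simp_all add: distrib_left)
      ultimately have 1: "\<bar>w s\<bar> \<le> 2 * (x s * (p s / s)) + x s * k" by linarith
      have "(x s * (p s / s))\<^sup>2 = (x s)\<^sup>2 * (p s)\<^sup>2 / s\<^sup>2" by (simp add: power_mult_distrib power_divide)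
      also have "\<dots> \<le> (root 3 s ^ 2)\<^sup>2 * (C * s) / s\<^sup>2"
        using x_le_root[of s] x_nonneg[of s] hoelder[of s] s
        by (intro divide_right_mono mult_mono power_mono) auto
      also have "\<dots> = C * root 3 s * (root 3 s ^ 3 / s)"
        using s by (simp add: power2_eq_square power3_eq_cube field_simps)
      also have "\<dots> = C * root 3 s" using s by simp
      finally have "x s * (p s / s) \<le> sqrt (C * root 3 s)" by (rule real_le_rsqrt)
      then show ?thesis using 1 by simp
    qed
    then show "\<forall>\<^sub>F s in at_right 0. norm (w s) \<le> 2 * sqrt (C * root 3 s) + x s * k"
      unfolding eventually_at_right_field by (intro exI[of _ "1/2"]) auto
    have "(x \<longlongrightarrow> x 0) (at_right 0)"
      using x_isCont[of 0] by (simp add: isCont_def filterlim_at_split)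
    then have "((\<lambda>s. 2 * sqrt (C * root 3 s) + x s * k) \<longlongrightarrow> 2 * sqrt (C * root 3 0) + x 0 * k) (at_right 0)"
      by (intro tendsto_intros)
    then show "((\<lambda>s. 2 * sqrt (C * root 3 s) + x s * k) \<longlongrightarrow> 0) (at_right 0)" by simp
  qed
  have w1_eq: "w1 s = u s / x s * (1 / 8 - 1 / sqrt (1 + (u s)\<^sup>2) ^ 3)" if "0 < s" "s < 1" for s
  proof -
    have "(x s)\<^sup>2 + (p s)\<^sup>2 = (x s)\<^sup>2 * (1 + (u s)\<^sup>2)"
      using xs[OF that] by (simp add: u_def field_simps)
    then have "sqrt ((x s)\<^sup>2 + (p s)\<^sup>2) = x s * sqrt (1 + (u s)\<^sup>2)"
      using xs[OF that] by (simp add: real_sqrt_mult)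
    moreover have "p s = u s * x s" using xs[OF that] by (simp add: u_def)
    moreover have "0 < sqrt (1 + (u s)\<^sup>2)" by (simp add: add_pos_nonneg)
    moreover have "U * X * (1 / (8 * X\<^sup>2) - X / (X * g) ^ 3) = U / X * (1 / 8 - 1 / g ^ 3)"
      if "0 < X" "0 < g" for U X g :: real
      using that by (simp add: field_simps power2_eq_square power3_eq_cube)
    ultimately show ?thesis using xs[OF that] unfolding w1_def by simp
  qed
  have upos: "0 < u s" if "0 < s" "s < 1" for s using pos[OF that] xs[OF that] by (simp add: u_def)
  have cube_less: "1 / 8 - 1 / sqrt (1 + v\<^sup>2) ^ 3 < 0" if "0 \<le> v" "v < sqrt 3" for v
  proof -
    have "v\<^sup>2 < (sqrt 3)\<^sup>2" using that by (intro power_strict_mono) auto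
    then have "sqrt (1 + v\<^sup>2) < sqrt (2\<^sup>2)" by (intro real_sqrt_less_mono) simp
    then have "sqrt (1 + v\<^sup>2) ^ 3 < 2 ^ 3" by (intro power_strict_mono) auto
    moreover have "0 < sqrt (1 + v\<^sup>2) ^ 3" by (simp add: add_pos_nonneg)
    ultimately show ?thesis by (simp add: field_simps)
  qed
  have cube_greater: "0 < 1 / 8 - 1 / sqrt (1 + v\<^sup>2) ^ 3" if "sqrt 3 < v" for v
  proof -
    have "(sqrt 3)\<^sup>2 < v\<^sup>2" using that by (intro power_strict_mono) auto
    then have "sqrt (2\<^sup>2) < sqrt (1 + v\<^sup>2)" by (intro real_sqrt_less_mono) simp
    then have "2 ^ 3 < sqrt (1 + v\<^sup>2) ^ 3" by (intro power_strict_mono) auto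
    then have "1 / sqrt (1 + v\<^sup>2) ^ 3 < 1 / 8"
      by (intro divide_strict_left_mono) (auto simp: add_pos_nonneg)
    then show ?thesis by simp
  qed
  have cube_mono: "1 / 8 - 1 / sqrt (1 + v\<^sup>2) ^ 3 \<le> 1 / 8 - 1 / sqrt (1 + v'\<^sup>2) ^ 3"
    if "0 \<le> v" "v \<le> v'" for v v'
  proof -
    have "v\<^sup>2 \<le> v'\<^sup>2" using that by (intro power_mono) auto
    then have "sqrt (1 + v\<^sup>2) ^ 3 \<le> sqrt (1 + v'\<^sup>2) ^ 3" by (intro power_mono) auto
    moreover have "0 < sqrt (1 + v\<^sup>2) ^ 3" by (simp add: add_pos_nonneg)
    ultimately show ?thesis by (simp add: frac_le)
  qed
  interpret D: collision_dichotomy "\<lambda>s. sqrt 3 - u s" w w1 "\<lambda>s. (x s)\<^sup>2" "1/2"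
  proof unfold_locales
    fix s :: real assume s: "0 < s" "s < 1/2"
    have s1: "s < 1" using s by simp
    show "((\<lambda>s. sqrt 3 - u s) has_real_derivative - w s / (x s)\<^sup>2) (at s)"
      "((\<lambda>s. - (sqrt 3 - u s)) has_real_derivative - (- w s) / (x s)\<^sup>2) (at s)"
      using s s1 by (auto intro!: derivative_eq_intros du)
    show "0 < (x s)\<^sup>2" using xs[of s] s by simp
    show "(w has_real_derivative w1 s) (at s)" "((\<lambda>s. - w s) has_real_derivative - w1 s) (at s)"
      using s s1 by (auto intro!: derivative_eq_intros dw)
    have q: "0 < u s / x s" using upos[OF s(1) s1] xs[OF s(1) s1] by simp
    show "0 < sqrt 3 - u s \<Longrightarrow> w1 s < 0"
      unfolding w1_eq[OF s(1) s1] using cube_less[of "u s"] upos[OF s(1) s1] q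
      by (intro mult_pos_neg) auto
    show "0 < - (sqrt 3 - u s) \<Longrightarrow> - w1 s < 0"
      unfolding w1_eq[OF s(1) s1] neg_less_0_iff_less using cube_greater[of "u s"] q
      by (intro mult_pos_pos) auto
  qed (use w_lim tendsto_minus[OF w_lim] in auto)
  obtain c where c: "0 < c" "c < 1/2"
    and cases: "(\<forall>s. 0 < s \<longrightarrow> s < c \<longrightarrow> sqrt 3 - u s = 0) \<or> (\<forall>s. 0 < s \<longrightarrow> s < c \<longrightarrow> 0 < sqrt 3 - u s) \<or>
     (\<forall>s. 0 < s \<longrightarrow> s < c \<longrightarrow> sqrt 3 - u s < 0)"
    using D.constant_sign_near_0 by blast
  have X_le: "(x s)\<^sup>2 \<le> root 3 s ^ 4" if "0 < s" "s < c" for s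
  proof -
    have "(x s)\<^sup>2 \<le> (root 3 s ^ 2)\<^sup>2" using x_le_root[of s] x_nonneg[of s] that c by (intro power_mono) auto
    then show ?thesis by (simp flip: power_mult)
  qed
  have inv_x: "1 / root 3 s ^ 2 \<le> 1 / x s" if "0 < s" "s < c" for s
    using x_le_root[of s] xs[of s] that c by (intro divide_left_mono) auto
  from cases have "(u \<longlongrightarrow> sqrt 3) (at_right 0)"
  proof (elim disjE)
    assume "\<forall>s. 0 < s \<longrightarrow> s < c \<longrightarrow> sqrt 3 - u s = 0"
    then have "\<forall>\<^sub>F s in at_right 0. u s = sqrt 3"
      unfolding eventually_at_right_field using c by (intro exI[of _ c]) auto
    then show ?thesis by (rule tendsto_eventually)
  next
    assume *: "\<forall>s. 0 < s \<longrightarrow> s < c \<longrightarrow> 0 < sqrt 3 - u s"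
    have "((\<lambda>s. sqrt 3 - u s) \<longlongrightarrow> 0) (at_right 0)"
    proof (rule D.pos.f_tendsto_0[OF c])
      fix l :: real assume l: "0 < l" "\<And>s. 0 < s \<Longrightarrow> s < c \<Longrightarrow> l \<le> sqrt 3 - u s"
      define k where "k = - (u (c / 2) * (1 / 8 - 1 / sqrt (1 + (sqrt 3 - l)\<^sup>2) ^ 3))"
      have c2: "0 < c / 2" "c / 2 < c" "c / 2 < 1" using c by auto
      have "0 < u (c / 2)" by (rule upos) (use c2 in auto)
      moreover have l3: "0 \<le> sqrt 3 - l" using l(2)[of "c / 2"] c2 calculation by simp
      moreover have neg: "1 / 8 - 1 / sqrt (1 + (sqrt 3 - l)\<^sup>2) ^ 3 < 0"
        using l l3 by (intro cube_less) auto
      ultimately have "0 < k" unfolding k_def by (simp add: mult_pos_neg)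
      moreover have "w1 s \<le> - k / root 3 s ^ 2" if s: "0 < s" "s < c / 2" for s
      proof -
        have s': "s < 1" "s < c" using s c by auto
        \<comment> \<open>The deviation grows with s, so u is bounded below by its value at c/2;
          near u = 0 the estimate of \<open>w1\<close> would degenerate.\<close>
        have "sqrt 3 - u s < sqrt 3 - u (c / 2)"
        proof (rule D.pos.f_mono[OF s])
          show "c / 2 < 1/2" using c by simp
          show "w r < 0" if "s < r" "r < c / 2" for r
            using D.pos.W_negative[of r] that s c * by auto
        qed
        then have "u (c / 2) / root 3 s ^ 2 \<le> u s / x s"
          using x_le_root[of s] xs[OF s(1) s'(1)] s c upos[OF c2(1,3)] by (intro frac_le) auto
        then have "u s / x s * (1 / 8 - 1 / sqrt (1 + (sqrt 3 - l)\<^sup>2) ^ 3)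
            \<le> u (c / 2) / root 3 s ^ 2 * (1 / 8 - 1 / sqrt (1 + (sqrt 3 - l)\<^sup>2) ^ 3)"
          using neg by (intro mult_right_mono_neg) auto
        moreover have "u s / x s * (1 / 8 - 1 / sqrt (1 + (u s)\<^sup>2) ^ 3)
            \<le> u s / x s * (1 / 8 - 1 / sqrt (1 + (sqrt 3 - l)\<^sup>2) ^ 3)"
          using l(2)[OF s(1) s'(2)] upos[OF s(1) s'(1)] xs[OF s(1) s'(1)]
          by (intro mult_left_mono cube_mono) auto
        ultimately show ?thesis unfolding w1_eq[OF s(1) s'(1)] k_def by simp
      qed
      ultimately show "\<exists>k c'. 0 < k \<and> 0 < c' \<and> c' < c \<and> (\<forall>s. 0 < s \<longrightarrow> s < c' \<longrightarrow> w1 s \<le> - k / root 3 s ^ 2)"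
        using c2 by blast
    qed (use * X_le in auto)
    from tendsto_diff[OF tendsto_const[of "sqrt 3"] this] show ?thesis by simp
  next
    assume *: "\<forall>s. 0 < s \<longrightarrow> s < c \<longrightarrow> sqrt 3 - u s < 0"
    have "((\<lambda>s. - (sqrt 3 - u s)) \<longlongrightarrow> 0) (at_right 0)"
    proof (rule D.neg.f_tendsto_0[OF c])
      fix l :: real assume l: "0 < l" "\<And>s. 0 < s \<Longrightarrow> s < c \<Longrightarrow> l \<le> - (sqrt 3 - u s)"
      define k where "k = sqrt 3 * (1 / 8 - 1 / sqrt (1 + (sqrt 3 + l)\<^sup>2) ^ 3)"
      have pos: "0 < 1 / 8 - 1 / sqrt (1 + (sqrt 3 + l)\<^sup>2) ^ 3"
        using l(1) by (intro cube_greater) auto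
      then have "0 < k" by (simp add: k_def)
      moreover have "- w1 s \<le> - k / root 3 s ^ 2" if s: "0 < s" "s < c / 2" for s
      proof -
        have s': "s < 1" "s < c" using s c by auto
        have u: "sqrt 3 + l \<le> u s" using l(2)[OF s(1) s'(2)] by simp
        then have "sqrt 3 / root 3 s ^ 2 \<le> u s / x s"
          using x_le_root[of s] xs[OF s(1) s'(1)] upos[OF s(1) s'(1)] s c l(1) by (intro frac_le) auto
        then have "sqrt 3 / root 3 s ^ 2 * (1 / 8 - 1 / sqrt (1 + (sqrt 3 + l)\<^sup>2) ^ 3)
            \<le> u s / x s * (1 / 8 - 1 / sqrt (1 + (u s)\<^sup>2) ^ 3)"
          using pos u l(1) upos[OF s(1) s'(1)] xs[OF s(1) s'(1)] by (intro mult_mono cube_mono) auto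
        then show ?thesis unfolding w1_eq[OF s(1) s'(1)] k_def by simp
      qed
      ultimately show "\<exists>k c'. 0 < k \<and> 0 < c' \<and> c' < c \<and> (\<forall>s. 0 < s \<longrightarrow> s < c' \<longrightarrow> - w1 s \<le> - k / root 3 s ^ 2)"
        using c by (intro exI[of _ k] exI[of _ "c / 2"]) auto
    qed (use * X_le in auto)
    from tendsto_add[OF tendsto_const[of "sqrt 3"] this] show ?thesis by simp
  qed
  then show ?thesis by (simp add: u_def[abs_def])
qed

end

subsection \<open>Excluding triple collisions\<close>

text \<open>For w = sqrt 3 b the square of the root exceeds that of (a + 3b)/2 by 3/4 (a - b)^2.
  Then 1/t is convex, applied to a and b with weights 1/4 and 3/4.\<close>

lemma inverse_sqrt_le_harmonic:
  fixes a b w :: real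
  assumes "0 < a" "0 < b" "sqrt 3 * b \<le> \<bar>w\<bar>"
  shows "2 / sqrt (a\<^sup>2 + w\<^sup>2) \<le> 1 / 4 * (1 / a) + 3 / 4 * (1 / b)"
proof -
  have "(sqrt 3 * b)\<^sup>2 \<le> \<bar>w\<bar>\<^sup>2" using assms by (intro power_mono) auto
  then have "3 * b\<^sup>2 \<le> w\<^sup>2" by (simp add: power_mult_distrib)
  moreover have "((a + 3 * b) / 2)\<^sup>2 = a\<^sup>2 + 3 * b\<^sup>2 - 3 / 4 * (a - b)\<^sup>2"
    by (simp add: power2_eq_square field_simps)
  ultimately have "((a + 3 * b) / 2)\<^sup>2 \<le> a\<^sup>2 + w\<^sup>2" using zero_le_power2[of "a - b"] by linarith
  then have "(a + 3 * b) / 2 \<le> sqrt (a\<^sup>2 + w\<^sup>2)" by (rule real_le_rsqrt)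
  then have "2 / sqrt (a\<^sup>2 + w\<^sup>2) \<le> 2 / ((a + 3 * b) / 2)"
    using assms by (intro divide_left_mono mult_pos_pos) (auto simp: add_pos_nonneg)
  also have "\<dots> \<le> 1 / 4 * (1 / a) + 3 / 4 * (1 / b)"
  proof -
    have "16 * (a * b) \<le> (b + 3 * a) * (a + 3 * b)"
      using zero_le_power2[of "a - b"] by (simp add: power2_eq_square algebra_simps)
    then have "4 / (a + 3 * b) \<le> (b + 3 * a) / (4 * (a * b))"
      using assms by (simp add: frac_le_eq field_simps)
    also have "\<dots> = 1 / 4 * (1 / a) + 3 / 4 * (1 / b)" using assms by (simp add: field_simps)
    finally show ?thesis by simp
  qed
  finally show ?thesis .
qed

context sitnikov
begin

section \<open>Folding an arc and cutting off a dip\<close>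

lemma act_abs_cong:
  assumes "\<And>r. s \<le> r \<Longrightarrow> r \<le> t \<Longrightarrow> \<bar>z r\<bar> = \<bar>y r\<bar>"
  shows "act z E s t = act y E s t"
proof -
  have "integral {s..t} (pot z) = integral {s..t} (pot y)"
    by (rule integral_cong) (auto intro: pot_cong assms)
  then show ?thesis by (simp add: act_def)
qed

text \<open>The potential is even in y and the absolute value is 1-Lipschitz, so folding an arc
  costs nothing and leads to another minimiser.\<close>

lemma locmin_fold:
  assumes lm: "locmin a y E" and "s \<le> t" and \<kappa>: "\<kappa> = 1 \<or> \<kappa> = - 1"
    and ends: "\<kappa> * \<bar>y s\<bar> = y s" "\<kappa> * \<bar>y t\<bar> = y t"
    and sgn: "\<And>n. s \<le> of_int n \<Longrightarrow> of_int n \<le> t \<Longrightarrow> 0 \<le> of_int (a n) * (\<kappa> * \<bar>y (of_int n)\<bar>)"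
  shows "locmin a (patch s t y (\<lambda>r. \<kappa> * \<bar>y r\<bar>)) (patch_energy s t E E)"
proof (rule locmin_patch[OF lm _ ends _ \<open>s \<le> t\<close>])
  have "energy_bound (\<lambda>r. \<kappa> * \<bar>y r\<bar>) E s t"
    by (rule energy_bound_contraction[OF locmin_energy_bound[OF lm]]) (use \<kappa> in auto)
  then show "admissible a (\<lambda>r. \<kappa> * \<bar>y r\<bar>) E s t"
    using sgn by (simp add: admissible_def signed_def)
  show "act (\<lambda>r. \<kappa> * \<bar>y r\<bar>) E s t \<le> act y E s t"
    by (rule eq_refl, rule act_abs_cong) (use \<kappa> in \<open>auto simp: abs_mult\<close>)
qed

text \<open>Raising the curve to the smaller of its end values costs no kinetic energy, and it
  lowers the potential part strictly if the curve was below that level at \<open>r0\<close>.\<close>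

lemma locmin_no_dip:
  assumes lm: "locmin a y E" and \<kappa>: "\<kappa> = 1 \<or> \<kappa> = - 1"
    and nonneg: "\<And>r. s \<le> r \<Longrightarrow> r \<le> t \<Longrightarrow> 0 \<le> \<kappa> * y r"
    and sgn: "\<And>n. s \<le> of_int n \<Longrightarrow> of_int n \<le> t \<Longrightarrow> 0 \<le> of_int (a n) * \<kappa>"
    and r0: "s < r0" "r0 < t" "r0 \<notin> \<int>"
  shows "min \<bar>y s\<bar> \<bar>y t\<bar> \<le> \<bar>y r0\<bar>"
proof (rule ccontr)
  assume not: "\<not> min \<bar>y s\<bar> \<bar>y t\<bar> \<le> \<bar>y r0\<bar>"
  define e where "e = min \<bar>y s\<bar> \<bar>y t\<bar>"
  define z where "z r = \<kappa> * max \<bar>y r\<bar> e" for r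
  have e: "\<bar>y r0\<bar> < e" "e \<le> \<bar>y s\<bar>" "e \<le> \<bar>y t\<bar>" "0 \<le> e"
    using not by (auto simp: e_def)
  have y_eq: "y r = \<kappa> * \<bar>y r\<bar>" if "s \<le> r" "r \<le> t" for r
    using nonneg[OF that] \<kappa> by auto
  have "energy_bound z E s t"
    unfolding z_def
    by (rule energy_bound_contraction[OF locmin_energy_bound[OF lm]]) (use \<kappa> in auto)
  moreover have "0 \<le> of_int (a n) * z (of_int n)" if "s \<le> of_int n" "of_int n \<le> t" for n
    unfolding z_def mult.assoc[symmetric] by (rule mult_nonneg_nonneg[OF sgn[OF that]]) (use e in auto)
  ultimately have adm: "admissible a z E s t" by (simp add: admissible_def signed_def)
  have "z s = y s" "z t = y t" using y_eq[of s] y_eq[of t] e r0 by (auto simp: z_def max_def)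
  then have "act y E s t \<le> act z E s t" using r0 by (intro locmin_act_le[OF lm _ adm]) auto
  moreover have "integral {s..t} (pot z) < integral {s..t} (pot y)"
  proof (rule pot_integral_strict_mono[OF _ _ _ r0(1,2) _ r0(3)])
    show "continuous_on {s..t} y" by (rule locmin_continuous[OF lm])
    show "continuous_on {s..t} z" using adm energy_bound_continuous by (auto simp: admissible_def)
    show "\<bar>y r\<bar> \<le> \<bar>z r\<bar>" for r using \<kappa> by (auto simp: z_def abs_mult)
    show "\<bar>y r0\<bar> < \<bar>z r0\<bar>" using \<kappa> e by (auto simp: z_def abs_mult)
  qed
  ultimately show False by (simp add: act_def)
qed

text \<open>By concavity x lies above its chord from 0 to 1/2.\<close>

lemma x_ge_linear: "0 < q \<Longrightarrow> q \<le> 1/2 \<Longrightarrow> 2 * q * x (1/2) \<le> x q"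
proof (cases "q = 1/2")
  assume q: "0 < q" "q \<le> 1/2" and "q \<noteq> 1/2"
  then have "q < 1/2" by simp
  then obtain c where c: "q < c" "c < 1/2" "x (1/2) - x q = (1/2 - q) * dx c"
    using real_mvt[of q "1/2" x dx] x_continuous x_deriv[OF not_Ints_unit] q by auto
  have "q * dx c \<le> q * dx q" using dx_decreasing[of q c] c q by (intro mult_left_mono) auto
  also have "\<dots> \<le> x q" using x_dx_le[of q] q by simp
  finally have "(1/2 - q) * (q * dx c) \<le> (1/2 - q) * x q" using q by (intro mult_left_mono) auto
  then have "q * (x (1/2) - x q) \<le> (1/2 - q) * x q" unfolding c(3) by (simp add: mult_ac)
  then show ?thesis by (simp add: algebra_simps)
next
  assume "q = 1/2"
  show ?thesis unfolding \<open>q = 1/2\<close> by simp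
qed

text \<open>The curve that stays in the collinear configuration is unstable: the gain of potential energy
  is at least 5 d^2, the cost of the hat of height d is 4 d^2.\<close>

lemma locmin_not_zero:
  assumes lm: "locmin a y E" and zero: "\<And>r. of_int n < r \<Longrightarrow> r < of_int n + 1 \<Longrightarrow> y r = 0"
  shows False
proof -
  define s t m where "s = real_of_int n" and "t = s + 1" and "m = s + 1/2"
  \<comment> \<open>A quarter of the maximum of x: by concavity of x the hat then stays below x/4,
    and the distance S below 11/10 x.\<close>
  define d where "d = x (1/2) / 4"
  have "0 < d" using x_half_pos by (simp add: d_def)
  have zero': "y r = 0" if "s \<le> r" "r \<le> t" for r
  proof (rule continuous_constant_on_closure[of "{s<..<t}" y])
    show "continuous_on (closure {s<..<t}) y"
      by (rule continuous_on_subset[OF locmin_continuous_UNIV[OF lm]]) auto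
  qed (use zero that in \<open>auto simp: s_def t_def\<close>)
  define z1 where "z1 r = 2 * d * (r - s) + 0" for r
  define z2 where "z2 r = (- 2 * d) * (r - t) + 0" for r
  define F1 where "F1 r = (2 * d)\<^sup>2 * r" for r
  define F2 where "F2 r = (- 2 * d)\<^sup>2 * r" for r
  define z F where "z = join m z1 z2" and "F = join_energy m F1 F2"
  have "z1 m = z2 m" by (simp add: z1_def z2_def m_def t_def)
  then have eb: "energy_bound z F s t"
    unfolding z_def F_def z1_def[abs_def] F1_def[abs_def] z2_def[abs_def] F2_def[abs_def]
    by (intro energy_bound_join energy_bound_affine)
  have ends: "z s = 0" "z t = 0" by (auto simp: z_def join_def z1_def z2_def m_def t_def)
  have "signed a z s t"
    unfolding signed_def
  proof (intro allI impI)
    fix k assume "s \<le> of_int k" "of_int k \<le> t"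
    then have "k = n \<or> k = n + 1" unfolding s_def t_def by linarith
    then have "z (of_int k) = 0" using ends by (auto simp: s_def t_def)
    then show "0 \<le> of_int (a k) * z (of_int k)" by simp
  qed
  then have "act y E s t \<le> act z F s t"
    using eb ends zero'[of s] zero'[of t] by (intro locmin_act_le[OF lm]) (auto simp: admissible_def t_def)
  moreover have "F t - F s = 4 * d\<^sup>2"
    by (simp add: F_def join_energy_def F1_def F2_def m_def t_def power2_eq_square algebra_simps)
  moreover have "0 \<le> E t - E s"
    using energy_bound_mono[OF locmin_energy_bound[OF lm], of s s t t] by (simp add: t_def)
  moreover have "integral {s..t} (pot z) \<le> integral {s..t} (\<lambda>r. pot y r - 5 * d\<^sup>2)"
  proof (rule integral_le_off_finite[OF finite_Ints_Icc[of s t]])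
    show "pot z integrable_on {s..t}" by (rule pot_integrable[OF energy_bound_continuous[OF eb]])
    show "(\<lambda>r. pot y r - 5 * d\<^sup>2) integrable_on {s..t}"
      by (intro integrable_diff pot_integrable locmin_continuous[OF lm] integrable_const_ivl)
    fix r assume r: "r \<in> {s..t} - \<int> \<inter> {s..t}"
    then have r': "r \<notin> \<int>" "s \<le> r" "r \<le> t" by auto
    define q where "q = (if r \<le> m then r - s else t - r)"
    have "r \<noteq> s" "r \<noteq> t" using r' by (auto simp: s_def t_def)
    then have q: "0 < q" "q \<le> 1/2" using r' by (auto simp: q_def m_def t_def)
    have zq: "z r = 2 * d * q" by (auto simp: z_def join_def z1_def z2_def q_def algebra_simps)
    have xq: "x r = x q"
      using x_add_int[of "r - s" n] x_int_minus[of "n + 1" r] by (auto simp: q_def s_def t_def)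
    define X where "X = x q"
    define S where "S = sqrt (X\<^sup>2 + (2 * d * q)\<^sup>2)"
    have X: "0 < X" using x_pos[OF r'(1)] by (simp add: X_def xq)
    have "2 * q * x (1/2) \<le> X" using x_ge_linear[OF q] by (simp add: X_def)
    then have "2 * d * q \<le> X / 4" by (simp add: d_def)
    then have "(2 * d * q)\<^sup>2 \<le> (X / 4)\<^sup>2" using q \<open>0 < d\<close> by (intro power_mono) auto
    moreover have "(X / 4)\<^sup>2 = X\<^sup>2 / 16" "(11 / 10 * X)\<^sup>2 = 121 / 100 * X\<^sup>2"
      by (simp_all add: power_mult_distrib power_divide)
    ultimately have "X\<^sup>2 + (2 * d * q)\<^sup>2 \<le> (11 / 10 * X)\<^sup>2"
      using zero_le_power2[of X] by linarith
    then have S: "S \<le> 11 / 10 * X" unfolding S_def using X by (intro real_le_lsqrt) auto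
    have SX: "X \<le> S" "0 < S" unfolding S_def using X by (auto intro: real_le_rsqrt simp: add_pos_nonneg)
    have "X ^ 3 \<le> 9 / 16 * q\<^sup>2" using x_cube_le[of q] q by (simp add: X_def)
    \<comment> \<open>The gain 1/X - 1/S equals 4 d^2 q^2 / (S X (S + X)). The denominator is at
      most 2.31 X^3, and X^3 at most 9/16 q^2, so the gain is at least 5/2 d^2.\<close>
    then have "5 / 2 * (S * X * (S + X)) \<le> 5 / 2 * ((11 / 10 * X) * X * (21 / 10 * X))"
      using S SX X by (intro mult_left_mono mult_mono) auto
    also have "\<dots> = 231 / 40 * X ^ 3" by (simp add: power3_eq_cube)
    also have "\<dots> \<le> 4 * q\<^sup>2"
      using \<open>X ^ 3 \<le> 9 / 16 * q\<^sup>2\<close> zero_le_power2[of q] by linarith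
    finally have "d\<^sup>2 * (5 / 2 * (S * X * (S + X))) \<le> d\<^sup>2 * (4 * q\<^sup>2)"
      by (rule mult_left_mono) simp
    then have "5 / 2 * d\<^sup>2 * (S * X * (S + X)) \<le> d\<^sup>2 * (4 * q\<^sup>2)"
      by (simp only: mult_ac)
    also have "\<dots> = (S - X) * (S + X)"
    proof -
      have "S\<^sup>2 = X\<^sup>2 + (2 * d * q)\<^sup>2" unfolding S_def by simp
      then show ?thesis by (simp add: power2_eq_square algebra_simps)
    qed
    finally have "5 / 2 * d\<^sup>2 * (S * X) \<le> S - X"
      using X SX mult_right_le_imp_le[of "5 / 2 * d\<^sup>2 * (S * X)" "S + X" "S - X"] by (simp add: mult_ac)
    then have "5 / 2 * d\<^sup>2 \<le> (S - X) / (S * X)" using X SX by (simp add: field_simps)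
    also have "\<dots> = 1 / X - 1 / S" using X SX by (simp add: field_simps)
    finally have "2 / S \<le> 2 / X - 5 * d\<^sup>2" by simp
    moreover have "pot y r = 2 / X"
      using zero'[OF r'(2,3)] X by (simp add: pot_def xq X_def[symmetric])
    moreover have "pot z r = 2 / S" by (simp add: pot_def xq zq X_def[symmetric] S_def)
    ultimately show "pot z r \<le> pot y r - 5 * d\<^sup>2" by simp
  qed
  moreover have "integral {s..t} (\<lambda>r. pot y r - 5 * d\<^sup>2) = integral {s..t} (pot y) - 5 * d\<^sup>2"
    by (subst integral_diff) (auto intro!: pot_integrable locmin_continuous[OF lm] simp: t_def)
  ultimately have "5 * d\<^sup>2 \<le> 4 * d\<^sup>2" unfolding act_def by linarith
  then show False using \<open>0 < d\<close> by simp
qed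

lemma nonsingular: "r \<notin> \<int> \<or> y r \<noteq> 0 \<Longrightarrow> (x r)\<^sup>2 + (y r)\<^sup>2 \<noteq> 0"
  using x_pos[of r] by (auto simp: sum_power2_eq_zero_iff)

lemma locmin_signed_equation:
  assumes lm: "locmin a y E" and \<kappa>: "\<kappa> = 1 \<or> \<kappa> = - 1" and r: "r \<notin> \<int> \<or> y r \<noteq> 0"
  shows "((\<lambda>r. \<kappa> * y r) has_real_derivative \<kappa> * deriv y r) (at r)"
    "((\<lambda>r. \<kappa> * deriv y r) has_real_derivative - force (\<lambda>r. \<kappa> * y r) r) (at r)"
proof -
  have "force (\<lambda>r. \<kappa> * y r) r = \<kappa> * force y r" using \<kappa> by (auto simp: force_def)
  then show "((\<lambda>r. \<kappa> * y r) has_real_derivative \<kappa> * deriv y r) (at r)"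
    "((\<lambda>r. \<kappa> * deriv y r) has_real_derivative - force (\<lambda>r. \<kappa> * y r) r) (at r)"
    using locmin_equation[OF lm nonsingular[of r y]] r by (auto intro!: derivative_eq_intros)
qed

lemma not_Ints_between: "of_int n < r \<Longrightarrow> r < of_int n + 1 \<Longrightarrow> r \<notin> (\<int> :: real set)"
  by (auto elim!: Ints_cases)

lemma force_nonneg: "0 \<le> y r \<Longrightarrow> 0 \<le> force y r"
  by (simp add: force_def)

lemma force_pos: "0 < y r \<Longrightarrow> 0 < force y r"
  by (auto simp: force_def intro!: divide_pos_pos add_nonneg_pos)

text \<open>An interior zero would be a minimum of \<kappa> y with zero speed. By concavity the
  curve would lie below its value there, hence vanish on the whole interval, contrary to the
  instability of the collinear configuration.\<close>

lemma locmin_positive_unit: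
  assumes lm: "locmin a y E" and \<kappa>: "\<kappa> = 1 \<or> \<kappa> = - 1"
    and nonneg: "\<And>r. of_int n \<le> r \<Longrightarrow> r \<le> of_int n + 1 \<Longrightarrow> 0 \<le> \<kappa> * y r"
    and r0: "of_int n < r0" "r0 < of_int n + 1"
  shows "0 < \<kappa> * y r0"
proof (rule ccontr)
  define p p' where "p r = \<kappa> * y r" and "p' r = \<kappa> * deriv y r" for r
  have dp: "(p has_real_derivative p' r) (at r)" and dp': "(p' has_real_derivative - force p r) (at r)"
    if "of_int n < r" "r < of_int n + 1" for r
    unfolding p_def p'_def using locmin_signed_equation[OF lm \<kappa>] not_Ints_between[OF that] by auto
  assume "\<not> 0 < \<kappa> * y r0"
  then have p0: "p r0 = 0" using nonneg[of r0] r0 by (simp add: p_def)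
  define d where "d = min (r0 - of_int n) (of_int n + 1 - r0)"
  have "p' r0 = 0"
  proof (rule DERIV_local_min[OF dp[OF r0], of d])
    show "0 < d" using r0 by (simp add: d_def)
    show "\<forall>r. \<bar>r0 - r\<bar> < d \<longrightarrow> p r0 \<le> p r" using nonneg p0 by (auto simp: d_def p_def)
  qed
  have p'_anti: "p' t \<le> p' s" if "of_int n < s" "s \<le> t" "t < of_int n + 1" for s t
  proof (rule DERIV_nonpos_imp_nonincreasing[of s t p'])
    show "\<exists>q. (p' has_real_derivative q) (at r) \<and> q \<le> 0" if r: "s \<le> r" "r \<le> t" for r
      using dp'[of r] force_nonneg[of p r] nonneg[of r] r \<open>of_int n < s\<close> \<open>t < of_int n + 1\<close>
      by (intro exI[of _ "- force p r"]) (auto simp: p_def)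
  qed (use that in simp)
  have "p r \<le> p r0" if r: "of_int n < r" "r < of_int n + 1" for r
  proof (cases "r0 \<le> r")
    case True
    show ?thesis
    proof (rule DERIV_nonpos_imp_nonincreasing[of r0 r p, OF True])
      fix q assume "r0 \<le> q" "q \<le> r"
      then show "\<exists>d. (p has_real_derivative d) (at q) \<and> d \<le> 0"
        using dp[of q] p'_anti[of r0 q] \<open>p' r0 = 0\<close> r r0 by (intro exI[of _ "p' q"]) auto
    qed
  next
    case False
    then have "r \<le> r0" by simp
    show ?thesis
    proof (rule DERIV_nonneg_imp_nondecreasing[of r r0 p, OF \<open>r \<le> r0\<close>])
      fix q assume "r \<le> q" "q \<le> r0"
      then show "\<exists>d. (p has_real_derivative d) (at q) \<and> 0 \<le> d"
        using dp[of q] p'_anti[of q r0] \<open>p' r0 = 0\<close> r r0 by (intro exI[of _ "p' q"]) auto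
    qed
  qed
  then have "y r = 0" if "of_int n < r" "r < of_int n + 1" for r
    using nonneg[of r] p0 that \<kappa> by (force simp: p_def)
  then show False using locmin_not_zero[OF lm] by blast
qed

lemma locmin_collision_asymptotics:
  assumes lm: "locmin a y E" and y0: "y 0 = 0" and \<kappa>: "\<kappa> = 1 \<or> \<kappa> = - 1"
    and pos: "\<And>r. 0 < r \<Longrightarrow> r < 1 \<Longrightarrow> 0 < \<kappa> * y r"
  shows "((\<lambda>s. \<bar>y s\<bar> / x s) \<longlongrightarrow> sqrt 3) (at_right 0)"
proof -
  have "((\<lambda>s. \<kappa> * y s / x s) \<longlongrightarrow> sqrt 3) (at_right 0)"
  proof (rule collision_asymptotics[where p' = "\<lambda>s. \<kappa> * deriv y s" and C = "E 1 - E 0"])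
    show "continuous_on {0..1} (\<lambda>s. \<kappa> * y s)"
      by (intro continuous_intros locmin_continuous[OF lm])
    show "(\<kappa> * y s)\<^sup>2 \<le> (E 1 - E 0) * s" if "0 < s" "s < 1" for s
      using energy_bound_le[OF locmin_energy_bound[OF lm], of 0 0 s 1] that y0 \<kappa>
      by (auto simp: mult.commute)
  qed (use y0 pos locmin_signed_equation[OF lm \<kappa>] not_Ints_unit in auto)
  moreover have "\<forall>\<^sub>F s in at_right 0. \<kappa> * y s / x s = \<bar>y s\<bar> / x s"
    unfolding eventually_at_right_field using pos \<kappa> by (intro exI[of _ 1]) force
  ultimately show ?thesis by (rule Lim_transform_eventually)
qed

section \<open>Crossings at a triple collision\<close>

lemma x_ge_root_near_0: "\<exists>r>0. r \<le> 1/2 \<and> (\<forall>s. \<bar>s\<bar> \<le> r \<longrightarrow> root 3 s ^ 2 / 2 \<le> x s)"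
proof -
  obtain r where r: "r > 0" "r \<le> 1/2" "\<And>s. \<bar>s\<bar> \<le> r \<Longrightarrow> s\<^sup>2 / 8 \<le> x s ^ 3"
    using x_cube_ge_near_0 by blast
  have "root 3 s ^ 2 / 2 \<le> x s" if "\<bar>s\<bar> \<le> r" for s
  proof -
    have "(root 3 s ^ 2 / 2) ^ 3 = (root 3 s ^ 3)\<^sup>2 / 8" by (simp add: power_divide flip: power_mult)
    also have "\<dots> = s\<^sup>2 / 8" by (simp add: odd_real_root_pow)
    also have "\<dots> \<le> x s ^ 3" by (rule r(3)[OF that])
    finally show ?thesis using x_nonneg by (rule power_le_imp_le_base[of _ 2, simplified])
  qed
  then show ?thesis using r by blast
qed

text \<open>The bound 2 s^(-2/3) for 1/x has the primitive 6 s^(1/3), so that q, the cube root of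
  the half length, is the right scale.\<close>

lemma inverse_x_integral_le:
  assumes ge: "\<And>s. \<bar>s\<bar> \<le> r \<Longrightarrow> root 3 s ^ 2 / 2 \<le> x s" and q: "0 < q" "q ^ 3 \<le> r"
  shows "integral {- (q ^ 3)..q ^ 3} (\<lambda>s. 1 / x s) \<le> 12 * q"
proof -
  have root: "root 3 (q ^ 3) = q" "root 3 (- (q ^ 3)) = - q"
    using q odd_real_root_power_cancel[of 3 q] by (simp_all add: real_root_minus)
  have "((\<lambda>s. 2 / root 3 s ^ 2) has_integral 6 * root 3 (q ^ 3) - 6 * root 3 (- (q ^ 3))) {- (q ^ 3)..q ^ 3}"
  proof (rule fundamental_theorem_of_calculus_interior_strong[of "{0}"])
    show "continuous_on {- (q ^ 3)..q ^ 3} (\<lambda>s. 6 * root 3 s)"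
      by (intro continuous_intros)
    fix s :: real assume "s \<in> {- (q ^ 3)<..<q ^ 3} - {0}"
    then have "s \<noteq> 0" by simp
    have "6 * inverse (real 3 * c ^ (3 - Suc 0)) = 2 / c ^ 2" for c :: real
      by (cases "c = 0") (simp_all add: field_simps)
    moreover have "((\<lambda>s. 6 * root 3 s) has_real_derivative 6 * inverse (real 3 * root 3 s ^ (3 - Suc 0))) (at s)"
      by (rule DERIV_cmult[OF DERIV_odd_real_root]) (use \<open>s \<noteq> 0\<close> in simp_all)
    ultimately have "((\<lambda>s. 6 * root 3 s) has_real_derivative 2 / root 3 s ^ 2) (at s)"
      by simp
    then show "((\<lambda>s. 6 * root 3 s) has_vector_derivative 2 / root 3 s ^ 2) (at s)"
      by (simp add: has_real_derivative_iff_has_vector_derivative)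
  qed (use q in auto)
  then have i: "((\<lambda>s. 2 / root 3 s ^ 2) has_integral 12 * q) {- (q ^ 3)..q ^ 3}"
    unfolding root by simp
  show ?thesis
  proof (rule has_integral_le[OF integrable_integral[OF inverse_x_integrable] i])
    fix s assume "s \<in> {- (q ^ 3)..q ^ 3}"
    then have "root 3 s ^ 2 / 2 \<le> x s" using q by (intro ge) auto
    have "1 / x s \<le> 1 / (root 3 s ^ 2 / 2)" if "s \<noteq> 0"
    proof -
      have "0 < root 3 s ^ 2 / 2" using that by simp
      moreover from this \<open>root 3 s ^ 2 / 2 \<le> x s\<close> have "0 < x s" by linarith
      ultimately show ?thesis
        using \<open>root 3 s ^ 2 / 2 \<le> x s\<close> by (intro divide_left_mono mult_pos_pos) auto
    qed
    then show "1 / x s \<le> 2 / root 3 s ^ 2" by (cases "s = 0") auto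
  qed
qed

text \<open>Comparison with the broken line through the collision: since y is of order q^2 at the
  times -q^3 and q^3, its kinetic part is at most 8q, and its potential part, at most twice the
  integral of 1/x, is at most 24q.\<close>

lemma collision_energy_le:
  assumes lm: "locmin a y E" and y0: "y 0 = 0" and q: "0 < q" "q ^ 3 \<le> 1/2"
    and small: "\<bar>y (q ^ 3)\<bar> \<le> 2 * q\<^sup>2" "\<bar>y (- (q ^ 3))\<bar> \<le> 2 * q\<^sup>2"
    and int: "integral {- (q ^ 3)..q ^ 3} (\<lambda>s. 1 / x s) \<le> 12 * q"
  shows "E (q ^ 3) - E (- (q ^ 3)) \<le> 32 * q"
proof -
  define l where "l = q ^ 3"
  have l: "0 < l" "l \<le> 1/2" using q by (auto simp: l_def)
  define c1 c2 where "c1 = - y (- l) / l" and "c2 = y l / l"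
  define z1 z2 where "z1 r = c1 * (r - 0) + 0" and "z2 r = c2 * (r - 0) + 0" for r
  define F1 F2 where "F1 r = c1\<^sup>2 * r" and "F2 r = c2\<^sup>2 * r" for r
  define z F where "z = join 0 z1 z2" and "F = join_energy 0 F1 F2"
  have eb: "energy_bound z F (- l) l"
    unfolding z_def F_def z1_def[abs_def] z2_def[abs_def] F1_def[abs_def] F2_def[abs_def]
    by (intro energy_bound_join energy_bound_affine) simp
  have z: "z (- l) = y (- l)" "z l = y l" "z 0 = 0"
    using l by (auto simp: z_def join_def z1_def z2_def c1_def c2_def)
  have "signed a z (- l) l"
    unfolding signed_def
  proof (intro allI impI)
    fix n :: int assume "- l \<le> of_int n" "of_int n \<le> l"
    then have "n = 0" using l by linarith
    then show "0 \<le> of_int (a n) * z (of_int n)" using z by simp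
  qed
  then have "act y E (- l) l \<le> act z F (- l) l"
    using l z eb by (intro locmin_act_le[OF lm]) (auto simp: admissible_def)
  moreover have "E l - E (- l) \<le> act y E (- l) l"
    by (rule energy_le_act[OF locmin_energy_bound[OF lm]])
  moreover have "F l - F (- l) \<le> 8 * q"
  proof -
    have sq: "(y r)\<^sup>2 \<le> 4 * q * l" if "\<bar>y r\<bar> \<le> 2 * q\<^sup>2" for r
    proof -
      have "\<bar>y r\<bar>\<^sup>2 \<le> (2 * q\<^sup>2)\<^sup>2" using that by (intro power_mono) auto
      also have "\<dots> = 4 * q * l" by (simp add: l_def power2_eq_square power3_eq_cube)
      finally show ?thesis by simp
    qed
    have "F l - F (- l) = c2\<^sup>2 * l + c1\<^sup>2 * l"
      using l by (simp add: F_def join_energy_def F1_def F2_def)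
    also have "\<dots> = (y l)\<^sup>2 / l + (y (- l))\<^sup>2 / l"
      using l by (simp add: c1_def c2_def power2_eq_square)
    also have "\<dots> \<le> 4 * q + 4 * q"
      using sq[of l] sq[of "- l"] small l by (intro add_mono) (auto simp: l_def[symmetric] field_simps)
    finally show ?thesis by simp
  qed
  moreover have "integral {- l..l} (pot z) \<le> 24 * q"
  proof -
    have "((\<lambda>s. 2 * (1 / x s)) has_integral 2 * integral {- l..l} (\<lambda>s. 1 / x s)) {- l..l}"
      by (intro has_integral_mult_right integrable_integral inverse_x_integrable)
    then have i: "((\<lambda>s. 2 / x s) has_integral 2 * integral {- l..l} (\<lambda>s. 1 / x s)) {- l..l}" by simp
    have "integral {- l..l} (pot z) \<le> integral {- l..l} (\<lambda>s. 2 / x s)"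
      by (rule integral_le_off_finite[OF finite_Ints_Icc[of "- l" l]])
        (use i pot_le[of _ z] in \<open>auto intro!: pot_integrable energy_bound_continuous[OF eb]\<close>)
    also have "\<dots> = 2 * integral {- l..l} (\<lambda>s. 1 / x s)" using i by (rule integral_unique)
    finally show ?thesis using int by (simp add: l_def)
  qed
  ultimately show ?thesis by (simp add: act_def l_def)
qed

lemma inverse_x_affine:
  assumes "0 < m" "m * s + c = s'" "m * t + c = t'"
  shows "((\<lambda>r. 1 / x (m * r + c)) has_integral integral {s'..t'} (\<lambda>s. 1 / x s) / m) {s..t}"
  using has_integral_affine_real[of "\<lambda>s. 1 / x s" m s c t] inverse_x_integrable assms by simp

text \<open>A crossing at a triple collision is moved by a piecewise linear change of time. Since
  2/sqrt(x^2 + 3 g^2) is at most 1/(4x) + 3/(4g), with equality only for x = g, and since the change of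
  time preserves the integral of 1/x, this gains a multiple of q where the crossing used to be,
  compared with errors of smaller constants.\<close>

lemma crossing_warp:
  assumes lm: "locmin a y E" and y0: "y 0 = 0"
    and asym: "((\<lambda>s. \<bar>y s\<bar> / x s) \<longlongrightarrow> sqrt 3) (at 0)"
  shows "\<exists>l z F \<theta>. 0 < l \<and> l < 1/2 \<and> energy_bound z F (- l) l \<and> z (- l) = y (- l) \<and> z l = y l \<and>
    - l < \<theta> \<and> \<theta> < 0 \<and> z 0 = y \<theta> \<and> act z F (- l) l < act y E (- l) l"
proof -
  \<comment> \<open>\<eta> bounds the relative error of the asymptotics, and e the relative shift of
    the crossing. In units of q the errors add up to about 5/10^5, while the gain is
    14/10^5.\<close>
  define \<eta> where "\<eta> = (1 / 10 ^ 6 :: real)"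
  define e where "e = (1 / 10 ^ 6 :: real)"
  have \<eta>: "0 < \<eta>" "\<eta> < 1 / 100" and e: "0 < e" "e < 1 / 100" by (auto simp: \<eta>_def e_def)
  have s3: "sqrt 3 < 1.74" by (rule real_less_lsqrt) (simp_all add: power2_eq_square)
  have "\<forall>\<^sub>F s in at 0. \<bar>\<bar>y s\<bar> / x s - sqrt 3\<bar> < sqrt 3 * \<eta>"
    using tendstoD[OF asym, of "sqrt 3 * \<eta>"] \<eta> by (simp add: dist_real_def)
  then obtain d where d: "d > 0" "\<And>s. s \<noteq> 0 \<Longrightarrow> \<bar>s\<bar> < d \<Longrightarrow> \<bar>\<bar>y s\<bar> / x s - sqrt 3\<bar> < sqrt 3 * \<eta>"
    unfolding eventually_at by (auto simp: dist_real_def)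
  obtain r where r: "r > 0" "r \<le> 1/2" "\<And>s. \<bar>s\<bar> \<le> r \<Longrightarrow> root 3 s ^ 2 / 2 \<le> x s"
    using x_ge_root_near_0 by blast
  define l where "l = min d r / 2"
  define q where "q = root 3 l"
  have l: "0 < l" "l < d" "l < r" "l < 1/2" using d r by (auto simp: l_def)
  have q: "0 < q" "q ^ 3 = l" using l by (auto simp: q_def)
  \<comment> \<open>On [0, j] the primaries are still close to their collision, whereas y is
    evaluated at a time of order k. The cube roots of k and j are q/100 and q/1000.\<close>
  define k j where "k = e * l" and "j = k / 1000"
  have kj: "0 < j" "j < k" "k < l" using l e by (auto simp: k_def j_def)
  \<comment> \<open>Sends -l, k, l to -l, 0, l: the new curve vanishes at k > 0, and at time 0 it
    still takes a value of y from the left side.\<close>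
  define \<tau> where "\<tau> s = (if s \<le> k then (s - k) / (1 + e) else (s - k) / (1 - e))" for s
  define L where "L = 1 / (1 - e)"
  have Lpos: "0 < L" "1 / (1 + e) \<le> L" using e by (auto simp: L_def field_simps)
  have \<tau>_ends: "\<tau> (- l) = - l" "\<tau> l = l" "\<tau> k = 0"
    using kj l e by (auto simp: \<tau>_def k_def field_simps)
  have \<tau>_diff: "0 \<le> \<tau> b - \<tau> a" "\<tau> b - \<tau> a \<le> L * (b - a)" if "a \<le> b" for a b
  proof -
    have low: "(b - a) / (1 + e) \<le> L * (b - a)" if "a \<le> b" for a b :: real
      using mult_right_mono[OF Lpos(2), of "b - a"] that by simp
    have high: "(b - a) / (1 - e) = L * (b - a)" for a b :: real by (simp add: L_def)
    consider "b \<le> k" | "a \<le> k" "k < b" | "k < a" using that by linarith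
    then have "0 \<le> \<tau> b - \<tau> a \<and> \<tau> b - \<tau> a \<le> L * (b - a)"
    proof cases
      case 1
      then have "\<tau> b - \<tau> a = (b - a) / (1 + e)" using that by (simp add: \<tau>_def diff_divide_distrib)
      then show ?thesis using low[OF that] that e by simp
    next
      case 2
      then have "\<tau> b - \<tau> a = (b - k) / (1 - e) + (k - a) / (1 + e)" by (simp add: \<tau>_def diff_divide_distrib)
      moreover have "(b - k) / (1 - e) + (k - a) / (1 + e) \<le> L * (b - k) + L * (k - a)"
        using high[where a = k and b = b] low[OF 2(1)] by simp
      moreover have "L * (b - k) + L * (k - a) = L * (b - a)" by (simp add: algebra_simps)
      ultimately show ?thesis using 2 e by simp
    next
      case 3
      then have "\<tau> b - \<tau> a = (b - a) / (1 - e)" using that by (simp add: \<tau>_def diff_divide_distrib)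
      then show ?thesis using high[where a = a and b = b] that e Lpos by simp
    qed
    then show "0 \<le> \<tau> b - \<tau> a" "\<tau> b - \<tau> a \<le> L * (b - a)" by auto
  qed
  have \<tau>_mono: "\<tau> a \<le> \<tau> b" if "a \<le> b" for a b using \<tau>_diff(1)[OF that] by simp
  have \<tau>_range: "\<tau> s \<in> {- l..l}" if "s \<in> {- l..l}" for s
    using \<tau>_mono[of "- l" s] \<tau>_mono[of s l] that \<tau>_ends by auto
  have \<tau>_nz: "\<tau> s \<noteq> 0" if "s \<noteq> k" for s using that e by (auto simp: \<tau>_def)
  define z F where "z s = y (\<tau> s)" and "F s = L * E (\<tau> s)" for s
  have eb: "energy_bound z F (- l) l"
    unfolding z_def F_def
    by (rule energy_bound_warp[where \<tau> = \<tau>, OF _ \<tau>_mono \<tau>_diff(2)])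
      (auto simp: \<tau>_ends locmin_energy_bound[OF lm])
  have not_Int: "s \<notin> \<int>" if "s \<noteq> 0" "s \<in> {- l..l}" for s
    using that l not_Ints_unit[of s] not_Ints_unit[of "- s"] by (cases "0 < s") auto
  have xpos: "0 < x s" if "s \<noteq> 0" "s \<in> {- l..l}" for s by (rule x_pos[OF not_Int[OF that]])
  have ratio: "sqrt 3 * ((1 - \<eta>) * x s) \<le> \<bar>y s\<bar>" "\<bar>y s\<bar> \<le> sqrt 3 * ((1 + \<eta>) * x s)"
    if s: "s \<noteq> 0" "s \<in> {- l..l}" for s
  proof -
    have "\<bar>\<bar>y s\<bar> / x s - sqrt 3\<bar> < sqrt 3 * \<eta>" using l s by (intro d(2)) auto
    then have "sqrt 3 * (1 - \<eta>) \<le> \<bar>y s\<bar> / x s" "\<bar>y s\<bar> / x s \<le> sqrt 3 * (1 + \<eta>)"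
      by (simp_all add: abs_less_iff algebra_simps)
    then show "sqrt 3 * ((1 - \<eta>) * x s) \<le> \<bar>y s\<bar>" "\<bar>y s\<bar> \<le> sqrt 3 * ((1 + \<eta>) * x s)"
      using xpos[OF s] by (simp_all add: field_simps)
  qed
  have root_le: "b\<^sup>2 \<le> root 3 s ^ 2" if "0 \<le> b" "b ^ 3 \<le> \<bar>s\<bar>" for b s :: real
  proof -
    have "b = root 3 (b ^ 3)" using that by (simp add: real_root_power_cancel)
    also have "\<dots> \<le> root 3 \<bar>s\<bar>" using that by simp
    finally have "b\<^sup>2 \<le> (root 3 \<bar>s\<bar>)\<^sup>2" using that by (intro power_mono) auto
    then show ?thesis by (simp add: real_root_abs)
  qed
  have root_ge: "root 3 s ^ 2 \<le> b\<^sup>2" if "0 \<le> b" "\<bar>s\<bar> \<le> b ^ 3" for b s :: real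
  proof -
    have "root 3 \<bar>s\<bar> \<le> root 3 (b ^ 3)" using that by simp
    also have "\<dots> = b" using that by (simp add: real_root_power_cancel)
    finally have "(root 3 \<bar>s\<bar>)\<^sup>2 \<le> b\<^sup>2" by (intro power_mono) auto
    then show ?thesis by (simp add: real_root_abs)
  qed
  define X where "X = integral {- l..l} (\<lambda>s. 1 / x s)"
  have X_le: "X \<le> 12 * q" unfolding X_def using inverse_x_integral_le[of r q] r q l by simp
  have X_nonneg: "0 \<le> X" unfolding X_def
    by (rule integral_nonneg[OF inverse_x_integrable]) (use x_nonneg in auto)
  have y_small: "\<bar>y s\<bar> \<le> 2 * q\<^sup>2" if "s = l \<or> s = - l" for s
  proof -
    have s: "s \<noteq> 0" "s \<in> {- l..l}" "\<bar>s\<bar> \<le> 1/2" "\<bar>s\<bar> \<le> q ^ 3" using that l q by auto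
    have "\<bar>y s\<bar> \<le> (sqrt 3 * (1 + \<eta>)) * x s" using ratio(2)[OF s(1,2)] by (simp add: mult_ac)
    also have "\<dots> \<le> (1.74 * (1 + 1 / 100)) * x s"
      using s3 \<eta> xpos[OF s(1,2)] by (intro mult_right_mono mult_mono) auto
    also have "\<dots> \<le> 2 * x s" using xpos[OF s(1,2)] by simp
    also have "x s \<le> root 3 s ^ 2" by (rule x_le_root[OF s(3)])
    also have "root 3 s ^ 2 \<le> q\<^sup>2" using q s(4) by (intro root_ge) auto
    finally show ?thesis by simp
  qed
  have dE: "E l - E (- l) \<le> 32 * q"
    using collision_energy_le[OF lm y0 q(1)] q l y_small X_le by (simp add: X_def)
  have half: "integral {- l..0} (\<lambda>s. 1 / x s) = integral {0..l} (\<lambda>s. 1 / x s)"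
    using Henstock_Kurzweil_Integration.integral_reflect_real[of l 0 "\<lambda>s. 1 / x s"]
    by (simp add: x_minus)
  have X_half: "integral {- l..0} (\<lambda>s. 1 / x s) + integral {0..l} (\<lambda>s. 1 / x s) = X"
    unfolding X_def using l
    by (intro Henstock_Kurzweil_Integration.integral_combine inverse_x_integrable) auto
  \<comment> \<open>The halves of X are equal by the symmetry of x, and they acquire the factors 1 +
    e and 1 - e.\<close>
  have warp_int: "((\<lambda>s. 1 / x (\<tau> s)) has_integral X) {- l..l}"
  proof -
    have "((\<lambda>s. 1 / x (1 / (1 + e) * s + - k / (1 + e))) has_integral integral {- l..0} (\<lambda>s. 1 / x s) / (1 / (1 + e))) {- l..k}"
    proof -
      have "1 / (1 + e) * (- l) + - k / (1 + e) = (- l * (1 + e)) / (1 + e)"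
        by (simp add: k_def distrib_left add_divide_distrib diff_divide_distrib mult.commute)
      then have "1 / (1 + e) * (- l) + - k / (1 + e) = - l" "1 / (1 + e) * k + - k / (1 + e) = 0"
        using e by simp_all
      then show ?thesis
        by (intro inverse_x_affine) (use e in simp_all)
    qed
    then have i1: "((\<lambda>s. 1 / x (\<tau> s)) has_integral integral {- l..0} (\<lambda>s. 1 / x s) / (1 / (1 + e))) {- l..k}"
      by (rule has_integral_eq[rotated]) (use kj in \<open>auto simp: \<tau>_def diff_divide_distrib\<close>)
    have "((\<lambda>s. 1 / x (1 / (1 - e) * s + - k / (1 - e))) has_integral integral {0..l} (\<lambda>s. 1 / x s) / (1 / (1 - e))) {k..l}"
    proof -
      have "1 / (1 - e) * l + - k / (1 - e) = (l * (1 - e)) / (1 - e)"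
        by (simp add: k_def right_diff_distrib diff_divide_distrib mult.commute)
      then have "1 / (1 - e) * l + - k / (1 - e) = l" "1 / (1 - e) * k + - k / (1 - e) = 0"
        using e by simp_all
      then show ?thesis
        by (intro inverse_x_affine) (use e in simp_all)
    qed
    then have i2: "((\<lambda>s. 1 / x (\<tau> s)) has_integral integral {0..l} (\<lambda>s. 1 / x s) / (1 / (1 - e))) {k..l}"
      by (rule has_integral_eq[rotated]) (use kj in \<open>auto simp: \<tau>_def diff_divide_distrib\<close>)
    have "((\<lambda>s. 1 / x (\<tau> s)) has_integral
        (integral {- l..0} (\<lambda>s. 1 / x s) / (1 / (1 + e)) + integral {0..l} (\<lambda>s. 1 / x s) / (1 / (1 - e)))) {- l..l}"
      using kj l by (intro has_integral_combine[OF _ _ i1 i2]) auto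
    moreover have "integral {- l..0} (\<lambda>s. 1 / x s) / (1 / (1 + e)) + integral {0..l} (\<lambda>s. 1 / x s) / (1 / (1 - e)) = X"
      unfolding X_half[symmetric] half by (simp add: algebra_simps)
    ultimately show ?thesis by simp
  qed
  \<comment> \<open>The surplus in the harmonic bound on [0, j]: there 1/(4x) alone is at least 25 *
    10^4/q^2, and the actual potential is at most 11 * 10^4/q^2.\<close>
  define D where "D = 14 * 10 ^ 4 / q\<^sup>2"
  define g where "g s = (if s \<in> {0..j} then D else 0)" for s
  have g_int: "(g has_integral D * j) {- l..l}"
  proof -
    have "((\<lambda>s. D) has_integral D * j) {0..j}"
      using has_integral_const_real[of D 0 j] kj by (simp add: mult.commute)
    moreover have "{0..j} \<subseteq> {- l..l}" using kj l by auto
    ultimately show ?thesis unfolding g_def[abs_def] by (simp only: has_integral_restrict)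
  qed
  define G where "G s = 1 / 4 * (1 / x s) + 3 / 4 / (1 - \<eta>) * (1 / x (\<tau> s)) - g s" for s
  have G_int: "(G has_integral 1 / 4 * X + 3 / 4 / (1 - \<eta>) * X - D * j) {- l..l}"
    unfolding G_def
    by (intro has_integral_diff has_integral_add has_integral_mult_right warp_int g_int)
      (auto simp: X_def intro!: integrable_integral inverse_x_integrable)
  have pot_z: "pot z s \<le> G s" if s: "s \<in> {- l..l} - {0, k}" for s
  proof -
    have s': "s \<noteq> 0" "s \<in> {- l..l}" "\<tau> s \<noteq> 0" "\<tau> s \<in> {- l..l}" using s \<tau>_nz \<tau>_range by auto
    show ?thesis
    proof (cases "s \<in> {0..j}")
      case False
      have "pot z s \<le> 1 / 4 * (1 / x s) + 3 / 4 * (1 / ((1 - \<eta>) * x (\<tau> s)))"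
        unfolding pot_def z_def using xpos[OF s'(1,2)] xpos[OF s'(3,4)] \<eta> ratio(1)[OF s'(3,4)]
        by (intro inverse_sqrt_le_harmonic) auto
      moreover have "g s = 0" unfolding g_def using False by (simp only: if_False)
      moreover have "3 / 4 * (1 / ((1 - \<eta>) * x (\<tau> s))) = 3 / 4 / (1 - \<eta>) * (1 / x (\<tau> s))" by simp
      ultimately show ?thesis unfolding G_def by linarith
    next
      case True
      have "(q / 200) ^ 3 \<le> \<bar>\<tau> s\<bar>"
      proof -
        have "s < k" using True kj by auto
        then have "\<bar>\<tau> s\<bar> = (k - s) / (1 + e)" using e by (simp add: \<tau>_def abs_if field_simps)
        moreover have "(k - k / 1000) / (1 + 1 / 100) \<le> (k - s) / (1 + e)"
          using True kj e by (intro frac_le) (auto simp: j_def)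
        moreover have "(q / 200) ^ 3 \<le> (k - k / 1000) / (1 + 1 / 100)"
          using q l by (simp add: power_divide k_def e_def)
        ultimately show ?thesis by linarith
      qed
      then have "(q / 200)\<^sup>2 \<le> root 3 (\<tau> s) ^ 2" using q by (intro root_le) auto
      also have "\<bar>\<tau> s\<bar> \<le> r" using s'(4) l by (auto simp: abs_le_iff)
      then have "root 3 (\<tau> s) ^ 2 \<le> 2 * x (\<tau> s)" using r(3)[of "\<tau> s"] by simp
      finally have "q\<^sup>2 / 40000 \<le> 2 * x (\<tau> s)" by (simp add: power_divide)
      moreover have "3 / 2 * x (\<tau> s) \<le> \<bar>y (\<tau> s)\<bar>"
      proof -
        have "3 / 2 \<le> sqrt 3 * (1 - \<eta>)"
        proof -
          have "1.6 \<le> sqrt 3" by (rule real_le_rsqrt) (simp add: power2_eq_square)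
          then have "1.6 * (1 - 1 / 100) \<le> sqrt 3 * (1 - \<eta>)" using \<eta> by (intro mult_mono) auto
          then show ?thesis by simp
        qed
        then have "3 / 2 * x (\<tau> s) \<le> (sqrt 3 * (1 - \<eta>)) * x (\<tau> s)"
          using xpos[OF s'(3,4)] by (intro mult_right_mono) auto
        then show ?thesis using ratio(1)[OF s'(3,4)] by (simp add: mult_ac)
      qed
      ultimately have yq: "3 / 4 * (q\<^sup>2 / 40000) \<le> \<bar>y (\<tau> s)\<bar>" by linarith
      have "\<bar>y (\<tau> s)\<bar> \<le> sqrt ((x s)\<^sup>2 + (y (\<tau> s))\<^sup>2)" by (rule real_le_rsqrt) simp
      then have le: "3 / 4 * (q\<^sup>2 / 40000) \<le> sqrt ((x s)\<^sup>2 + (y (\<tau> s))\<^sup>2)" using yq by linarith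
      have "0 < 3 / 4 * (q\<^sup>2 / 40000)" using q by simp
      then have "pot z s \<le> 2 / (3 / 4 * (q\<^sup>2 / 40000))"
        unfolding pot_def z_def using le by (intro divide_left_mono mult_pos_pos) linarith+
      also have "\<dots> \<le> 11 * 10 ^ 4 / q\<^sup>2" using q by (simp add: field_simps)
      finally have 1: "pot z s \<le> 11 * 10 ^ 4 / q\<^sup>2" .
      have "s \<le> (q / 1000) ^ 3" using True q by (simp add: power_divide j_def k_def e_def)
      then have "root 3 s ^ 2 \<le> (q / 1000)\<^sup>2" using True q by (intro root_ge) auto
      moreover have "\<bar>s\<bar> \<le> 1/2" using s'(2) l by (auto simp: abs_le_iff)
      ultimately have "x s \<le> (q / 1000)\<^sup>2" using x_le_root[of s] by linarith
      then have "1 / (q / 1000)\<^sup>2 \<le> 1 / x s" using xpos[OF s'(1,2)] q by (intro divide_left_mono) auto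
      then have 2: "10 ^ 6 / q\<^sup>2 \<le> 1 / x s" by (simp add: power_divide)
      have "0 \<le> 3 / 4 / (1 - \<eta>) * (1 / x (\<tau> s))" using \<eta> xpos[OF s'(3,4)] by simp
      moreover have "11 * 10 ^ 4 / q\<^sup>2 + D \<le> 1 / 4 * (10 ^ 6 / q\<^sup>2)"
        using q by (simp add: D_def flip: add_divide_distrib)
      ultimately have "pot z s + D \<le> 1 / 4 * (1 / x s) + 3 / 4 / (1 - \<eta>) * (1 / x (\<tau> s))"
        using 1 2 by linarith
      moreover have "g s = D" unfolding g_def using True by (simp only: if_True)
      ultimately show ?thesis unfolding G_def by linarith
    qed
  qed
  have pz: "integral {- l..l} (pot z) \<le> 1 / 4 * X + 3 / 4 / (1 - \<eta>) * X - D * j"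
    unfolding integral_unique[OF G_int, symmetric]
    using G_int pot_z
    by (intro integral_le_off_finite[of "{0, k}"] pot_integrable energy_bound_continuous[OF eb]) auto
  have py: "1 / (1 + \<eta>) * X \<le> integral {- l..l} (pot y)"
  proof -
    have "integral {- l..l} (\<lambda>s. 1 / (1 + \<eta>) * (1 / x s)) \<le> integral {- l..l} (pot y)"
    proof (rule integral_le_off_finite[of "{0}"])
      fix s assume s: "s \<in> {- l..l} - {0}"
      then have s': "s \<noteq> 0" "s \<in> {- l..l}" by auto
      have "\<bar>y s\<bar>\<^sup>2 \<le> (sqrt 3 * ((1 + \<eta>) * x s))\<^sup>2" using ratio(2)[OF s'] by (intro power_mono) auto
      then have "(y s)\<^sup>2 \<le> 3 * ((1 + \<eta>) * x s)\<^sup>2" by (simp add: power_mult_distrib)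
      moreover have "(x s)\<^sup>2 \<le> ((1 + \<eta>) * x s)\<^sup>2"
        using \<eta> xpos[OF s'] by (intro power_mono) (auto simp: mult_le_cancel_right1)
      ultimately have "(x s)\<^sup>2 + (y s)\<^sup>2 \<le> (2 * ((1 + \<eta>) * x s))\<^sup>2" by (simp add: power_mult_distrib)
      then have "sqrt ((x s)\<^sup>2 + (y s)\<^sup>2) \<le> 2 * ((1 + \<eta>) * x s)"
        using \<eta> xpos[OF s'] by (intro real_le_lsqrt) auto
      moreover have "0 < sqrt ((x s)\<^sup>2 + (y s)\<^sup>2)" using xpos[OF s'] by (simp add: add_pos_nonneg)
      ultimately have "2 / (2 * ((1 + \<eta>) * x s)) \<le> pot y s"
        unfolding pot_def using \<eta> xpos[OF s'] by (intro divide_left_mono mult_pos_pos) auto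
      then show "1 / (1 + \<eta>) * (1 / x s) \<le> pot y s" by simp
    qed (auto intro!: pot_integrable locmin_continuous[OF lm] integrable_on_mult_right inverse_x_integrable
        simp del: times_divide_eq_right times_divide_eq_left)
    then show ?thesis unfolding X_def Henstock_Kurzweil_Integration.integral_mult_right .
  qed
  have dF: "F l - F (- l) = E l - E (- l) + (L - 1) * (E l - E (- l))"
    by (simp add: F_def \<tau>_ends algebra_simps)
  have "(L - 1) * (E l - E (- l)) \<le> (L - 1) * (32 * q)"
    using dE e by (intro mult_left_mono) (auto simp: L_def)
  moreover have "(1 / 4 + 3 / 4 / (1 - \<eta>) - 1 / (1 + \<eta>)) * X \<le> (1 / 4 + 3 / 4 / (1 - \<eta>) - 1 / (1 + \<eta>)) * (12 * q)"
    using X_le by (intro mult_left_mono) (auto simp: \<eta>_def)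
  moreover have "D * j = 14 / 10 ^ 5 * q"
    using q by (simp add: D_def j_def k_def e_def power2_eq_square power3_eq_cube flip: q(2))
  moreover have "(L - 1) * (32 * q) + (1 / 4 + 3 / 4 / (1 - \<eta>) - 1 / (1 + \<eta>)) * (12 * q) < 14 / 10 ^ 5 * q"
  proof -
    have "(L - 1) * 32 + (1 / 4 + 3 / 4 / (1 - \<eta>) - 1 / (1 + \<eta>)) * 12 < 14 / 10 ^ 5"
      by (simp add: L_def \<eta>_def e_def)
    from mult_strict_right_mono[OF this q(1)] show ?thesis by (simp only: distrib_right mult.assoc)
  qed
  moreover have "(1 / 4 + 3 / 4 / (1 - \<eta>) - 1 / (1 + \<eta>)) * X = 1 / 4 * X + 3 / 4 / (1 - \<eta>) * X - 1 / (1 + \<eta>) * X"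
    by (simp only: distrib_right left_diff_distrib)
  ultimately have "act z F (- l) l < act y E (- l) l"
    unfolding act_def dF using pz py by linarith
  moreover have "- l < \<tau> 0" "\<tau> 0 < 0"
  proof -
    have "\<tau> 0 = - (k / (1 + e))" using kj by (simp add: \<tau>_def)
    moreover have "0 < k / (1 + e)" "k / (1 + e) < l" using kj e l by (auto simp: k_def field_simps)
    ultimately show "- l < \<tau> 0" "\<tau> 0 < 0" by auto
  qed
  ultimately show ?thesis using l eb \<tau>_ends by (intro exI[of _ l] exI[of _ z] exI[of _ F] exI[of _ "\<tau> 0"]) (auto simp: z_def)
qed

text \<open>The sign prescribed at 0 fits the left side. The warped curve takes at 0 a value of y
  from before 0, hence is admissible.\<close>

lemma crossing_collision_not_locmin:
  assumes lm: "locmin a y E" and y0: "y 0 = 0" and \<kappa>: "\<kappa> = 1 \<or> \<kappa> = - 1"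
    and left: "\<And>r. 0 < r \<Longrightarrow> r < 1 \<Longrightarrow> 0 < \<kappa> * y (- r)"
    and right: "\<And>r. 0 < r \<Longrightarrow> r < 1 \<Longrightarrow> 0 < - \<kappa> * y r"
    and sgn: "0 \<le> of_int (a 0) * \<kappa>"
  shows False
proof -
  have "((\<lambda>s. \<bar>y s\<bar> / x s) \<longlongrightarrow> sqrt 3) (at_right 0)"
    using locmin_collision_asymptotics[OF lm y0, of "- \<kappa>"] \<kappa> right by auto
  moreover have "((\<lambda>s. \<bar>y (- s)\<bar> / x s) \<longlongrightarrow> sqrt 3) (at_right 0)"
    using locmin_collision_asymptotics[OF locmin_reflect[OF lm], of \<kappa>] \<kappa> left y0 by simp
  then have "((\<lambda>s. \<bar>y s\<bar> / x s) \<longlongrightarrow> sqrt 3) (at_left 0)"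
    by (simp add: filterlim_at_left_to_right x_minus)
  ultimately have "((\<lambda>s. \<bar>y s\<bar> / x s) \<longlongrightarrow> sqrt 3) (at 0)" by (simp add: filterlim_split_at)
  then obtain l z F \<theta> where l: "0 < l" "l < 1/2" and eb: "energy_bound z F (- l) l"
    and z: "z (- l) = y (- l)" "z l = y l" "z 0 = y \<theta>" and \<theta>: "- l < \<theta>" "\<theta> < 0"
    and less: "act z F (- l) l < act y E (- l) l"
    using crossing_warp[OF lm y0] by blast
  have "signed a z (- l) l"
    unfolding signed_def
  proof (intro allI impI)
    fix n :: int assume "- l \<le> of_int n" "of_int n \<le> l"
    then have "n = 0" using l by linarith
    have "0 < \<kappa> * y \<theta>" using left[of "- \<theta>"] \<theta> l by simp
    then have "0 \<le> (of_int (a 0) * \<kappa>) * (\<kappa> * y \<theta>)"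
      by (intro mult_nonneg_nonneg[OF sgn]) simp
    then show "0 \<le> of_int (a n) * z (of_int n)" using \<kappa> z \<open>n = 0\<close> by auto
  qed
  then have "act y E (- l) l \<le> act z F (- l) l"
    using l z eb by (intro locmin_act_le[OF lm]) (auto simp: admissible_def)
  then show False using less by simp
qed

lemma locmin_no_collision_0:
  assumes lm: "locmin a y E" and y0: "y 0 = 0"
    and a: "a 0 \<in> {1, - 1}" "a 1 \<in> {1, - 1}" "a (- 1) \<in> {1, - 1}" "a 0 = a 1 \<or> a 0 = a (- 1)"
  shows False
proof -
  define \<kappa>r \<kappa>l where "\<kappa>r = real_of_int (a 1)" and "\<kappa>l = real_of_int (a (- 1))"
  have \<kappa>: "\<kappa>r = 1 \<or> \<kappa>r = - 1" "\<kappa>l = 1 \<or> \<kappa>l = - 1" using a by (auto simp: \<kappa>r_def \<kappa>l_def)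
  have ar: "\<kappa>r * \<bar>y 1\<bar> = y 1" and al: "\<kappa>l * \<bar>y (- 1)\<bar> = y (- 1)"
    using locmin_sign[OF lm, of 1] locmin_sign[OF lm, of "- 1"] \<kappa>
    by (auto simp: \<kappa>r_def[symmetric] \<kappa>l_def[symmetric])
  \<comment> \<open>Each side is folded to the sign prescribed at the integer beyond it; at the
    collision itself either sign is admissible because y vanishes.\<close>
  define y1 E1 where "y1 = patch 0 1 y (\<lambda>r. \<kappa>r * \<bar>y r\<bar>)" and "E1 = patch_energy 0 1 E E"
  have lm1: "locmin a y1 E1"
    unfolding y1_def E1_def
  proof (rule locmin_fold[OF lm _ \<kappa>(1) _ ar])
    fix n :: int assume "0 \<le> real_of_int n" "real_of_int n \<le> 1"
    then have "n = 0 \<or> n = 1" by linarith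
    then show "0 \<le> of_int (a n) * (\<kappa>r * \<bar>y (of_int n)\<bar>)"
      using y0 \<kappa>(1) by (auto simp: \<kappa>r_def)
  qed (use y0 in auto)
  have y1: "y1 r = (if 0 \<le> r \<and> r \<le> 1 then \<kappa>r * \<bar>y r\<bar> else y r)" for r
    unfolding y1_def using y0 ar by (auto simp: patch_def join_def)
  define y2 E2 where "y2 = patch (- 1) 0 y1 (\<lambda>r. \<kappa>l * \<bar>y1 r\<bar>)" and "E2 = patch_energy (- 1) 0 E1 E1"
  have lm2: "locmin a y2 E2"
    unfolding y2_def E2_def
  proof (rule locmin_fold[OF lm1 _ \<kappa>(2)])
    fix n :: int assume "- 1 \<le> real_of_int n" "real_of_int n \<le> 0"
    then have "n = 0 \<or> n = - 1" by linarith
    then show "0 \<le> of_int (a n) * (\<kappa>l * \<bar>y1 (of_int n)\<bar>)"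
      using y0 \<kappa>(2) by (auto simp: y1 \<kappa>l_def)
  qed (use y0 al in \<open>auto simp: y1\<close>)
  have y2: "y2 r = (if - 1 \<le> r \<and> r \<le> 0 then \<kappa>l * \<bar>y1 r\<bar> else y1 r)" for r
    unfolding y2_def using y0 al by (auto simp: patch_def join_def y1)
  have y20: "y2 0 = 0" using y0 by (simp add: y2 y1)
  have right: "0 < \<kappa>r * y2 r" if "0 < r" "r < 1" for r
  proof (rule locmin_positive_unit[OF lm2 \<kappa>(1), of 0])
    show "0 \<le> \<kappa>r * y2 r" if "of_int 0 \<le> r" "r \<le> of_int 0 + 1" for r
      using that \<kappa> y0 by (auto simp: y2 y1)
  qed (use that in auto)
  have left: "0 < \<kappa>l * y2 (- r)" if "0 < r" "r < 1" for r
  proof (rule locmin_positive_unit[OF lm2 \<kappa>(2), of "- 1"])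
    show "0 \<le> \<kappa>l * y2 r" if "of_int (- 1) \<le> r" "r \<le> of_int (- 1) + 1" for r
      using that \<kappa> by (auto simp: y2)
  qed (use that in auto)
  show False
  proof (cases "\<kappa>l = \<kappa>r")
    case True
    then have a0: "real_of_int (a 0) = \<kappa>r" using a(4) by (auto simp: \<kappa>r_def \<kappa>l_def)
    define m where "m = min \<bar>y2 (- (1/2))\<bar> \<bar>y2 (1/2)\<bar>"
    have "0 < m" using right[of "1/2"] left[of "1/2"] by (auto simp: m_def)
    have "isCont y2 0" using locmin_continuous_UNIV[OF lm2] by (simp add: continuous_on_eq_continuous_at)
    then have "\<forall>\<^sub>F r in at 0. \<bar>y2 r\<bar> < m"
      using tendstoD[of y2 "y2 0" "at 0" m] \<open>0 < m\<close> y20 by (simp add: isCont_def dist_real_def)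
    then obtain d where d: "d > 0" "\<And>r. r \<noteq> 0 \<Longrightarrow> \<bar>r\<bar> < d \<Longrightarrow> \<bar>y2 r\<bar> < m"
      unfolding eventually_at by (auto simp: dist_real_def)
    define r where "r = min (d / 2) (1/4)"
    have r: "0 < r" "r < d" "r \<le> 1/4" using d by (auto simp: r_def)
    have "m \<le> \<bar>y2 r\<bar>"
      unfolding m_def
    proof (rule locmin_no_dip[OF lm2 \<kappa>(1)])
      show "0 \<le> \<kappa>r * y2 q" if "- (1/2) \<le> q" "q \<le> 1/2" for q
        using right[of q] left[of "- q"] True y20 that by (cases "q = 0"; cases "0 < q") auto
      show "0 \<le> of_int (a n) * \<kappa>r" if "- (1/2) \<le> real_of_int n" "of_int n \<le> (1/2 :: real)" for n
      proof -
        have "n = 0" using that by linarith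
        then show ?thesis using a0 \<kappa> by auto
      qed
      show "r \<notin> \<int>" using r by (intro not_Ints_unit) auto
    qed (use r in auto)
    then show False using d(2)[of r] r by simp
  next
    case False
    then have neg: "\<kappa>r = - \<kappa>l" using \<kappa> by auto
    show False
    proof (cases "real_of_int (a 0) = \<kappa>l")
      case True
      show False
        by (rule crossing_collision_not_locmin[OF lm2 y20 \<kappa>(2) left]) (use right neg True \<kappa> in auto)
    next
      case False
      \<comment> \<open>Time reversal exchanges the two sides, so the crossing can be moved in the
        other direction.\<close>
      then have "real_of_int (a 0) = \<kappa>r" using a(4) by (auto simp: \<kappa>r_def \<kappa>l_def)
      then show False
        using crossing_collision_not_locmin[OF locmin_reflect[OF lm2], of \<kappa>r] y20 \<kappa> left right neg
        by auto
    qed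
  qed
qed

text \<open>The form in which block lengths enter the exclusion of collisions: at each integer, the
  prescribed sign is shared with at least one side, so that a crossing can be moved to the other
  side.\<close>

definition good :: "(int \<Rightarrow> int) \<Rightarrow> bool" where
  "good a \<longleftrightarrow> (\<forall>n. a n \<in> {1, - 1} \<and> (a n = a (n + 1) \<or> a n = a (n - 1)))"

lemma goodD: "good a \<Longrightarrow> a n \<in> {1, - 1}" "good a \<Longrightarrow> a n = a (n + 1) \<or> a n = a (n - 1)"
  unfolding good_def by blast+

lemma good_real: "good a \<Longrightarrow> real_of_int (a n) = 1 \<or> real_of_int (a n) = - 1"
  using goodD(1)[of a n] by auto

lemma locmin_no_collision:
  assumes lm: "locmin a y E" and good: "good a"
  shows "0 < of_int (a n) * y (of_int n)"
proof -
  have "y (of_int n) \<noteq> 0"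
  proof
    assume "y (of_int n) = 0"
    then show False
      using locmin_no_collision_0[OF locmin_shift[OF lm, of n]] goodD(1)[OF good] goodD(2)[OF good, of n]
      by (simp add: add.commute)
  qed
  then show ?thesis using locmin_sign[OF lm, of n] good_real[OF good, of n] by auto
qed

lemma locmin_nonsingular:
  assumes "locmin a y E" "good a"
  shows "(x r)\<^sup>2 + (y r)\<^sup>2 \<noteq> 0"
proof (rule nonsingular)
  show "r \<notin> \<int> \<or> y r \<noteq> 0"
    using locmin_no_collision[OF assms] by (auto elim!: Ints_cases) (metis less_irrefl mult_zero_right)
qed

subsection \<open>Zeros of local minimisers\<close>

text \<open>Folded to one sign on the whole interval, the curve would dip to 0 between two nonzero
  end values.\<close>

lemma locmin_no_zero:
  assumes lm: "locmin a y E" and good: "good a" and eq: "a n * a (n + 1) = 1"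
    and t: "of_int n < t" "t < of_int n + 1"
  shows "y t \<noteq> 0"
proof
  assume "y t = 0"
  define \<kappa> where "\<kappa> = real_of_int (a n)"
  have \<kappa>: "\<kappa> = 1 \<or> \<kappa> = - 1" using good_real[OF good] by (simp add: \<kappa>_def)
  have an: "real_of_int (a (n + 1)) = \<kappa>"
    using eq goodD(1)[OF good, of n] goodD(1)[OF good, of "n + 1"] by (auto simp: \<kappa>_def)
  have ends: "0 < \<kappa> * y (of_int n)" "0 < \<kappa> * y (of_int n + 1)"
    using locmin_no_collision[OF lm good, of n] locmin_no_collision[OF lm good, of "n + 1"] an
    by (auto simp: \<kappa>_def)
  define z E' where "z = patch (of_int n) (of_int n + 1) y (\<lambda>r. \<kappa> * \<bar>y r\<bar>)"
    and "E' = patch_energy (of_int n) (of_int n + 1) E E"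
  have e: "\<kappa> * \<bar>y (of_int n)\<bar> = y (of_int n)" "\<kappa> * \<bar>y (of_int n + 1)\<bar> = y (of_int n + 1)"
    using ends \<kappa> by auto
  have int: "real_of_int (a k) = \<kappa>" if "real_of_int n \<le> of_int k" "real_of_int k \<le> of_int n + 1" for k
  proof -
    have "k = n \<or> k = n + 1" using that by linarith
    then show ?thesis using an by (auto simp: \<kappa>_def)
  qed
  have lm': "locmin a z E'"
    unfolding z_def E'_def
    by (rule locmin_fold[OF lm _ \<kappa> e]) (use int \<kappa> in auto)
  have z: "z r = \<kappa> * \<bar>y r\<bar>" if "of_int n \<le> r" "r \<le> of_int n + 1" for r
    unfolding z_def by (rule patch_inside) (use e that in auto)
  have "min \<bar>z (of_int n)\<bar> \<bar>z (of_int n + 1)\<bar> \<le> \<bar>z t\<bar>"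
    by (rule locmin_no_dip[OF lm' \<kappa>]) (use z int \<kappa> t not_Ints_between[OF t] in auto)
  then show False using z[of t] z[of "of_int n"] z[of "of_int n + 1"] e ends \<open>y t = 0\<close> t by auto
qed

text \<open>At the first zero the solution, being concave, crosses with nonzero speed. A second zero would
  therefore allow one to reflect the part in between.\<close>

lemma locmin_unique_zero:
  assumes lm: "locmin a y E" and good: "good a" and eq: "a n * a (n + 1) = - 1"
  shows "\<exists>!t. t \<in> {of_int n<..<of_int n + 1} \<and> y t = 0"
proof -
  define s t where "s = real_of_int n" and "t = real_of_int n + 1"
  define \<kappa> where "\<kappa> = real_of_int (a n)"
  have \<kappa>: "\<kappa> = 1 \<or> \<kappa> = - 1" using good_real[OF good] by (simp add: \<kappa>_def)
  have an: "real_of_int (a (n + 1)) = - \<kappa>"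
    using eq goodD(1)[OF good, of n] goodD(1)[OF good, of "n + 1"] by (auto simp: \<kappa>_def)
  have ends: "0 < \<kappa> * y s" "\<kappa> * y t < 0"
    using locmin_no_collision[OF lm good, of n] locmin_no_collision[OF lm good, of "n + 1"] an
    by (auto simp: \<kappa>_def s_def t_def)
  have cont: "continuous_on S (\<lambda>r. \<kappa> * y r)" for S
    by (intro continuous_intros continuous_on_subset[OF locmin_continuous_UNIV[OF lm]]) auto
  have "s < t" by (simp add: s_def t_def)
  then obtain t1 where t1: "s < t1" "t1 \<le> t" "\<kappa> * y t1 = 0" "\<And>r. s \<le> r \<Longrightarrow> r < t1 \<Longrightarrow> 0 < \<kappa> * y r"
    using first_zero_after[of s t "\<lambda>r. \<kappa> * y r" thesis] ends cont by auto
  have "t1 \<noteq> t" using t1(3) ends(2) by auto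
  then have t1': "t1 < t" "y t1 = 0" using t1(2,3) \<kappa> by auto
  have "t2 = t1" if t2: "s < t2" "t2 < t" "y t2 = 0" for t2
  proof (rule ccontr)
    assume "t2 \<noteq> t1"
    have "\<not> t2 < t1"
    proof
      assume "t2 < t1"
      then have "0 < \<kappa> * y t2" using t1(4)[of t2] t2(1) by simp
      then show False using t2(3) by simp
    qed
    then have less: "t1 < t2" using \<open>t2 \<noteq> t1\<close> by simp
    define p p' where "p r = \<kappa> * y r" and "p' r = \<kappa> * deriv y r" for r
    have dp: "(p has_real_derivative p' r) (at r)" and dp': "(p' has_real_derivative - force p r) (at r)"
      if "s < r" "r < t" for r
    proof -
      have "r \<notin> \<int>" using not_Ints_between[of n r] that by (simp add: s_def t_def)
      then show "(p has_real_derivative p' r) (at r)" "(p' has_real_derivative - force p r) (at r)"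
        unfolding p_def[abs_def] p'_def[abs_def] using locmin_signed_equation[OF lm \<kappa>, of r] by blast+
    qed
    \<comment> \<open>On (s, t1) the curve is positive and concave; with nonnegative speed at t1 it
      would increase up to the value 0.\<close>
    have "p' t1 < 0"
    proof (rule ccontr)
      assume "\<not> p' t1 < 0"
      have p'_pos: "0 < p' r" if r: "s < r" "r < t1" for r
      proof -
        have "p' t1 < p' r"
        proof (rule DERIV_neg_imp_decreasing_open[of r t1 p'])
          fix q assume q: "r < q" "q < t1"
          have "0 < force p q" using t1(4)[of q] q r by (intro force_pos) (auto simp: p_def)
          then show "\<exists>y. (p' has_real_derivative y) (at q) \<and> y < 0"
            using dp'[of q] q r t1' by (intro exI[of _ "- force p q"]) auto
        next
          show "continuous_on {r..t1} p'"
            by (rule DERIV_continuous_on[where D = "\<lambda>r. - force p r"], rule has_field_derivative_at_within, rule dp')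
              (use r t1' in auto)
        qed (use r in simp)
        then show ?thesis using \<open>\<not> p' t1 < 0\<close> by simp
      qed
      have "p s < p t1"
      proof (rule DERIV_pos_imp_increasing_open[of s t1 p])
        show "\<exists>d. (p has_real_derivative d) (at q) \<and> 0 < d" if "s < q" "q < t1" for q
          using dp[of q] p'_pos[of q] that t1' by (intro exI[of _ "p' q"]) auto
      qed (use t1 cont in \<open>auto simp: p_def[abs_def]\<close>)
      then show False using ends t1 by (simp add: p_def)
    qed
    from DERIV_neg_dec_right[OF dp this] t1 t1'
    obtain d where d: "d > 0" "\<And>h. 0 < h \<Longrightarrow> h < d \<Longrightarrow> p (t1 + h) < p t1" by auto
    \<comment> \<open>A time just past t1 at which y is nonzero: the folded curve then dips at t1,
      between s and m.\<close>
    define m where "m = t1 + min (d / 2) ((t2 - t1) / 2)"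
    have m: "t1 < m" "m < t2" "m < t1 + d" using d(1) less by (auto simp: m_def min_def field_simps)
    have "p m < 0" using d(2)[of "m - t1"] m t1 by (simp add: p_def)
    then have ym: "0 < \<bar>y m\<bar>" by (auto simp: p_def)
    define z E' where "z = patch s t2 y (\<lambda>r. \<kappa> * \<bar>y r\<bar>)" and "E' = patch_energy s t2 E E"
    have e: "\<kappa> * \<bar>y s\<bar> = y s" "\<kappa> * \<bar>y t2\<bar> = y t2" using ends t2 \<kappa> by auto
    have int: "real_of_int (a k) = \<kappa>" if "s \<le> of_int k" "of_int k \<le> t2" for k
    proof -
      have "k = n" using that t2 unfolding s_def t_def by linarith
      then show ?thesis by (simp add: \<kappa>_def)
    qed
    have lm': "locmin a z E'"
      unfolding z_def E'_def
      by (rule locmin_fold[OF lm _ \<kappa> e]) (use t2 int \<kappa> in auto)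
    have z: "z r = \<kappa> * \<bar>y r\<bar>" if "s \<le> r" "r \<le> t2" for r
      unfolding z_def by (rule patch_inside) (use e that in auto)
    have "min \<bar>z s\<bar> \<bar>z m\<bar> \<le> \<bar>z t1\<bar>"
    proof (rule locmin_no_dip[OF lm' \<kappa>])
      show "t1 \<notin> \<int>" using t1 t1' not_Ints_between[of n t1] by (simp add: s_def t_def)
    qed (use z int \<kappa> t1 t2 m in auto)
    moreover have "z t1 = 0" using z[of t1] t1' t1(1) less by simp
    moreover have "z s \<noteq> 0" using z[of s] t2(1) ends(1) \<kappa> by auto
    moreover have "z m \<noteq> 0" using z[of m] t1(1) m ym \<kappa> by auto
    ultimately show False by auto
  qed
  note unique = this
  show ?thesis
  proof (rule ex1I[of _ t1])
    show "t1 \<in> {of_int n<..<of_int n + 1} \<and> y t1 = 0"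
      using t1(1) t1' by (simp add: s_def t_def)
    show "r = t1" if "r \<in> {of_int n<..<of_int n + 1} \<and> y r = 0" for r
      using unique[of r] that by (simp add: s_def t_def)
  qed
qed

end

subsection \<open>Compactness\<close>

text \<open>A common Hoelder bound of exponent 1/2 near r carries the Cauchy property from a nearby
  rational over to r.\<close>

lemma limit_from_dense:
  fixes f :: "nat \<Rightarrow> real \<Rightarrow> real"
  assumes conv: "\<And>q. q \<in> \<rat> \<Longrightarrow> convergent (\<lambda>n. f n q)"
    and equi: "\<And>n s. \<bar>s - r\<bar> \<le> 1 \<Longrightarrow> (f n s - f n r)\<^sup>2 \<le> \<bar>s - r\<bar> * B"
  shows "convergent (\<lambda>n. f n r)"
proof -
  have "Cauchy (\<lambda>n. f n r)"
  proof (rule metric_CauchyI)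
    fix e :: real assume "0 < e"
    define \<delta> where "\<delta> = min 1 ((e / 3)\<^sup>2 / (\<bar>B\<bar> + 1))"
    have "\<delta> \<le> (e / 3)\<^sup>2 / (\<bar>B\<bar> + 1)" by (simp add: \<delta>_def)
    moreover have "0 < \<bar>B\<bar> + 1" by simp
    ultimately have "\<delta> * (\<bar>B\<bar> + 1) \<le> (e / 3)\<^sup>2" by (simp only: pos_le_divide_eq)
    then have \<delta>: "0 < \<delta>" "\<delta> \<le> 1" "\<delta> * (\<bar>B\<bar> + 1) \<le> (e / 3)\<^sup>2"
      using \<open>0 < e\<close> by (auto simp: \<delta>_def)
    obtain q where q: "q \<in> \<rat>" "r < q" "q < r + \<delta>" using Rats_dense_in_real[of r "r + \<delta>"] \<delta> by auto
    have near: "\<bar>f n q - f n r\<bar> < e / 3" for n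
    proof -
      have "(f n q - f n r)\<^sup>2 \<le> \<bar>q - r\<bar> * B" using q \<delta> by (intro equi) auto
      also have "\<dots> \<le> \<bar>q - r\<bar> * \<bar>B\<bar>" by (intro mult_left_mono) auto
      also have "\<dots> \<le> \<delta> * \<bar>B\<bar>" using q by (intro mult_right_mono) auto
      also have "\<dots> < \<delta> * (\<bar>B\<bar> + 1)" using \<delta> by simp
      also have "\<dots> \<le> (e / 3)\<^sup>2" by (rule \<delta>(3))
      finally have "\<bar>f n q - f n r\<bar>\<^sup>2 < (e / 3)\<^sup>2" by simp
      then show ?thesis using \<open>0 < e\<close> by (intro power2_less_imp_less[of _ "e / 3"]) auto
    qed
    have "Cauchy (\<lambda>n. f n q)" using conv[OF q(1)] convergent_Cauchy by blast
    then obtain M where M: "\<And>m n. m \<ge> M \<Longrightarrow> n \<ge> M \<Longrightarrow> dist (f m q) (f n q) < e / 3"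
      using \<open>0 < e\<close> metric_CauchyD[of "\<lambda>n. f n q" "e / 3"] by auto
    have "dist (f m r) (f n r) < e" if "m \<ge> M" "n \<ge> M" for m n
      using M[OF that] near[of m] near[of n] unfolding dist_real_def by linarith
    then show "\<exists>M. \<forall>m\<ge>M. \<forall>n\<ge>M. dist (f m r) (f n r) < e" by blast
  qed
  then show ?thesis by (simp add: Cauchy_convergent_iff)
qed

text \<open>The limit energy is the upper limit of the energies: the inequality defining a majorant
  survives because the increments of the curves converge.\<close>

lemma energy_bound_compact:
  fixes Y E :: "nat \<Rightarrow> real \<Rightarrow> real"
  assumes eb: "\<And>k s t. energy_bound (Y k) (E k) s t"
    and bdd: "\<And>r. \<exists>M. \<forall>k. \<bar>Y k r\<bar> \<le> M \<and> \<bar>E k r\<bar> \<le> M"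
  obtains \<sigma> y F where "strict_mono \<sigma>" "\<And>s t. energy_bound y F s t"
    "\<And>r. (\<lambda>k. Y (\<sigma> k) r) \<longlonglongrightarrow> y r"
    "\<And>n::int. (\<lambda>k. E (\<sigma> k) (of_int n)) \<longlonglongrightarrow> F (of_int n)"
proof -
  obtain M where M: "\<And>k r. \<bar>Y k r\<bar> \<le> M r \<and> \<bar>E k r\<bar> \<le> M r" using bdd by metis
  define M' where "M' r = M r + 1" for r
  have M': "0 < M' r" "\<bar>Y k r\<bar> \<le> M' r" "\<bar>E k r\<bar> \<le> M' r" for k r
    using M[of k r] by (auto simp: M'_def)
  \<comment> \<open>Curve and energy are paired and scaled pointwise, so that a single diagonal
    extraction, for functions with a common bound, serves both.\<close>
  define f where "f k r = (Y k r / M' r, E k r / M' r)" for k r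
  have "norm (f k r) \<le> 2" for k r
  proof -
    have "norm (f k r) \<le> norm (Y k r / M' r) + norm (E k r / M' r)"
      unfolding f_def by (rule norm_Pair_le)
    also have "\<dots> \<le> 1 + 1" using M'(1)[of r] M'(2)[of k r] M'(3)[of k r] by (intro add_mono) auto
    finally show ?thesis by simp
  qed
  then obtain \<sigma> where \<sigma>: "strict_mono (\<sigma> :: nat \<Rightarrow> nat)" "\<And>q. q \<in> \<rat> \<Longrightarrow> \<exists>l. (\<lambda>n. f (\<sigma> n) q) \<longlonglongrightarrow> l"
    using function_convergent_subsequence[OF countable_rat, of f 2] by metis
  have convE: "convergent (\<lambda>n. E (\<sigma> n) q)" and convY: "convergent (\<lambda>n. Y (\<sigma> n) q)" if q: "q \<in> \<rat>" for q
  proof -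
    obtain l where l: "(\<lambda>n. f (\<sigma> n) q) \<longlonglongrightarrow> l" using \<sigma>(2)[OF q] by blast
    have "(\<lambda>n. M' q * fst (f (\<sigma> n) q)) \<longlonglongrightarrow> M' q * fst l" "(\<lambda>n. M' q * snd (f (\<sigma> n) q)) \<longlonglongrightarrow> M' q * snd l"
      by (intro tendsto_intros l)+
    then show "convergent (\<lambda>n. E (\<sigma> n) q)" "convergent (\<lambda>n. Y (\<sigma> n) q)"
      using M'(1)[of q] by (auto simp: f_def convergent_def)
  qed
  have "convergent (\<lambda>n. Y (\<sigma> n) r)" for r
  proof (rule limit_from_dense[OF convY])
    fix n s assume "\<bar>s - r\<bar> \<le> 1"
    then have "(Y (\<sigma> n) s - Y (\<sigma> n) r)\<^sup>2 \<le> \<bar>s - r\<bar> * (E (\<sigma> n) (r + 1) - E (\<sigma> n) (r - 1))"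
      by (intro energy_bound_le_abs[OF eb]) auto
    also have "\<dots> \<le> \<bar>s - r\<bar> * (M' (r + 1) + M' (r - 1))"
      using M'(3)[of "\<sigma> n" "r + 1"] M'(3)[of "\<sigma> n" "r - 1"] by (intro mult_left_mono) auto
    finally show "(Y (\<sigma> n) s - Y (\<sigma> n) r)\<^sup>2 \<le> \<bar>s - r\<bar> * (M' (r + 1) + M' (r - 1))" .
  qed
  then obtain y where y: "\<And>r. (\<lambda>n. Y (\<sigma> n) r) \<longlonglongrightarrow> y r" unfolding convergent_def by metis
  define L where "L r = limsup (\<lambda>n. ereal (E (\<sigma> n) r))" for r
  define F where "F r = real_of_ereal (L r)" for r
  have LF: "L r = ereal (F r)" for r
  proof -
    have "L r \<le> ereal (M' r)" unfolding L_def
      using M'(3) by (intro Limsup_bounded always_eventually) (auto simp: abs_le_iff)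
    moreover have "ereal (- M' r) \<le> L r" unfolding L_def
      using M'(3) by (intro le_Limsup always_eventually) (auto simp: abs_le_iff minus_le_iff)
    ultimately have "\<bar>L r\<bar> \<noteq> \<infinity>" by auto
    then show ?thesis by (simp add: F_def ereal_real')
  qed
  have ebF: "energy_bound y F s t" for s t
  proof (rule energy_boundI)
    fix a b :: real assume "a < b"
    define d where "d n = (Y (\<sigma> n) b - Y (\<sigma> n) a)\<^sup>2 / (b - a)" for n
    have "(\<lambda>n. ereal (d n)) \<longlonglongrightarrow> ereal ((y b - y a)\<^sup>2 / (b - a))"
      unfolding d_def using \<open>a < b\<close> by (intro tendsto_intros y) auto
    from ereal_limsup_lim_add[OF this, of "\<lambda>n. ereal (E (\<sigma> n) a)"]
    have "limsup (\<lambda>n. ereal (d n) + ereal (E (\<sigma> n) a)) = ereal ((y b - y a)\<^sup>2 / (b - a)) + L a"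
      by (simp add: L_def)
    moreover have "limsup (\<lambda>n. ereal (d n) + ereal (E (\<sigma> n) a)) \<le> L b"
      unfolding L_def
    proof (intro Limsup_mono always_eventually allI)
      fix n
      have "(Y (\<sigma> n) b - Y (\<sigma> n) a)\<^sup>2 \<le> (b - a) * (E (\<sigma> n) b - E (\<sigma> n) a)"
        using energy_boundD[OF eb, of a a b b] \<open>a < b\<close> by simp
      then show "ereal (d n) + ereal (E (\<sigma> n) a) \<le> ereal (E (\<sigma> n) b)"
        using \<open>a < b\<close> by (simp add: d_def field_simps)
    qed
    ultimately have "(y b - y a)\<^sup>2 / (b - a) + F a \<le> F b" by (simp add: LF)
    then show "(y b - y a)\<^sup>2 \<le> (b - a) * (F b - F a)" using \<open>a < b\<close> by (simp add: field_simps)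
  qed
  \<comment> \<open>At rational times, in particular at integers, the energies converge along the
    subsequence, so the upper limit is a limit. This is why actions pass to the limit on windows
    with integer ends.\<close>
  have "(\<lambda>k. E (\<sigma> k) (of_int n)) \<longlonglongrightarrow> F (of_int n)" for n :: int
  proof -
    obtain l where l: "(\<lambda>k. E (\<sigma> k) (of_int n)) \<longlonglongrightarrow> l"
      using convE[of "of_int n"] by (auto simp: convergent_def)
    then have "L (of_int n) = ereal l" unfolding L_def by (intro lim_imp_Limsup) auto
    then show ?thesis using l by (simp add: F_def)
  qed
  then show ?thesis using that[OF \<sigma>(1) ebF y] by blast
qed

lemma energy_bound_lipschitz:
  assumes "\<And>a b. s \<le> a \<Longrightarrow> a < b \<Longrightarrow> b \<le> t \<Longrightarrow> \<bar>y b - y a\<bar> \<le> K * (b - a)"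
  shows "energy_bound y (\<lambda>r. K\<^sup>2 * r) s t"
proof (rule energy_boundI)
  fix a b assume ab: "s \<le> a" "a < b" "b \<le> t"
  have "\<bar>y b - y a\<bar>\<^sup>2 \<le> (K * (b - a))\<^sup>2" using assms[OF ab] by (intro power_mono) auto
  then show "(y b - y a)\<^sup>2 \<le> (b - a) * (K\<^sup>2 * b - K\<^sup>2 * a)"
    by (simp add: power2_eq_square algebra_simps)
qed

text \<open>The retraction of the line onto [0, n]. It freezes a curve outside [0, n], so that
  compactness on the whole line applies.\<close>

definition clamp_unit :: "real \<Rightarrow> real \<Rightarrow> real" where
  "clamp_unit n r = max 0 (min r n)"

lemma energy_bound_clamp:
  assumes "energy_bound z F 0 n" "0 \<le> n"
  shows "energy_bound (\<lambda>r. z (clamp_unit n r)) (\<lambda>r. F (clamp_unit n r) - F 0) s t"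
proof -
  have "energy_bound z F (clamp_unit n s) (clamp_unit n t)"
    by (rule energy_bound_subset[OF assms(1)]) (use assms(2) in \<open>auto simp: clamp_unit_def\<close>)
  then have "energy_bound (\<lambda>r. z (clamp_unit n r)) (\<lambda>r. 1 * F (clamp_unit n r)) s t"
    by (rule energy_bound_warp) (auto simp: clamp_unit_def)
  then show ?thesis by (rule energy_bound_cong[where c = "- F 0"]) auto
qed

context sitnikov
begin

lemma act_tendsto:
  assumes eb: "\<And>k s t. energy_bound (Y k) (E k) s t"
    and "\<And>r. (\<lambda>k. Y k r) \<longlonglongrightarrow> y r" "(\<lambda>k. E k s) \<longlonglongrightarrow> F s" "(\<lambda>k. E k t) \<longlonglongrightarrow> F t"
  shows "(\<lambda>k. act (Y k) (E k) s t) \<longlonglongrightarrow> act y F s t"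
  unfolding act_def
  by (intro tendsto_intros pot_integral_tendsto assms energy_bound_continuous[OF eb])

text \<open>Only non-strict signs survive a pointwise limit; strictness is regained by excluding
  collisions.\<close>

lemma signed_limit:
  assumes "\<And>k. signed a (Y k) s t" "\<And>r. (\<lambda>k. Y k r) \<longlonglongrightarrow> y r"
  shows "signed a y s t"
  unfolding signed_def
proof (intro allI impI)
  fix n assume n: "s \<le> of_int n" "of_int n \<le> t"
  have "(\<lambda>k. of_int (a n) * Y k (of_int n)) \<longlonglongrightarrow> of_int (a n) * y (of_int n)"
    by (intro tendsto_intros assms)
  then show "0 \<le> of_int (a n) * y (of_int n)"
    by (rule LIMSEQ_le_const) (use assms(1) n in \<open>auto simp: signed_def\<close>)
qed

text \<open>Opposite signs at k and k + 1 bound the value at k by the increment over that step,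
  which the action controls. The estimate |u| \<le> 1 + u^2 avoids square roots.\<close>

lemma crossing_bound:
  assumes adm: "admissible a z F s t" and k: "s \<le> of_int k" "of_int k + 1 \<le> t"
    and cross: "a k \<in> {1, - 1}" "a (k + 1) \<in> {1, - 1}" "a k \<noteq> a (k + 1)"
    and A: "act z F s t \<le> A" and r: "s \<le> r" "r \<le> t"
  shows "\<bar>z r\<bar> \<le> 2 + A + (t - s) * A"
proof -
  have eb: "energy_bound z F s t" using adm by (simp add: admissible_def)
  have dF: "F t - F s \<le> A" using energy_le_act[OF eb] A by simp
  have A0: "0 \<le> A" using act_nonneg[OF eb] A k by simp
  have le1: "\<bar>u\<bar> \<le> 1 + u\<^sup>2" for u :: real
    using zero_le_power2[of "\<bar>u\<bar> - 1"] zero_le_power2[of u] by (simp add: power2_eq_square algebra_simps)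
  have diff: "(z p - z q)\<^sup>2 \<le> \<bar>p - q\<bar> * A" if "p \<in> {s..t}" "q \<in> {s..t}" for p q
    using energy_bound_le_abs[OF eb that(2,1)] mult_left_mono[OF dF, of "\<bar>p - q\<bar>"] by simp
  have "0 \<le> of_int (a k) * z (of_int k)" "0 \<le> of_int (a (k + 1)) * z (of_int k + 1)"
    using adm k unfolding admissible_def signed_def by (metis add_increasing2 le_add_same_cancel1 of_int_1 of_int_add order_trans zero_le_one)+
  moreover have "of_int (a (k + 1)) = - (of_int (a k) :: real)" "(of_int (a k) :: real) \<in> {1, - 1}"
    using cross by auto
  ultimately have "\<bar>z (of_int k)\<bar> \<le> \<bar>z (of_int k + 1) - z (of_int k)\<bar>" by auto
  then have "\<bar>z (of_int k)\<bar>\<^sup>2 \<le> \<bar>z (of_int k + 1) - z (of_int k)\<bar>\<^sup>2" by (intro power_mono) auto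
  also have "\<dots> \<le> A" using diff[of "of_int k + 1" "of_int k"] k by simp
  finally have 1: "\<bar>z (of_int k)\<bar> \<le> 1 + A" using le1[of "z (of_int k)"] by simp
  have "(z r - z (of_int k))\<^sup>2 \<le> \<bar>r - of_int k\<bar> * A" using diff[of r "of_int k"] r k by simp
  also have "\<dots> \<le> (t - s) * A" using r k A0 by (intro mult_right_mono) auto
  finally show ?thesis using le1[of "z r - z (of_int k)"] 1 by linarith
qed

end

subsection \<open>Periodic minimisers\<close>

locale symmetric_sequence = sitnikov +
  fixes b :: "int \<Rightarrow> int" and N :: nat
  assumes N: "1 \<le> N"
    and good: "good b"
    and periodic: "\<And>n. b (n + int N) = b n"
    and even: "\<And>n. b (- n) = b n"
    and nonconst: "\<exists>n. b n \<noteq> b (n + 1)"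
begin

lemma periodic_int: "b (n + j * int N) = b n"
proof (cases "0 \<le> j")
  case True
  have "b (n + int k * int N) = b n" for k
  proof (induction k)
    case (Suc k)
    show ?case using periodic[of "n + int k * int N"] Suc by (simp add: algebra_simps)
  qed simp
  from this[of "nat j"] show ?thesis using True by simp
next
  case False
  have "b (n - int k * int N) = b n" for k
  proof (induction k)
    case (Suc k)
    show ?case using periodic[of "n - int (Suc k) * int N"] Suc by (simp add: algebra_simps)
  qed simp
  from this[of "nat (- j)"] show ?thesis using False by simp
qed

lemma crossing_in_block:
  obtains k where "j * int N \<le> k" "k + 1 \<le> (j + 1) * int N" "b k \<noteq> b (k + 1)"
proof -
  obtain n where n: "b n \<noteq> b (n + 1)" using nonconst by blast
  define k where "k = n mod int N + j * int N"
  have "n = n mod int N + (n div int N) * int N" by simp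
  then have "b (n mod int N) = b n" "b (n mod int N + 1) = b (n + 1)"
    using periodic_int[of "n mod int N" "n div int N"] periodic_int[of "n mod int N + 1" "n div int N"]
    by (simp_all add: add.commute add.left_commute)
  moreover have "b k = b (n mod int N)" "b (k + 1) = b (n mod int N + 1)"
    using periodic_int[of "n mod int N" j] periodic_int[of "n mod int N + 1" j]
    by (simp_all add: k_def add.commute add.left_commute)
  moreover have "0 \<le> n mod int N" "n mod int N < int N" using N by auto
  then have "j * int N \<le> k" "k + 1 \<le> (j + 1) * int N" unfolding k_def by (simp_all add: distrib_right)
  ultimately show ?thesis using that n by metis
qed

definition NN :: real where "NN = real N"

lemma NN_pos: "0 < NN" and NN_ge: "1 \<le> NN"
  using N by (auto simp: NN_def)

definition c :: real where
  "c = Inf {act z F 0 NN | z F. admissible b z F 0 NN}"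

lemma c_le: "admissible b z F 0 NN \<Longrightarrow> c \<le> act z F 0 NN"
  unfolding c_def
proof (rule cInf_lower)
  show "bdd_below {act z F 0 NN | z F. admissible b z F 0 NN}"
    by (rule bdd_belowI[of _ 0]) (use act_nonneg NN_pos in \<open>auto simp: admissible_def\<close>)
qed blast

lemma c_le_block:
  assumes "admissible b z F (of_int j * NN) (of_int (j + 1) * NN)"
  shows "c \<le> act z F (of_int j * NN) (of_int (j + 1) * NN)"
proof -
  define n where "n = j * int N"
  have n: "of_int n = of_int j * NN" "of_int n + NN = of_int (j + 1) * NN"
    by (simp_all add: n_def NN_def algebra_simps)
  have adm: "admissible b z F (0 + of_int n) (NN + of_int n)" using assms n by (simp add: add.commute)
  have "(\<lambda>k. b (k + n)) = b" using periodic_int by (auto simp: n_def)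
  then have "admissible b (\<lambda>r. z (r + of_int n)) (\<lambda>r. F (r + of_int n)) 0 NN"
    using admissible_shift[OF adm] by simp
  from c_le[OF this] have "c \<le> act z F (0 + of_int n) (NN + of_int n)"
    using act_shift[of z F 0 n NN] adm by (simp add: admissible_def)
  then show ?thesis using n by (simp add: add.commute)
qed

lemma c_le_blocks:
  assumes "admissible b z F (of_int i * NN) (of_int (i + int m) * NN)"
  shows "real m * c \<le> act z F (of_int i * NN) (of_int (i + int m) * NN)"
  using assms
proof (induction m)
  case (Suc m)
  define s t u where "s = of_int i * NN" and "t = of_int (i + int m) * NN" and "u = of_int (i + int (Suc m)) * NN"
  have le: "s \<le> t" "t \<le> u" using NN_pos by (auto simp: s_def t_def u_def intro!: mult_right_mono)
  have adm: "admissible b z F s u" using Suc.prems by (simp add: s_def u_def)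
  have "real m * c \<le> act z F s t"
    using Suc.IH admissible_subset[OF adm order_refl le(2)] by (simp add: s_def t_def)
  moreover have "c \<le> act z F t u"
    using c_le_block[of z F "i + int m"] admissible_subset[OF adm le(1) order_refl]
    by (simp add: t_def u_def add_ac)
  moreover have "act z F s t + act z F t u = act z F s u"
    using adm le by (intro act_combine) (auto simp: admissible_def)
  ultimately show ?case by (simp add: s_def u_def algebra_simps)
qed simp

text \<open>Used twice: to attain the free minimum, and for the translates of an orbit along its
  tail. The change of sign inside the period supplies the pointwise bounds.\<close>

lemma minimising_limit:
  fixes Z G :: "nat \<Rightarrow> real \<Rightarrow> real"
  assumes adm: "\<And>k. admissible b (Z k) (G k) 0 NN"
    and lim: "(\<lambda>k. act (Z k) (G k) 0 NN) \<longlonglongrightarrow> c"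
  obtains \<sigma> g F where "strict_mono \<sigma>" "admissible b g F 0 NN" "act g F 0 NN = c"
    "\<And>r. 0 \<le> r \<Longrightarrow> r \<le> NN \<Longrightarrow> (\<lambda>k. Z (\<sigma> k) r) \<longlonglongrightarrow> g r"
proof -
  define Y E where "Y k r = Z k (clamp_unit NN r)" and "E k r = G k (clamp_unit NN r) - G k 0" for k r
  have eb: "energy_bound (Y k) (E k) s t" for k s t
    unfolding Y_def E_def using adm[of k] NN_pos by (intro energy_bound_clamp) (auto simp: admissible_def)
  have cl: "clamp_unit NN r = r" if "0 \<le> r" "r \<le> NN" for r using that by (simp add: clamp_unit_def)
  have actY: "act (Y k) (E k) 0 NN = act (Z k) (G k) 0 NN" for k
    using NN_pos by (intro act_cong) (auto simp: Y_def E_def cl)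
  obtain A where A: "\<And>k. act (Z k) (G k) 0 NN \<le> A"
    using convergent_imp_Bseq[of "\<lambda>k. act (Z k) (G k) 0 NN"] lim
    by (auto simp: convergent_def Bseq_def abs_le_iff)
  obtain k0 where k0: "0 \<le> k0" "k0 + 1 \<le> int N" "b k0 \<noteq> b (k0 + 1)" using crossing_in_block[of 0] by auto
  have k0': "0 \<le> real_of_int k0" "real_of_int k0 + 1 \<le> NN" using k0 unfolding NN_def by linarith+
  have "\<bar>Y k r\<bar> \<le> 2 + A + NN * A \<and> \<bar>E k r\<bar> \<le> A" for k r
  proof -
    have r: "0 \<le> clamp_unit NN r" "clamp_unit NN r \<le> NN" using NN_pos by (auto simp: clamp_unit_def)
    have ebZ: "energy_bound (Z k) (G k) 0 NN" using adm[of k] by (simp add: admissible_def)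
    have "\<bar>Z k (clamp_unit NN r)\<bar> \<le> 2 + A + (NN - 0) * A"
      using k0' k0(3) goodD(1)[OF good] A r by (intro crossing_bound[OF adm[of k]]) auto
    moreover have "G k 0 \<le> G k (clamp_unit NN r)" "G k (clamp_unit NN r) \<le> G k NN"
      using energy_bound_mono[OF ebZ] r by auto
    moreover have "G k NN - G k 0 \<le> A" using energy_le_act[OF ebZ] A[of k] by simp
    ultimately show ?thesis by (simp add: Y_def E_def)
  qed
  then have bd: "\<exists>M. \<forall>k. \<bar>Y k r\<bar> \<le> M \<and> \<bar>E k r\<bar> \<le> M" for r
    by (intro exI[of _ "max (2 + A + NN * A) A"]) (auto simp: le_max_iff_disj)
  then obtain \<sigma> g F where \<sigma>: "strict_mono \<sigma>" "\<And>s t. energy_bound g F s t"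
    "\<And>r. (\<lambda>k. Y (\<sigma> k) r) \<longlonglongrightarrow> g r" "\<And>n::int. (\<lambda>k. E (\<sigma> k) (of_int n)) \<longlonglongrightarrow> F (of_int n)"
    using energy_bound_compact[of Y E, OF eb bd] by metis
  have "(\<lambda>k. act (Y (\<sigma> k)) (E (\<sigma> k)) 0 NN) \<longlonglongrightarrow> act g F 0 NN"
    using \<sigma>(4)[of 0] \<sigma>(4)[of "int N"] by (intro act_tendsto eb \<sigma>) (auto simp: NN_def)
  moreover have "(\<lambda>k. act (Y (\<sigma> k)) (E (\<sigma> k)) 0 NN) \<longlonglongrightarrow> c"
    unfolding actY using LIMSEQ_subseq_LIMSEQ[OF lim \<sigma>(1)] by (simp add: o_def)
  ultimately have "act g F 0 NN = c" using LIMSEQ_unique by blast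
  moreover have "signed b g 0 NN"
  proof (rule signed_limit[OF _ \<sigma>(3)])
    show "signed b (Y (\<sigma> k)) 0 NN" for k
      using adm[of "\<sigma> k"] cl by (auto simp: admissible_def signed_def Y_def)
  qed
  then have "admissible b g F 0 NN" using \<sigma>(2) by (simp add: admissible_def)
  moreover have "(\<lambda>k. Z (\<sigma> k) r) \<longlonglongrightarrow> g r" if "0 \<le> r" "r \<le> NN" for r
    using \<sigma>(3)[of r] cl[OF that] by (simp add: Y_def)
  ultimately show ?thesis using that \<sigma>(1) by blast
qed

lemma c_attained: "\<exists>g F. admissible b g F 0 NN \<and> act g F 0 NN = c"
proof -
  have "\<exists>z F. admissible b z F 0 NN \<and> act z F 0 NN < c + 1 / real (Suc k)" for k
  proof -
    have "admissible b (\<lambda>r. 0) (\<lambda>r. 0) 0 NN" by (simp add: admissible_def energy_bound_const signed_def)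
    then have ne: "{act z F 0 NN | z F. admissible b z F 0 NN} \<noteq> {}" by blast
    have "Inf {act z F 0 NN | z F. admissible b z F 0 NN} < c + 1 / real (Suc k)"
      unfolding c_def[symmetric] by simp
    from cInf_lessD[OF ne this] show ?thesis by blast
  qed
  then obtain Z G where ZG: "\<And>k. admissible b (Z k) (G k) 0 NN" "\<And>k. act (Z k) (G k) 0 NN < c + 1 / real (Suc k)"
    by metis
  have "(\<lambda>k. c + 1 / real (Suc k)) \<longlonglongrightarrow> c + 0"
    using tendsto_add[OF tendsto_const[of c] LIMSEQ_inverse_real_of_nat] by (simp only: inverse_eq_divide)
  then have lim: "(\<lambda>k. c + 1 / real (Suc k)) \<longlonglongrightarrow> c" by (simp only: add_0_right)
  have "(\<lambda>k. act (Z k) (G k) 0 NN) \<longlonglongrightarrow> c"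
  proof (rule tendsto_sandwich[OF _ _ tendsto_const lim])
    show "\<forall>\<^sub>F k in sequentially. c \<le> act (Z k) (G k) 0 NN"
      using c_le[OF ZG(1)] by simp
    show "\<forall>\<^sub>F k in sequentially. act (Z k) (G k) 0 NN \<le> c + 1 / real (Suc k)"
      using less_imp_le[OF ZG(2)] by simp
  qed
  from minimising_limit[OF ZG(1) this] show ?thesis by metis
qed

text \<open>Reflection in the midpoint of a period, under which b is invariant by evenness and
  periodicity.\<close>

definition flip :: "(real \<Rightarrow> real) \<Rightarrow> real \<Rightarrow> real" where
  "flip z r = z (NN - r)"

lemma flip_admissible:
  assumes "admissible b z F s t"
  shows "admissible b (flip z) (\<lambda>r. - flip F r) (NN - t) (NN - s)"
    and "act (flip z) (\<lambda>r. - flip F r) (NN - t) (NN - s) = act z F s t"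
proof -
  have fl: "(\<lambda>r. z (- (r + of_int (- int N)))) = flip z" for z :: "real \<Rightarrow> real"
    by (simp add: flip_def[abs_def] NN_def)
  have bb: "(\<lambda>k. b (- (k + - int N))) = b"
  proof
    fix k show "b (- (k + - int N)) = b k" using even[of "k - int N"] periodic[of "k - int N"] by simp
  qed
  have adm: "admissible (\<lambda>k. b (- k)) (\<lambda>r. z (- r)) (\<lambda>r. - F (- r)) (NN - t + of_int (- int N)) (NN - s + of_int (- int N))"
    using admissible_reflect[OF assms] by (simp add: NN_def)
  show "admissible b (flip z) (\<lambda>r. - flip F r) (NN - t) (NN - s)"
    using admissible_shift[OF adm] unfolding bb fl by (simp add: flip_def NN_def)
  have "act (\<lambda>r. z (- (r + of_int (- int N)))) (\<lambda>r. - F (- (r + of_int (- int N)))) (NN - t) (NN - s)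
      = act (\<lambda>r. z (- r)) (\<lambda>r. - F (- r)) (- t) (- s)"
    using act_shift[of "\<lambda>r. z (- r)" "\<lambda>r. - F (- r)" "NN - t" "- int N" "NN - s"] adm
    by (simp add: admissible_def NN_def)
  also have "\<dots> = act z F s t" by (rule act_reflect)
  finally show "act (flip z) (\<lambda>r. - flip F r) (NN - t) (NN - s) = act z F s t"
    by (simp add: fl flip_def[abs_def] NN_def)
qed

text \<open>Either half of a curve, continued by reflection, competes for the free minimum. Hence the
  free minimum is attained by a curve with equal end values.\<close>

lemma periodic_minimiser: "\<exists>g F. admissible b g F 0 NN \<and> act g F 0 NN = c \<and> g 0 = g NN"
proof -
  define h where "h = NN / 2"
  have h: "0 \<le> h" "h \<le> NN" "NN - h = h" "NN - NN = 0" "NN - 0 = NN" using NN_pos by (auto simp: h_def)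
  have double: "\<exists>w W. admissible b w W 0 NN \<and> act w W 0 NN = 2 * act z F 0 h \<and> w 0 = w NN"
    if adm: "admissible b z F 0 NN" for z F
  proof -
    define w W where "w = join h z (flip z)" and "W = join_energy h F (\<lambda>r. - flip F r)"
    have a1: "admissible b z F 0 h" by (rule admissible_subset[OF adm]) (use h in auto)
    note a2 = flip_admissible[OF a1, unfolded h]
    have eq: "z h = flip z h" using h by (simp add: flip_def)
    have "admissible b w W 0 NN" unfolding w_def W_def by (rule admissible_join[OF a1 a2(1) eq])
    moreover have "act w W 0 NN = act z F 0 h + act (flip z) (\<lambda>r. - flip F r) h NN"
      unfolding w_def W_def using a1 a2(1) eq h by (intro act_join) (auto simp: admissible_def)
    moreover have "w 0 = w NN"
      using h NN_pos by (simp add: w_def join_def flip_def h_def)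
    ultimately show ?thesis using a2(2) by auto
  qed
  obtain g F where g: "admissible b g F 0 NN" "act g F 0 NN = c" using c_attained by blast
  have fg: "admissible b (flip g) (\<lambda>r. - flip F r) 0 NN" using flip_admissible(1)[OF g(1)] by (simp add: h)
  obtain w W where w: "admissible b w W 0 NN" "act w W 0 NN = 2 * act g F 0 h" "w 0 = w NN"
    using double[OF g(1)] by blast
  obtain w' W' where w': "admissible b w' W' 0 NN" "act w' W' 0 NN = 2 * act (flip g) (\<lambda>r. - flip F r) 0 h"
    using double[OF fg] by blast
  have "admissible b g F h NN" by (rule admissible_subset[OF g(1)]) (use h in auto)
  then have "act (flip g) (\<lambda>r. - flip F r) 0 h = act g F h NN"
    using flip_admissible(2)[of g F h NN] h by simp
  moreover have "act g F 0 h + act g F h NN = c"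
    using act_combine[of g F 0 NN h] g h by (simp add: admissible_def)
  ultimately have "act w W 0 NN = c" using c_le[OF w(1)] c_le[OF w'(1)] w(2) w'(2) by linarith
  then show ?thesis using w by blast
qed

text \<open>A perturbed curve is compared with the iterated one over whole periods, where the latter
  attains the lower bound c in each. The energy grows by \<open>D\<close> with every period.\<close>

lemma periodic_extension:
  assumes adm: "admissible b g G 0 NN" and act: "act g G 0 NN = c" and ends: "g 0 = g NN"
  obtains \<gamma> \<Gamma> where "locmin b \<gamma> \<Gamma>" "\<And>r. \<gamma> (r + NN) = \<gamma> r" "\<And>r. 0 \<le> r \<Longrightarrow> r \<le> NN \<Longrightarrow> \<gamma> r = g r"
    "\<And>j. act \<gamma> \<Gamma> (of_int j * NN) (of_int (j + 1) * NN) = c"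
proof -
  define fl where "fl r = \<lfloor>r / NN\<rfloor>" for r
  define D where "D = G NN - G 0"
  define \<gamma> \<Gamma> where "\<gamma> r = g (r - of_int (fl r) * NN)" and "\<Gamma> r = G (r - of_int (fl r) * NN) + of_int (fl r) * D" for r
  have fl_eq: "fl r = j" if "of_int j * NN \<le> r" "r < of_int (j + 1) * NN" for r j
    unfolding fl_def using that NN_pos by (intro floor_unique) (auto simp: field_simps)
  have \<gamma>: "\<gamma> r = g (r - of_int j * NN)" and \<Gamma>: "\<Gamma> r = G (r - of_int j * NN) + of_int j * D"
    if r: "of_int j * NN \<le> r" "r \<le> of_int (j + 1) * NN" for r j
  proof -
    have "\<gamma> r = g (r - of_int j * NN) \<and> \<Gamma> r = G (r - of_int j * NN) + of_int j * D"
    proof (cases "r = of_int (j + 1) * NN")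
      case True
      have "fl r = j + 1" using NN_pos by (intro fl_eq) (auto simp: True)
      then show ?thesis using ends by (simp add: \<gamma>_def \<Gamma>_def True D_def algebra_simps)
    next
      case False
      then have "fl r = j" using r by (intro fl_eq) auto
      then show ?thesis by (simp add: \<gamma>_def \<Gamma>_def)
    qed
    then show "\<gamma> r = g (r - of_int j * NN)" "\<Gamma> r = G (r - of_int j * NN) + of_int j * D" by auto
  qed
  have block: "admissible b \<gamma> \<Gamma> (of_int j * NN) (of_int (j + 1) * NN)"
    "act \<gamma> \<Gamma> (of_int j * NN) (of_int (j + 1) * NN) = c" for j
  proof -
    define n where "n = j * int N"
    have n: "of_int n = of_int j * NN" by (simp add: n_def NN_def)
    have adm': "admissible b g G (of_int j * NN + of_int (- n)) (of_int (j + 1) * NN + of_int (- n))"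
      using adm n by (simp add: algebra_simps)
    have "(\<lambda>k. b (k + - n)) = b" using periodic_int[of _ "- j"] by (auto simp: n_def)
    then have sh: "admissible b (\<lambda>r. g (r + of_int (- n))) (\<lambda>r. G (r + of_int (- n))) (of_int j * NN) (of_int (j + 1) * NN)"
      using admissible_shift[OF adm'] by simp
    have "energy_bound \<gamma> \<Gamma> (of_int j * NN) (of_int (j + 1) * NN)"
      by (rule energy_bound_cong[of "\<lambda>r. g (r + of_int (- n))" "\<lambda>r. G (r + of_int (- n))" _ _ _ _ "of_int j * D"])
        (use sh \<gamma> \<Gamma> n in \<open>auto simp: admissible_def\<close>)
    then show "admissible b \<gamma> \<Gamma> (of_int j * NN) (of_int (j + 1) * NN)"
      using sh \<gamma>[of j] n by (auto simp: admissible_def signed_def)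
    have "act \<gamma> \<Gamma> (of_int j * NN) (of_int (j + 1) * NN)
        = act (\<lambda>r. g (r + of_int (- n))) (\<lambda>r. G (r + of_int (- n))) (of_int j * NN) (of_int (j + 1) * NN)"
      using \<gamma>[of j] \<Gamma>[of j] n NN_pos by (intro act_cong) (auto simp: algebra_simps)
    also have "\<dots> = act g G 0 NN"
      using act_shift[of g G "of_int j * NN" "- n" "of_int (j + 1) * NN"] adm' n
      by (simp add: admissible_def algebra_simps)
    finally show "act \<gamma> \<Gamma> (of_int j * NN) (of_int (j + 1) * NN) = c" using act by simp
  qed
  have blocks: "admissible b \<gamma> \<Gamma> (of_int i * NN) (of_int (i + int m) * NN) \<and>
      act \<gamma> \<Gamma> (of_int i * NN) (of_int (i + int m) * NN) = real m * c" for i m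
  proof (induction m)
    case 0
    have "admissible b \<gamma> \<Gamma> (of_int i * NN) (of_int i * NN)"
      by (rule admissible_subset[OF block(1)[of i]]) (use NN_pos in auto)
    then show ?case by simp
  next
    case (Suc m)
    define s t u where "s = of_int i * NN" and "t = of_int (i + int m) * NN" and "u = of_int (i + int (Suc m)) * NN"
    have le: "s \<le> t" "t \<le> u" using NN_pos by (auto simp: s_def t_def u_def intro!: mult_right_mono)
    have 1: "admissible b \<gamma> \<Gamma> s t" "act \<gamma> \<Gamma> s t = real m * c" using Suc by (auto simp: s_def t_def)
    have 2: "admissible b \<gamma> \<Gamma> t u" "act \<gamma> \<Gamma> t u = c"
      using block[of "i + int m"] by (simp_all add: t_def u_def add_ac)
    have eb: "energy_bound \<gamma> \<Gamma> s u"
      using 1 2 by (intro energy_bound_combine[of \<gamma> \<Gamma> s t u]) (auto simp: admissible_def)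
    moreover have "signed b \<gamma> s u"
      using 1 2 unfolding admissible_def signed_def by (meson linear)
    moreover have "act \<gamma> \<Gamma> s u = act \<gamma> \<Gamma> s t + act \<gamma> \<Gamma> t u"
      using act_combine[OF eb le] by simp
    ultimately show ?case using 1 2 by (simp add: admissible_def s_def u_def algebra_simps)
  qed
  have window: "\<exists>m. - real m * NN \<le> s \<and> t \<le> real m * NN" for s t
  proof -
    obtain m where m: "max \<bar>s\<bar> \<bar>t\<bar> \<le> real m" using real_arch_simple by blast
    have "real m * 1 \<le> real m * NN" using NN_ge by (intro mult_left_mono) auto
    then show ?thesis using m by (intro exI[of _ m]) auto
  qed
  have blocks2: "admissible b \<gamma> \<Gamma> (- real m * NN) (real m * NN)" "act \<gamma> \<Gamma> (- real m * NN) (real m * NN) = 2 * real m * c" for m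
    using blocks[of "- int m" "2 * m"] by (auto simp: algebra_simps)
  have adm\<gamma>: "admissible b \<gamma> \<Gamma> s t" for s t
    using window[of s t] blocks2(1) admissible_subset by blast
  have lm: "locmin b \<gamma> \<Gamma>"
  proof (rule locminI_large[OF adm\<gamma>])
    fix s t z F assume h: "s \<le> t" "admissible b z F s t" "z s = \<gamma> s" "z t = \<gamma> t"
    obtain m where m: "- real m * NN \<le> s" "t \<le> real m * NN" using window by blast
    have "admissible b (patch s t \<gamma> z) (patch_energy s t \<Gamma> F) (- real m * NN) (real m * NN)"
      by (rule admissible_patch[OF h(3,4,1) adm\<gamma> h(2) adm\<gamma>])
    \<comment> \<open>The lower bound c holds in every period of the patched curve, whatever values
      the patch gives to it at the ends of the period.\<close>
    then have "2 * real m * c \<le> act (patch s t \<gamma> z) (patch_energy s t \<Gamma> F) (- real m * NN) (real m * NN)"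
      using c_le_blocks[of _ _ "- int m" "2 * m"] by (simp add: algebra_simps)
    then show "\<exists>s' t'. s' \<le> s \<and> t \<le> t' \<and> act \<gamma> \<Gamma> s' t' \<le> act (patch s t \<gamma> z) (patch_energy s t \<Gamma> F) s' t'"
      using m blocks2(2)[of m] by (intro exI[of _ "- real m * NN"] exI[of _ "real m * NN"]) auto
  qed
  have "\<gamma> (r + NN) = \<gamma> r" for r
  proof -
    have "fl (r + NN) = fl r + 1" using NN_pos by (simp add: fl_def add_divide_distrib)
    then show ?thesis by (simp add: \<gamma>_def algebra_simps)
  qed
  moreover have "\<gamma> r = g r" if "0 \<le> r" "r \<le> NN" for r using \<gamma>[of 0 r] that by simp
  ultimately show ?thesis using that lm block(2) by blast
qed

end

subsection \<open>Convergence to a periodic minimiser\<close>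

lemma derivative_zero_if_constant_left:
  fixes f :: "real \<Rightarrow> real"
  assumes der: "(f has_real_derivative l) (at t)" and "0 < d"
    and const: "\<And>h. 0 < h \<Longrightarrow> h < d \<Longrightarrow> f (t - h) = f t"
  shows "l = 0"
proof (rule ccontr)
  assume "l \<noteq> 0"
  then consider "0 < l" | "l < 0" by linarith
  then have "\<exists>e>0. \<forall>h>0. h < e \<longrightarrow> f (t - h) \<noteq> f t"
    using DERIV_pos_inc_left[OF der] DERIV_neg_dec_left[OF der] by cases (metis less_irrefl)+
  then obtain e where e: "e > 0" "\<And>h. 0 < h \<Longrightarrow> h < e \<Longrightarrow> f (t - h) \<noteq> f t" by blast
  obtain h where "0 < h" "h < min d e" using dense[of 0 "min d e"] e(1) \<open>0 < d\<close> by auto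
  then show False using const[of h] e(2)[of h] by simp
qed

lemma derivative_zero_if_constant_right:
  fixes f :: "real \<Rightarrow> real"
  assumes der: "(f has_real_derivative l) (at t)" and "0 < d"
    and const: "\<And>h. 0 < h \<Longrightarrow> h < d \<Longrightarrow> f (t + h) = f t"
  shows "l = 0"
proof (rule ccontr)
  assume "l \<noteq> 0"
  then consider "0 < l" | "l < 0" by linarith
  then have "\<exists>e>0. \<forall>h>0. h < e \<longrightarrow> f (t + h) \<noteq> f t"
    using DERIV_pos_inc_right[OF der] DERIV_neg_dec_right[OF der] by cases (metis less_irrefl)+
  then obtain e where e: "e > 0" "\<And>h. 0 < h \<Longrightarrow> h < e \<Longrightarrow> f (t + h) \<noteq> f t" by blast
  obtain h where "0 < h" "h < min d e" using dense[of 0 "min d e"] e(1) \<open>0 < d\<close> by auto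
  then show False using const[of h] e(2)[of h] by simp
qed

lemma constant_sign_if_nonzero:
  fixes f :: "real \<Rightarrow> real"
  assumes cont: "\<And>a b. continuous_on {a..b} f" and nz: "\<And>r. T < r \<Longrightarrow> f r \<noteq> 0"
  shows "(\<forall>r>T. 0 < f r) \<or> (\<forall>r>T. f r < 0)"
proof (rule ccontr)
  assume "\<not> ?thesis"
  then obtain p q where pq: "T < p" "f p \<le> 0" "T < q" "0 \<le> f q" by (auto simp: not_less)
  then have pq': "f p < 0" "0 < f q" using nz by (auto simp: order_less_le)
  show False
  proof (cases "p < q")
    case True
    obtain r where "p \<le> r" "f r = 0" using last_zero_before[OF True cont pq(2) pq'(2)] by metis
    then show False using nz[of r] pq by simp
  next
    case False
    then have "q < p" using pq' by (cases "p = q") auto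
    obtain r where "q < r" "f r = 0" using first_zero_after[OF \<open>q < p\<close> cont pq'(2) pq(2)] by metis
    then show False using nz[of r] pq by simp
  qed
qed

context sitnikov
begin

lemma admissible_seq_cong:
  assumes "admissible a y E s t" "\<And>n. s \<le> of_int n \<Longrightarrow> of_int n \<le> t \<Longrightarrow> a n = b n"
  shows "admissible b y E s t"
  using assms unfolding admissible_def signed_def by auto

lemma good_shift: "good a \<Longrightarrow> good (\<lambda>k. a (k + n))"
  unfolding good_def by (metis add.assoc add.commute diff_add_eq)

text \<open>Two minimisers that meet twice may exchange the arcs in between; the exchanged curve is again
  a minimiser, hence has no corner, and uniqueness for the initial value problem applies.\<close>

lemma locmin_meets_shift_once:
  assumes lm: "locmin a y E" and good: "good a"
    and agree: "\<And>n. t1 \<le> of_int n \<Longrightarrow> a (n + P) = a n"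
    and t: "t1 < t2" and meet: "y t1 = y (t1 + of_int P)" "y t2 = y (t2 + of_int P)"
  shows "y = (\<lambda>r. y (r + of_int P))"
proof -
  define a' where "a' k = a (k + P)" for k
  define v V where "v r = y (r + of_int P)" and "V r = E (r + of_int P)" for r
  have lm': "locmin a' v V" unfolding a'_def[abs_def] v_def[abs_def] V_def[abs_def] by (rule locmin_shift[OF lm])
  have good': "good a'" unfolding a'_def[abs_def] by (rule good_shift[OF good])
  have ends: "v t1 = y t1" "v t2 = y t2" using meet by (simp_all add: v_def)
  \<comment> \<open>From t1 on the two sequences of signs agree, so each curve may compete with the
    other there.\<close>
  have adm1: "admissible a v V t1 t2"
    by (rule admissible_seq_cong[OF locmin_admissible[OF lm']]) (simp add: a'_def agree)
  have adm2: "admissible a' y E t1 t2"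
    by (rule admissible_seq_cong[OF locmin_admissible[OF lm]]) (simp add: a'_def agree)
  have le: "act v V t1 t2 \<le> act y E t1 t2"
    by (rule locmin_act_le[OF lm' _ adm2]) (use t ends in simp_all)
  define w W where "w = patch t1 t2 y v" and "W = patch_energy t1 t2 E V"
  have lmw: "locmin a w W"
    unfolding w_def W_def by (rule locmin_patch[OF lm adm1 ends le]) (use t in simp)
  have t12: "t1 \<le> t2" using t by simp
  have w_in: "w r = v r" if "t1 \<le> r" "r \<le> t2" for r
    unfolding w_def by (rule patch_inside[OF ends t12 that])
  have w_out: "w r = y r" if "r \<le> t1" for r
    unfolding w_def by (rule patch_outside[OF ends t12]) (use that in simp)
  note dw = locmin_equation(1)[OF lmw locmin_nonsingular[OF lmw good], of t1]
  note dy = locmin_equation[OF lm locmin_nonsingular[OF lm good]]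
  note dv = locmin_equation[OF lm' locmin_nonsingular[OF lm' good']]
  \<comment> \<open>The exchanged curve coincides with y before t1 and with v just after it, and it
    is differentiable at t1; so the two velocities agree.\<close>
  have "deriv w t1 - deriv y t1 = 0"
    by (rule derivative_zero_if_constant_left[OF DERIV_diff[OF dw dy(1)[of t1]], of 1]) (simp_all add: w_out)
  moreover have "deriv w t1 - deriv v t1 = 0"
    by (rule derivative_zero_if_constant_right[OF DERIV_diff[OF dw dv(1)[of t1]], of "t2 - t1"])
      (use t in \<open>simp_all add: w_in\<close>)
  ultimately have "deriv y t1 = deriv v t1" by simp
  then have "y = v"
    by (intro equation_unique[of y "deriv y" v "deriv v" t1] dy dv
        locmin_nonsingular[OF lm good] locmin_nonsingular[OF lm' good']) (simp_all add: ends)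
  then show ?thesis by (simp add: v_def[abs_def])
qed

end

context symmetric_sequence
begin

lemma periodic_shift:
  fixes f :: "real \<Rightarrow> real"
  assumes "\<And>r. f (r + NN) = f r"
  shows "f (r + real j * NN) = f r"
proof (induction j)
  case (Suc j)
  show ?case using assms[of "r + real j * NN"] Suc by (simp add: algebra_simps)
qed simp

lemma periodic_functions_eq:
  fixes f g :: "real \<Rightarrow> real"
  assumes "\<And>r. f (r + NN) = f r" "\<And>r. g (r + NN) = g r" "\<And>r. 0 \<le> r \<Longrightarrow> r \<le> NN \<Longrightarrow> f r = g r"
  shows "f r = g r"
proof -
  define j where "j = \<lfloor>r / NN\<rfloor>"
  define q where "q = r - of_int j * NN"
  have q: "0 \<le> q" "q \<le> NN"
    using floor_correct[of "r / NN"] NN_pos unfolding q_def j_def[symmetric]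
    by (simp_all add: field_simps)
  show ?thesis
  proof (cases "0 \<le> j")
    case True
    then have "r = q + real (nat j) * NN" by (simp add: q_def)
    then show ?thesis using periodic_shift[of f] periodic_shift[of g] assms q by metis
  next
    case False
    then have "q = r + real (nat (- j)) * NN" by (simp add: q_def)
    then show ?thesis using periodic_shift[of f] periodic_shift[of g] assms q by metis
  qed
qed

lemma converges_to_periodic:
  assumes lm: "locmin a y E" and ga: "good a"
    and agree: "\<And>n. int k * int N \<le> n \<Longrightarrow> a n = b n"
    and lim: "(\<lambda>j. act y E (real (k + j) * NN) (real (k + j + 1) * NN)) \<longlonglongrightarrow> c"
  obtains \<gamma> \<Gamma> B where "locmin b \<gamma> \<Gamma>" "\<And>r. \<gamma> (r + NN) = \<gamma> r"
    "\<And>r. (\<lambda>j. y (r + real j * NN)) \<longlonglongrightarrow> \<gamma> r" "\<And>r. real k * NN \<le> r \<Longrightarrow> \<bar>y r\<bar> \<le> B"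
proof -
  define T where "T = real k * NN"
  have agree': "a n = b n" if "T \<le> of_int n" for n
  proof (rule agree)
    have "of_int (int k * int N) \<le> (of_int n :: real)" using that by (simp add: T_def NN_def)
    then show "int k * int N \<le> n" by (simp only: of_int_le_iff)
  qed
  have block: "admissible b y E (real (k + j) * NN) (real (k + j + 1) * NN)" for j
  proof (rule admissible_seq_cong[OF locmin_admissible[OF lm]])
    fix n assume "real (k + j) * NN \<le> of_int n"
    moreover have "T \<le> real (k + j) * NN" using NN_pos by (simp add: T_def)
    ultimately show "a n = b n" by (intro agree') simp
  qed
  obtain A where A: "\<And>j. act y E (real (k + j) * NN) (real (k + j + 1) * NN) \<le> A"
    using convergent_imp_Bseq[of "\<lambda>j. act y E (real (k + j) * NN) (real (k + j + 1) * NN)"] lim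
    by (auto simp: convergent_def Bseq_def abs_le_iff)
  define B where "B = 2 + A + NN * A"
  \<comment> \<open>Every block of the tail contains a change of sign and has action at most A, so
    the bound does not depend on the block.\<close>
  have yB: "\<bar>y r\<bar> \<le> B" if "T \<le> r" for r
  proof -
    define j where "j = nat \<lfloor>r / NN\<rfloor> - k"
    have "real k \<le> r / NN" using that NN_pos by (simp add: T_def field_simps)
    then have "int k \<le> \<lfloor>r / NN\<rfloor>" by (simp add: le_floor_iff)
    then have j: "real (k + j) = of_int \<lfloor>r / NN\<rfloor>" unfolding j_def by (simp add: of_nat_diff)
    have "of_int \<lfloor>r / NN\<rfloor> \<le> r / NN" "r / NN \<le> of_int \<lfloor>r / NN\<rfloor> + 1"
      using floor_correct[of "r / NN"] by linarith+
    then have "real (k + j) * NN \<le> r" "r \<le> (real (k + j) + 1) * NN"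
      unfolding j pos_le_divide_eq[OF NN_pos] pos_divide_le_eq[OF NN_pos] .
    then have r: "real (k + j) * NN \<le> r" "r \<le> real (k + j + 1) * NN" by (simp_all add: add.commute)
    obtain p where p: "int (k + j) * int N \<le> p" "p + 1 \<le> (int (k + j) + 1) * int N" "b p \<noteq> b (p + 1)"
      using crossing_in_block by blast
    have p': "real (k + j) * NN \<le> of_int p" "of_int p + 1 \<le> real (k + j + 1) * NN"
    proof -
      have "of_int (int (k + j) * int N) \<le> (of_int p :: real)" using p(1) by (simp only: of_int_le_iff)
      then show "real (k + j) * NN \<le> of_int p" by (simp add: NN_def)
      have "of_int (p + 1) \<le> (of_int ((int (k + j) + 1) * int N) :: real)" using p(2) by (simp only: of_int_le_iff)
      then show "of_int p + 1 \<le> real (k + j + 1) * NN" by (simp add: NN_def add_ac)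
    qed
    have "\<bar>y r\<bar> \<le> 2 + A + (real (k + j + 1) * NN - real (k + j) * NN) * A"
      by (rule crossing_bound[OF block p' goodD(1)[OF good] goodD(1)[OF good] p(3) A r])
    then show ?thesis by (simp add: B_def algebra_simps)
  qed
  have "\<exists>T'. T \<le> T' \<and> ((\<forall>r>T'. y r \<le> y (r + NN)) \<or> (\<forall>r>T'. y (r + NN) \<le> y r))"
  proof (cases "y = (\<lambda>r. y (r + NN))")
    case True
    then have "y r = y (r + NN)" for r by (rule fun_cong)
    then show ?thesis by (intro exI[of _ T]) auto
  next
    case False
    have NNP: "NN = of_int (int N)" by (simp add: NN_def)
    have once: "\<not> (y t1 = y (t1 + NN) \<and> y t2 = y (t2 + NN))" if "T \<le> t1" "t1 < t2" for t1 t2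
    proof
      assume meet: "y t1 = y (t1 + NN) \<and> y t2 = y (t2 + NN)"
      have "y = (\<lambda>r. y (r + of_int (int N)))"
      proof (rule locmin_meets_shift_once[OF lm ga _ \<open>t1 < t2\<close>])
        fix n assume "t1 \<le> of_int n"
        then have "T \<le> of_int n" "T \<le> of_int (n + int N)" using that NN_pos by (auto simp: NN_def)
        then show "a (n + int N) = a n" using agree'[of n] agree'[of "n + int N"] periodic by simp
      qed (use meet NNP in simp_all)
      then show False using False NNP by simp
    qed
    obtain T' where T': "T \<le> T'" "\<And>r. T' < r \<Longrightarrow> y (r + NN) - y r \<noteq> 0"
    proof (cases "\<exists>t1\<ge>T. y t1 = y (t1 + NN)")
      case True
      then obtain t1 where t1: "T \<le> t1" "y t1 = y (t1 + NN)" by blast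
      have "y (r + NN) - y r \<noteq> 0" if "t1 < r" for r using once[OF t1(1) that] t1(2) by auto
      then show ?thesis using that[of t1] t1(1) by blast
    next
      case False
      have "y (r + NN) - y r \<noteq> 0" if "T < r" for r using False that by (auto dest: less_imp_le)
      then show ?thesis using that[of T] by blast
    qed
    have "continuous_on {p..q} (\<lambda>r. y (r + NN) - y r)" for p q
      by (intro continuous_intros locmin_continuous[OF lm]
          continuous_on_compose2[OF locmin_continuous_UNIV[OF lm]]) auto
    from constant_sign_if_nonzero[OF this T'(2)]
    have "(\<forall>r>T'. 0 < y (r + NN) - y r) \<or> (\<forall>r>T'. y (r + NN) - y r < 0)" by blast
    then have "(\<forall>r>T'. y r \<le> y (r + NN)) \<or> (\<forall>r>T'. y (r + NN) \<le> y r)" by (auto simp: less_imp_le)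
    then show ?thesis using T'(1) by blast
  qed
  then obtain T' where T': "T \<le> T'" "(\<forall>r>T'. y r \<le> y (r + NN)) \<or> (\<forall>r>T'. y (r + NN) \<le> y r)" by blast
  have "convergent (\<lambda>j. y (r + real j * NN))" for r
  proof -
    obtain j0 where j0: "T' - r < real j0" using reals_Archimedean2 by blast
    have *: "real j0 * 1 \<le> real j0 * NN" using NN_ge by (intro mult_left_mono) auto
    have large: "T' < r + real (j + j0) * NN" for j
    proof -
      have "0 \<le> real j * NN" using NN_pos by simp
      moreover have "real (j + j0) * NN = real j * NN + real j0 * NN" by (simp add: distrib_right)
      ultimately show ?thesis using j0 * by linarith
    qed
    have step: "r + real (Suc j + j0) * NN = r + real (j + j0) * NN + NN" for j by (simp add: algebra_simps)
    have "Bseq (\<lambda>j. y (r + real (j + j0) * NN))"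
    proof (rule BseqI'[of _ B])
      show "norm (y (r + real (j + j0) * NN)) \<le> B" for j
        using yB[of "r + real (j + j0) * NN"] large[of j] T'(1) by simp
    qed
    moreover have "monoseq (\<lambda>j. y (r + real (j + j0) * NN))"
      using T'(2)
    proof
      assume "\<forall>r>T'. y r \<le> y (r + NN)"
      then have "\<forall>j. y (r + real (j + j0) * NN) \<le> y (r + real (Suc j + j0) * NN)"
        unfolding step using large by blast
      then show ?thesis by (rule mono_SucI1)
    next
      assume "\<forall>r>T'. y (r + NN) \<le> y r"
      then have "\<forall>j. y (r + real (Suc j + j0) * NN) \<le> y (r + real (j + j0) * NN)"
        unfolding step using large by blast
      then show ?thesis by (rule mono_SucI2)
    qed
    ultimately have "convergent (\<lambda>j. y (r + real (j + j0) * NN))" by (rule Bseq_monoseq_convergent)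
    then show ?thesis using convergent_ignore_initial_segment[of "\<lambda>j. y (r + real j * NN)" j0] by simp
  qed
  then obtain l where l: "\<And>r. (\<lambda>j. y (r + real j * NN)) \<longlonglongrightarrow> l r" unfolding convergent_def by metis
  have l_per: "l (r + NN) = l r" for r
  proof -
    have "(\<lambda>j. y (r + real (Suc j) * NN)) \<longlonglongrightarrow> l r" by (rule LIMSEQ_Suc[OF l])
    moreover have "y (r + real (Suc j) * NN) = y (r + NN + real j * NN)" for j by (simp add: algebra_simps)
    ultimately show ?thesis using l[of "r + NN"] LIMSEQ_unique by simp
  qed
  define Y G where "Y j r = y (r + of_int (int ((k + j) * N)))" and "G j r = E (r + of_int (int ((k + j) * N)))" for j r
  have sh: "real (k + j) * NN = 0 + of_int (int ((k + j) * N))" "real (k + j + 1) * NN = NN + of_int (int ((k + j) * N))" for j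
    by (simp_all add: NN_def algebra_simps)
  have bb: "(\<lambda>n. b (n + int ((k + j) * N))) = b" for j
    using periodic_int[of _ "int (k + j)"] by (simp add: fun_eq_iff)
  have admY: "admissible b (Y j) (G j) 0 NN" for j
    using admissible_shift[OF block[of j, unfolded sh]] unfolding Y_def[abs_def] G_def[abs_def] bb .
  have "act (Y j) (G j) 0 NN = act y E (real (k + j) * NN) (real (k + j + 1) * NN)" for j
    unfolding sh Y_def[abs_def] G_def[abs_def] by (rule act_shift[OF locmin_energy_bound[OF lm]])
  then have limY: "(\<lambda>j. act (Y j) (G j) 0 NN) \<longlonglongrightarrow> c" using lim by simp
  obtain \<sigma> g F where \<sigma>: "strict_mono \<sigma>" and g: "admissible b g F 0 NN" "act g F 0 NN = c"
    and g_lim: "\<And>r. 0 \<le> r \<Longrightarrow> r \<le> NN \<Longrightarrow> (\<lambda>j. Y (\<sigma> j) r) \<longlonglongrightarrow> g r"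
    by (rule minimising_limit[of Y G, OF admY limY]) blast
  have gl: "g r = l r" if "0 \<le> r" "r \<le> NN" for r
  proof -
    have "strict_mono (\<lambda>j. k + \<sigma> j)" using \<sigma> by (simp add: strict_mono_def)
    from LIMSEQ_subseq_LIMSEQ[OF l this, of r]
    have "(\<lambda>j. Y (\<sigma> j) r) \<longlonglongrightarrow> l r" by (simp add: o_def Y_def NN_def)
    then show ?thesis using g_lim[OF that] LIMSEQ_unique by blast
  qed
  \<comment> \<open>The pointwise limit of the translates is periodic, so the minimiser obtained on
    one period closes up and can be iterated.\<close>
  have g_ends: "g 0 = g NN" using gl[of 0] gl[of NN] l_per[of 0] NN_pos by simp
  obtain \<gamma> \<Gamma> where \<gamma>: "locmin b \<gamma> \<Gamma>" "\<And>r. \<gamma> (r + NN) = \<gamma> r" "\<And>r. 0 \<le> r \<Longrightarrow> r \<le> NN \<Longrightarrow> \<gamma> r = g r"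
    "\<And>j. act \<gamma> \<Gamma> (of_int j * NN) (of_int (j + 1) * NN) = c"
    by (rule periodic_extension[OF g g_ends]) blast
  have \<gamma>l: "\<gamma> r = l r" for r
    by (rule periodic_functions_eq[of \<gamma> l, OF \<gamma>(2) l_per]) (simp add: \<gamma>(3) gl)
  show ?thesis
    by (rule that[OF \<gamma>(1,2), of B]) (use l yB in \<open>simp_all add: T_def \<gamma>l\<close>)
qed

section \<open>Convergence in the L2 norm\<close>

lemma L2_norm_on_integral:
  assumes "continuous_on {s..t} f"
  shows "L2_norm_on {s..t} f = sqrt (integral {s..t} (\<lambda>r. (f r)\<^sup>2))"
proof -
  have "set_integrable lborel {s..t} (\<lambda>r. (f r)\<^sup>2)"
    by (intro borel_integrable_atLeastAtMost' continuous_intros assms)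
  then show ?thesis unfolding L2_norm_on_def by (simp add: set_borel_integral_eq_integral(2))
qed

text \<open>Dominated convergence over one period; a unit interval with integer ends always lies
  within a single period.\<close>

lemma L2_limit:
  assumes cy: "\<And>s t. continuous_on {s..t} y" and cg: "\<And>s t. continuous_on {s..t} \<gamma>"
    and per: "\<And>r. \<gamma> (r + NN) = \<gamma> r" and lim: "\<And>r. (\<lambda>j. y (r + real j * NN)) \<longlonglongrightarrow> \<gamma> r"
    and bound: "\<And>r. real k * NN \<le> r \<Longrightarrow> \<bar>y r\<bar> \<le> B"
  shows "((\<lambda>i::int. L2_norm_on {of_int i..of_int i + 1} (\<lambda>t. y t - \<gamma> t)) \<longlongrightarrow> 0) at_top"
proof -
  define D where "D j = integral {real j * NN..real j * NN + NN} (\<lambda>r. (y r - \<gamma> r)\<^sup>2)" for j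
  have sq: "continuous_on {s..t} (\<lambda>r. (y r - \<gamma> r)\<^sup>2)" for s t by (intro continuous_intros cy cg)
  have D_eq: "((\<lambda>r. (y (r + real j * NN) - \<gamma> r)\<^sup>2) has_integral D j) {0..NN}" for j
  proof -
    have "((\<lambda>r. (y (1 * r + real j * NN) - \<gamma> (1 * r + real j * NN))\<^sup>2) has_integral
        integral {1 * 0 + real j * NN..1 * NN + real j * NN} (\<lambda>r. (y r - \<gamma> r)\<^sup>2) / 1) {0..NN}"
      by (rule has_integral_affine_real[OF integrable_continuous_real[OF sq]]) simp
    then show ?thesis unfolding D_def using periodic_shift[of \<gamma>, OF per] by (simp add: add.commute)
  qed
  have y_le: "\<bar>y (r + real (j + k) * NN)\<bar> \<le> B" if "0 \<le> r" for r j
    using bound[of "r + real (j + k) * NN"] that NN_pos by (simp add: distrib_right)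
  have \<gamma>_le: "\<bar>\<gamma> r\<bar> \<le> B" if "0 \<le> r" for r
  proof (rule LIMSEQ_le_const2)
    show "(\<lambda>j. \<bar>y (r + real (j + k) * NN)\<bar>) \<longlonglongrightarrow> \<bar>\<gamma> r\<bar>"
      by (intro tendsto_rabs LIMSEQ_ignore_initial_segment[OF lim])
  qed (use y_le[OF that] in auto)
  have "(\<lambda>j. integral {0..NN} (\<lambda>r. (y (r + real (j + k) * NN) - \<gamma> r)\<^sup>2)) \<longlonglongrightarrow> integral {0..NN} (\<lambda>r. (\<gamma> r - \<gamma> r)\<^sup>2)"
  proof (rule dominated_convergence(2))
    show "(\<lambda>r. (y (r + real (j + k) * NN) - \<gamma> r)\<^sup>2) integrable_on {0..NN}" for j using D_eq by blast
    show "(\<lambda>r. (2 * B)\<^sup>2) integrable_on {0..NN}" by (rule integrable_const_ivl)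
    show "norm ((y (r + real (j + k) * NN) - \<gamma> r)\<^sup>2) \<le> (2 * B)\<^sup>2" if "r \<in> {0..NN}" for j r
    proof -
      have "\<bar>y (r + real (j + k) * NN) - \<gamma> r\<bar> \<le> 2 * B"
        using y_le[of r j] \<gamma>_le[of r] that by auto
      then have "\<bar>y (r + real (j + k) * NN) - \<gamma> r\<bar>\<^sup>2 \<le> (2 * B)\<^sup>2" by (rule power_mono) simp
      then show ?thesis by simp
    qed
    show "(\<lambda>j. (y (r + real (j + k) * NN) - \<gamma> r)\<^sup>2) \<longlonglongrightarrow> (\<gamma> r - \<gamma> r)\<^sup>2" for r
      by (rule tendsto_power[OF tendsto_diff[OF LIMSEQ_ignore_initial_segment[OF lim] tendsto_const]])
  qed
  then have "(\<lambda>j. D (j + k)) \<longlonglongrightarrow> 0" unfolding integral_unique[OF D_eq] by simp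
  then have Dlim: "D \<longlonglongrightarrow> 0" by (rule LIMSEQ_offset)
  show ?thesis
  proof (rule tendstoI)
    fix e :: real assume "0 < e"
    then have "\<forall>\<^sub>F j in sequentially. D j < e\<^sup>2" using order_tendstoD(2)[OF Dlim, of "e\<^sup>2"] by simp
    then obtain J where J: "\<And>j. J \<le> j \<Longrightarrow> D j < e\<^sup>2" unfolding eventually_sequentially by blast
    have "dist (L2_norm_on {of_int i..of_int i + 1} (\<lambda>t. y t - \<gamma> t)) 0 < e" if i: "int J * int N \<le> i" for i :: int
    proof -
      define j where "j = nat (i div int N)"
      have Npos: "0 < int N" using N by simp
      have "int J \<le> i div int N" using zdiv_mono1[OF i Npos] Npos by simp
      then have j: "int j = i div int N" "J \<le> j" unfolding j_def by auto
      have "i = i div int N * int N + i mod int N" by simp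
      moreover have "0 \<le> i mod int N" "i mod int N < int N" using Npos by simp_all
      ultimately have "int j * int N \<le> i" "i + 1 \<le> int j * int N + int N"
        unfolding j(1) by linarith+
      then have "of_int (int j * int N) \<le> (of_int i :: real)" "of_int (i + 1) \<le> (of_int (int j * int N + int N) :: real)"
        by (simp_all only: of_int_le_iff)
      then have sub: "{of_int i..of_int i + 1} \<subseteq> {real j * NN..real j * NN + NN}" by (auto simp: NN_def)
      have "integral {of_int i..of_int i + 1} (\<lambda>r. (y r - \<gamma> r)\<^sup>2) \<le> D j"
        unfolding D_def by (rule integral_subset_le[OF sub]) (auto intro!: integrable_continuous_real sq)
      also have "\<dots> < e\<^sup>2" by (rule J[OF j(2)])
      finally have "sqrt (integral {of_int i..of_int i + 1} (\<lambda>r. (y r - \<gamma> r)\<^sup>2)) < e"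
        using \<open>0 < e\<close> by (intro real_less_lsqrt) auto
      moreover have "0 \<le> integral {of_int i..of_int i + 1} (\<lambda>r. (y r - \<gamma> r)\<^sup>2)"
        by (intro integral_nonneg integrable_continuous_real sq) auto
      ultimately show ?thesis
        by (simp add: L2_norm_on_integral continuous_intros cy cg dist_real_def)
    qed
    then show "\<forall>\<^sub>F i in at_top. dist (L2_norm_on {of_int i..of_int i + 1} (\<lambda>t. y t - \<gamma> t)) 0 < e"
      unfolding eventually_at_top_linorder by blast
  qed
qed

end

subsection \<open>The renormalised action\<close>

text \<open>The tails start at multiples of the periods. The gap of at least 2 between them leaves a
  unit interval at each end on which a competitor can pass between the periodic curve and 0.\<close>

locale connection = sitnikov x + P: symmetric_sequence x bp Np + M: symmetric_sequence x bm Nm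
  for x :: "real \<Rightarrow> real" and bp Np bm Nm +
  fixes a :: "int \<Rightarrow> int" and kp km :: nat
  assumes good_a: "good a"
    and agree_p: "\<And>n. int kp * int Np \<le> n \<Longrightarrow> a n = bp n"
    and agree_m: "\<And>n. n \<le> - (int km * int Nm) \<Longrightarrow> a n = bm n"
    and gap: "- (int km * int Nm) + 2 \<le> int kp * int Np"
begin

definition R :: "nat \<Rightarrow> real" where "R m = of_int (int (kp + m)) * P.NN"
definition L :: "nat \<Rightarrow> real" where "L m = - of_int (int (km + m)) * M.NN"

definition S :: "(real \<Rightarrow> real) \<Rightarrow> (real \<Rightarrow> real) \<Rightarrow> nat \<Rightarrow> real" where
  "S z F m = act z F (L m) (R m) - real m * (P.c + M.c)"

lemma R_int: "R m = of_int (int (kp + m) * int Np)" and L_int: "L m = of_int (- (int (km + m) * int Nm))"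
  by (simp_all add: R_def L_def P.NN_def M.NN_def algebra_simps)

lemma L0_R0: "L 0 + 2 \<le> R 0"
proof -
  have "of_int (- (int km * int Nm) + 2) \<le> (of_int (int kp * int Np) :: real)"
    using gap by (simp only: of_int_le_iff)
  then show ?thesis by (simp add: R_int L_int)
qed

lemma R_mono: "R m \<le> R (m + n)" and L_antimono: "L (m + n) \<le> L m"
  using P.NN_pos M.NN_pos by (simp_all add: R_def L_def algebra_simps)

lemma L_le_R: "L m \<le> R n"
  using L0_R0 R_mono[of 0 n] L_antimono[of 0 m] by simp

lemma bp_agree: "R 0 \<le> of_int n \<Longrightarrow> a n = bp n" and bm_agree: "of_int n \<le> L 0 \<Longrightarrow> a n = bm n"
  unfolding R_int L_int of_int_le_iff by (simp_all add: agree_p agree_m)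

lemma right_block:
  assumes "admissible a z F (R m) (R (Suc m))"
  shows "P.c \<le> act z F (R m) (R (Suc m))"
proof -
  have "admissible bp z F (R m) (R (Suc m))"
    by (rule admissible_seq_cong[OF assms]) (use bp_agree R_mono[of 0 m] in force)
  then show ?thesis using P.c_le_block[of z F "int (kp + m)"] by (simp add: R_def add_ac)
qed

lemma left_block:
  assumes "admissible a z F (L (Suc m)) (L m)"
  shows "M.c \<le> act z F (L (Suc m)) (L m)"
proof -
  have "admissible bm z F (L (Suc m)) (L m)"
    by (rule admissible_seq_cong[OF assms]) (use bm_agree L_antimono[of 0 m] in force)
  moreover have "L (Suc m) = of_int (- int (km + Suc m)) * M.NN" "L m = of_int (- int (km + Suc m) + 1) * M.NN"
    by (simp_all add: L_def)
  ultimately show ?thesis using M.c_le_block[of z F "- int (km + Suc m)"] by simp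
qed

lemma S_Suc:
  assumes adm: "\<And>s t. admissible a z F s t"
  shows "S z F (Suc m) = S z F m + (act z F (R m) (R (Suc m)) - P.c) + (act z F (L (Suc m)) (L m) - M.c)"
proof -
  have eb: "energy_bound z F s t" for s t using adm by (simp add: admissible_def)
  have "act z F (L (Suc m)) (R (Suc m)) = act z F (L (Suc m)) (L m) + act z F (L m) (R m) + act z F (R m) (R (Suc m))"
    using act_combine[OF eb, of "L (Suc m)" "L m" "R (Suc m)"] act_combine[OF eb, of "L m" "R m" "R (Suc m)"]
      L_antimono[of m 1] R_mono[of m 1] L_le_R[of m m] by simp
  then show ?thesis by (simp add: S_def algebra_simps)
qed

text \<open>Each further period, in either tail, costs at least its free minimum.\<close>

lemma S_mono:
  assumes adm: "\<And>s t. admissible a z F s t"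
  shows "S z F m \<le> S z F (m + n)"
proof (induction n)
  case (Suc n)
  show ?case using S_Suc[OF adm, of "m + n"] right_block[OF adm] left_block[OF adm] Suc
    by (smt (verit) add_Suc_right)
qed simp

text \<open>Follow the periodic minimisers in the tails and vanish at the integers strictly in
  between, where any sign is then allowed. The renormalised action of this curve is the same for all
  windows.\<close>

lemma competitor: "\<exists>z F B. (\<forall>s t. admissible a z F s t) \<and> (\<forall>m. S z F m \<le> B)"
proof -
  obtain g1 G1 where 1: "admissible bp g1 G1 0 P.NN" "act g1 G1 0 P.NN = P.c" "g1 0 = g1 P.NN"
    using P.periodic_minimiser by blast
  obtain gp Gp where gp: "locmin bp gp Gp" "\<And>j. act gp Gp (of_int j * P.NN) (of_int (j + 1) * P.NN) = P.c"
    by (rule P.periodic_extension[OF 1]) blast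
  obtain g2 G2 where 2: "admissible bm g2 G2 0 M.NN" "act g2 G2 0 M.NN = M.c" "g2 0 = g2 M.NN"
    using M.periodic_minimiser by blast
  obtain gm Gm where gm: "locmin bm gm Gm" "\<And>j. act gm Gm (of_int j * M.NN) (of_int (j + 1) * M.NN) = M.c"
    by (rule M.periodic_extension[OF 2]) blast
  define A B where "A = gm (L 0)" and "B = gp (R 0)"
  define K where "K = \<bar>A\<bar> + \<bar>B\<bar>"
  define w where "w r = A * max 0 (1 - (r - L 0)) + B * max 0 (1 - (R 0 - r))" for r
  define W where "W r = K\<^sup>2 * r" for r
  have "energy_bound w W s t" for s t
    unfolding W_def
  proof (rule energy_bound_lipschitz)
    fix p q :: real assume "p < q"
    have "w q - w p = A * (max 0 (1 - (q - L 0)) - max 0 (1 - (p - L 0)))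
        + B * (max 0 (1 - (R 0 - q)) - max 0 (1 - (R 0 - p)))"
      by (simp add: w_def algebra_simps)
    also have "\<bar>\<dots>\<bar> \<le> \<bar>A\<bar> * \<bar>max 0 (1 - (q - L 0)) - max 0 (1 - (p - L 0))\<bar>
        + \<bar>B\<bar> * \<bar>max 0 (1 - (R 0 - q)) - max 0 (1 - (R 0 - p))\<bar>"
      by (rule order_trans[OF abs_triangle_ineq]) (simp add: abs_mult)
    also have "\<dots> \<le> \<bar>A\<bar> * (q - p) + \<bar>B\<bar> * (q - p)"
      using \<open>p < q\<close> by (intro add_mono mult_left_mono) auto
    finally show "\<bar>w q - w p\<bar> \<le> K * (q - p)" by (simp add: K_def distrib_right)
  qed
  moreover have wA: "w (L 0) = A" and wB: "w (R 0) = B" using L0_R0 by (simp_all add: w_def)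
  moreover have "signed a w (L 0) (R 0)"
    unfolding signed_def
  proof (intro allI impI)
    fix n :: int assume n: "L 0 \<le> of_int n" "of_int n \<le> R 0"
    consider "of_int n = L 0" | "of_int n = R 0" | "L 0 < of_int n" "of_int n < R 0" using n by linarith
    then show "0 \<le> of_int (a n) * w (of_int n)"
    proof cases
      case 1
      then show ?thesis using locmin_sign[OF gm(1), of n] bm_agree[of n] wA by (simp add: A_def)
    next
      case 2
      then show ?thesis using locmin_sign[OF gp(1), of n] bp_agree[of n] wB by (simp add: B_def)
    next
      case 3
      then have "- (int (km + 0) * int Nm) < n" "n < int (kp + 0) * int Np"
        unfolding R_int L_int of_int_less_iff .
      then have "- (int (km + 0) * int Nm) + 1 \<le> n" "n + 1 \<le> int (kp + 0) * int Np" by linarith+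
      then have "of_int (- (int (km + 0) * int Nm) + 1) \<le> (of_int n :: real)"
        "of_int (n + 1) \<le> (of_int (int (kp + 0) * int Np) :: real)"
        unfolding of_int_le_iff .
      then have "L 0 + 1 \<le> of_int n" "of_int n + 1 \<le> R 0"
        unfolding of_int_add of_int_1 R_int[symmetric] L_int[symmetric] .
      then show ?thesis by (simp add: w_def)
    qed
  qed
  ultimately have w: "admissible a w W (L 0) (R 0)" by (simp add: admissible_def)
  have admp: "admissible a gp Gp (R 0) t" for t
    by (rule admissible_seq_cong[OF locmin_admissible[OF gp(1)]]) (simp add: bp_agree)
  have admm: "admissible a gm Gm s (L 0)" for s
    by (rule admissible_seq_cong[OF locmin_admissible[OF gm(1)]]) (simp add: bm_agree)
  define z1 F1 where "z1 = join (R 0) w gp" and "F1 = join_energy (R 0) W Gp"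
  define z F where "z = join (L 0) gm z1" and "F = join_energy (L 0) Gm F1"
  have adm1: "admissible a z1 F1 (L 0) t" for t
    unfolding z1_def F1_def by (rule admissible_join[OF w admp]) (simp add: wB B_def)
  have eqm: "gm (L 0) = z1 (L 0)" using L0_R0 by (simp add: z1_def join_left wA A_def)
  have adm: "admissible a z F s t" for s t
    unfolding z_def F_def by (rule admissible_join[OF admm adm1 eqm])
  have actp: "act gp Gp (R 0) (R m) = real m * P.c" for m
  proof (induction m)
    case (Suc m)
    have "act gp Gp (R m) (R (Suc m)) = P.c" using gp(2)[of "int (kp + m)"] by (simp add: R_def add_ac)
    then show ?case
      using act_combine[OF locmin_energy_bound[OF gp(1)], of "R 0" "R m" "R (Suc m)"] Suc R_mono[of 0 m] R_mono[of m 1]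
      by (simp add: algebra_simps)
  qed simp
  have actm: "act gm Gm (L m) (L 0) = real m * M.c" for m
  proof (induction m)
    case (Suc m)
    have "L (Suc m) = of_int (- int (km + Suc m)) * M.NN" "L m = of_int (- int (km + Suc m) + 1) * M.NN"
      by (simp_all add: L_def)
    then have "act gm Gm (L (Suc m)) (L m) = M.c" using gm(2)[of "- int (km + Suc m)"] by simp
    then show ?case
      using act_combine[OF locmin_energy_bound[OF gm(1)], of "L (Suc m)" "L m" "L 0"] Suc L_antimono[of 0 m] L_antimono[of m 1]
      by (simp add: algebra_simps)
  qed simp
  have "S z F m = act w W (L 0) (R 0)" for m
  proof -
    have "act z F (L m) (R m) = act gm Gm (L m) (L 0) + act z1 F1 (L 0) (R m)"
      unfolding z_def F_def
      by (rule act_join) (use admm adm1 eqm L_antimono[of 0 m] L_le_R in \<open>auto simp: admissible_def\<close>)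
    also have "act z1 F1 (L 0) (R m) = act w W (L 0) (R 0) + act gp Gp (R 0) (R m)"
      unfolding z1_def F1_def
      by (rule act_join) (use w admp wB R_mono[of 0 m] L_le_R in \<open>auto simp: admissible_def B_def\<close>)
    finally show ?thesis by (simp add: S_def actp actm algebra_simps)
  qed
  then show ?thesis using adm by (intro exI[of _ z] exI[of _ F] exI[of _ "act w W (L 0) (R 0)"]) auto
qed

lemma window: "\<exists>m. L m \<le> s \<and> t \<le> R m"
proof -
  obtain m where m: "max \<bar>s - L 0\<bar> \<bar>t - R 0\<bar> \<le> real m" using real_arch_simple by blast
  have "real m * 1 \<le> real m * P.NN" "real m * 1 \<le> real m * M.NN"
    by (rule mult_left_mono[OF P.NN_ge], simp, rule mult_left_mono[OF M.NN_ge], simp)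
  moreover have "R m = R 0 + real m * P.NN" "L m = L 0 - real m * M.NN"
    by (simp_all add: R_def L_def algebra_simps)
  ultimately show ?thesis using m by (intro exI[of _ m]) auto
qed

lemma minimiser:
  obtains y E where "locmin a y E"
    "(\<lambda>m. act y E (R m) (R (Suc m))) \<longlonglongrightarrow> P.c" "(\<lambda>m. act y E (L (Suc m)) (L m)) \<longlonglongrightarrow> M.c"
proof -
  \<comment> \<open>Upper bounds are collected instead of suprema, because the renormalised action
    of a curve may be unbounded.\<close>
  define V where "V = {B. \<exists>z F. (\<forall>s t. admissible a z F s t) \<and> (\<forall>m. S z F m \<le> B)}"
  define J where "J = Inf V"
  have "V \<noteq> {}" using competitor by (auto simp: V_def)
  have "bdd_below V"
  proof (rule bdd_belowI[of _ 0])
    fix B assume "B \<in> V"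
    then obtain z F where "\<forall>s t. admissible a z F s t" "\<forall>m. S z F m \<le> B" by (auto simp: V_def)
    then have "admissible a z F (L 0) (R 0)" "S z F 0 \<le> B" by blast+
    then show "0 \<le> B" using act_nonneg[of z F "L 0" "R 0"] L_le_R by (auto simp: S_def admissible_def)
  qed
  have J_le: "J \<le> B" if "\<And>s t. admissible a z F s t" "\<And>m. S z F m \<le> B" for z F B
    unfolding J_def by (rule cInf_lower[OF _ \<open>bdd_below V\<close>]) (use that in \<open>auto simp: V_def\<close>)
  have "\<exists>z F. (\<forall>s t. admissible a z F s t) \<and> (\<forall>m. S z F m \<le> J + 1 / real (Suc k))" for k
  proof -
    have "Inf V < J + 1 / real (Suc k)" by (simp add: J_def)
    from cInf_lessD[OF \<open>V \<noteq> {}\<close> this] obtain B where B: "B \<in> V" "B < J + 1 / real (Suc k)" by blast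
    then obtain z F where "\<forall>s t. admissible a z F s t" "\<forall>m. S z F m \<le> B" by (auto simp: V_def)
    then show ?thesis using B(2) by (meson less_imp_le order_trans)
  qed
  then obtain Z G where Z: "\<And>k s t. admissible a (Z k) (G k) s t" "\<And>k m. S (Z k) (G k) m \<le> J + 1 / real (Suc k)"
    by metis
  \<comment> \<open>Only increments of the energies are controlled; normalised at time 0 they become
    pointwise bounded.\<close>
  define E where "E k r = G k r - G k 0" for k r
  have eb: "energy_bound (Z k) (E k) s t" for k s t
    by (rule energy_bound_cong[where c = "- G k 0"]) (use Z(1)[of k s t] in \<open>auto simp: admissible_def E_def\<close>)
  have adm: "admissible a (Z k) (E k) s t" for k s t
    using Z(1)[of k s t] eb by (simp add: admissible_def)
  have act_eq: "act (Z k) (E k) s t = act (Z k) (G k) s t" for k s t by (simp add: act_def E_def)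
  have act_le: "act (Z k) (E k) (L m) (R m) \<le> J + 1 + real m * (P.c + M.c)" for k m
  proof -
    have "1 / real (Suc k) \<le> 1" by simp
    then show ?thesis using Z(2)[of k m] unfolding S_def act_eq by linarith
  qed
  obtain n0 where n0: "int kp * int Np \<le> n0" "bp n0 \<noteq> bp (n0 + 1)" using P.crossing_in_block[of "int kp"] by blast
  then have cross: "a n0 \<noteq> a (n0 + 1)" by (simp add: agree_p)
  have "\<exists>B. \<forall>k. \<bar>Z k r\<bar> \<le> B \<and> \<bar>E k r\<bar> \<le> B" for r
  proof -
    obtain m where m: "L m \<le> min (min r 0) (of_int n0)" "max (max r 0) (of_int n0 + 1) \<le> R m" using window by blast
    define A where "A = J + 1 + real m * (P.c + M.c)"
    have "\<bar>Z k r\<bar> \<le> 2 + A + (R m - L m) * A" for k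
      by (rule crossing_bound[OF adm _ _ goodD(1)[OF good_a] goodD(1)[OF good_a] cross]) (use m act_le A_def in auto)
    moreover have "\<bar>E k r\<bar> \<le> A" for k
    proof -
      have "E k (R m) - E k (L m) \<le> A" using energy_le_act[OF eb] act_le[of k m] unfolding A_def by (meson order_trans)
      moreover have "E k (L m) \<le> E k r" "E k r \<le> E k (R m)" "E k (L m) \<le> E k 0" "E k 0 \<le> E k (R m)"
        using energy_bound_mono[OF eb, of "L m" _ _ "R m" k] m by auto
      moreover have "E k 0 = 0" by (simp add: E_def)
      ultimately show ?thesis by linarith
    qed
    ultimately show ?thesis by (intro exI[of _ "max (2 + A + (R m - L m) * A) A"]) (auto simp: le_max_iff_disj)
  qed
  then obtain \<sigma> y F where \<sigma>: "strict_mono \<sigma>" and ebF: "\<And>s t. energy_bound y F s t"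
    and y: "\<And>r. (\<lambda>k. Z (\<sigma> k) r) \<longlonglongrightarrow> y r" and F: "\<And>n::int. (\<lambda>k. E (\<sigma> k) (of_int n)) \<longlonglongrightarrow> F (of_int n)"
    using energy_bound_compact[of Z E, OF eb] by metis
  have admy: "admissible a y F s t" for s t
  proof -
    have "signed a (Z (\<sigma> k)) s t" for k using adm by (simp add: admissible_def)
    then have "signed a y s t" by (rule signed_limit[OF _ y])
    then show ?thesis using ebF by (simp add: admissible_def)
  qed
  have SJ: "S y F m \<le> J" for m
  proof (rule LIMSEQ_le)
    show "(\<lambda>k. S (Z (\<sigma> k)) (E (\<sigma> k)) m) \<longlonglongrightarrow> S y F m"
      unfolding S_def R_int L_int by (intro tendsto_diff tendsto_const act_tendsto eb y F)
    show "(\<lambda>k. J + 1 / real (Suc (\<sigma> k))) \<longlonglongrightarrow> J"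
      using LIMSEQ_subseq_LIMSEQ[OF tendsto_add[OF tendsto_const[of J] LIMSEQ_inverse_real_of_nat] \<sigma>]
      by (simp add: o_def inverse_eq_divide)
    show "\<exists>N. \<forall>k\<ge>N. S (Z (\<sigma> k)) (E (\<sigma> k)) m \<le> J + 1 / real (Suc (\<sigma> k))"
      using Z(2) by (auto simp: S_def act_eq)
  qed
  have eby: "energy_bound y F s t" for s t by (rule ebF)
  have lm: "locmin a y F"
  proof (rule locminI_large[OF admy])
    fix s t z H assume h: "s \<le> t" "admissible a z H s t" "z s = y s" "z t = y t"
    define w W where "w = patch s t y z" and "W = patch_energy s t F H"
    have admw: "admissible a w W p q" for p q
      unfolding w_def W_def by (rule admissible_patch[OF h(3,4,1) admy h(2) admy])
    obtain m0 where m0: "L m0 \<le> s" "t \<le> R m0" using window by blast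
    have "act y F (L m0) (R m0) \<le> act w W (L m0) (R m0)"
    proof (rule ccontr)
      \<comment> \<open>A gain inside one window persists in all larger ones, and by monotonicity it
        bounds the smaller ones too, in contradiction to the infimum.\<close>
      define \<delta> where "\<delta> = act y F (L m0) (R m0) - act w W (L m0) (R m0)"
      assume "\<not> ?thesis"
      then have "0 < \<delta>" by (simp add: \<delta>_def)
      have large: "S w W (m0 + n) = S y F (m0 + n) - \<delta>" for n
      proof -
        have eq: "act w W p q = act y F p q" if "q \<le> s \<or> t \<le> p" "p \<le> q" for p q
        proof (rule act_cong)
          show "w r = y r" if "p \<le> r" "r \<le> q" for r
            unfolding w_def by (rule patch_outside[OF h(3,4,1)]) (use that \<open>q \<le> s \<or> t \<le> p\<close> in auto)
          show "W q - W p = F q - F p"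
            using that h(1) by (cases "p = q") (auto simp: W_def patch_energy_def join_energy_def)
        qed
        have ebw: "energy_bound w W p q" for p q using admw by (simp add: admissible_def)
        have split: "act u U (L (m0 + n)) (R (m0 + n)) = act u U (L (m0 + n)) (L m0) + act u U (L m0) (R m0) + act u U (R m0) (R (m0 + n))"
          if "\<And>p q. energy_bound u U p q" for u U
          using act_combine[OF that, of "L (m0 + n)" "L m0" "R (m0 + n)"] act_combine[OF that, of "L m0" "R m0" "R (m0 + n)"]
            L_antimono[of m0 n] R_mono[of m0 n] L_le_R[of m0 m0] by simp
        show ?thesis
          unfolding S_def split[OF ebw] split[OF eby] \<delta>_def
          using eq[of "L m0" "L (m0 + n)"] eq[of "R (m0 + n)" "R m0"] m0 L_antimono[of m0 n] R_mono[of m0 n] by simp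
      qed
      have "S w W m \<le> J - \<delta>" for m
      proof -
        have "S w W m \<le> S w W (m0 + m)" using S_mono[of w W m m0, OF admw] by (simp add: add.commute)
        also have "\<dots> = S y F (m0 + m) - \<delta>" by (rule large)
        also have "\<dots> \<le> J - \<delta>" using SJ by simp
        finally show ?thesis .
      qed
      from J_le[OF admw this] show False using \<open>0 < \<delta>\<close> by simp
    qed
    then show "\<exists>s' t'. s' \<le> s \<and> t \<le> t' \<and> act y F s' t' \<le> act (patch s t y z) (patch_energy s t F H) s' t'"
      using m0 unfolding w_def W_def by blast
  qed
  have "incseq (S y F)"
    by (rule incseq_SucI) (use S_mono[of y F _ 1, OF admy] in simp)
  moreover have "bdd_above (range (S y F))" by (rule bdd_aboveI2[of _ _ J]) (rule SJ)
  ultimately obtain l where l: "S y F \<longlonglongrightarrow> l" using LIMSEQ_incseq_SUP by blast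
  \<comment> \<open>A bounded monotone sequence has increments tending to 0. They are sums of two
    nonnegative excesses, one in each tail, so both excesses tend to 0.\<close>
  have inc: "(\<lambda>m. S y F (Suc m) - S y F m) \<longlonglongrightarrow> 0"
    using tendsto_diff[OF LIMSEQ_Suc[OF l] l] by simp
  have r0: "0 \<le> act y F (R m) (R (Suc m)) - P.c" and l0: "0 \<le> act y F (L (Suc m)) (L m) - M.c" for m
    using right_block[OF admy] left_block[OF admy] by simp_all
  have "(\<lambda>m. act y F (R m) (R (Suc m)) - P.c) \<longlonglongrightarrow> 0"
    by (rule tendsto_sandwich[OF _ _ tendsto_const inc]) (use r0 l0 S_Suc[OF admy] in simp_all)
  moreover have "(\<lambda>m. act y F (L (Suc m)) (L m) - M.c) \<longlonglongrightarrow> 0"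
    by (rule tendsto_sandwich[OF _ _ tendsto_const inc]) (use r0 l0 S_Suc[OF admy] in simp_all)
  ultimately have "(\<lambda>m. act y F (R m) (R (Suc m))) \<longlonglongrightarrow> P.c" "(\<lambda>m. act y F (L (Suc m)) (L m)) \<longlonglongrightarrow> M.c"
    by (simp_all add: LIM_zero_iff)
  then show ?thesis using that lm by blast
qed

lemma connecting_minimiser:
  obtains y E \<gamma>p Gp \<gamma>m Gm where "locmin a y E" "locmin bp \<gamma>p Gp" "locmin bm \<gamma>m Gm"
    "\<And>r. \<gamma>p (r + P.NN) = \<gamma>p r" "\<And>r. \<gamma>m (r + M.NN) = \<gamma>m r" "connecting_orbit y \<gamma>m \<gamma>p"
proof -
  obtain y E where lm: "locmin a y E" and lr: "(\<lambda>m. act y E (R m) (R (Suc m))) \<longlonglongrightarrow> P.c"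
    and ll: "(\<lambda>m. act y E (L (Suc m)) (L m)) \<longlonglongrightarrow> M.c" using minimiser by blast
  have lp: "(\<lambda>j. act y E (real (kp + j) * P.NN) (real (kp + j + 1) * P.NN)) \<longlonglongrightarrow> P.c"
    using lr by (simp add: R_def add_ac)
  obtain \<gamma>p Gp Bp where gp: "locmin bp \<gamma>p Gp" "\<And>r. \<gamma>p (r + P.NN) = \<gamma>p r"
    "\<And>r. (\<lambda>j. y (r + real j * P.NN)) \<longlonglongrightarrow> \<gamma>p r" "\<And>r. real kp * P.NN \<le> r \<Longrightarrow> \<bar>y r\<bar> \<le> Bp"
    by (rule P.converges_to_periodic[where k = kp, OF lm good_a]) (use agree_p lp in blast)+
  have right: "((\<lambda>i::int. L2_norm_on {of_int i..of_int i + 1} (\<lambda>t. y t - \<gamma>p t)) \<longlongrightarrow> 0) at_top"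
    by (rule P.L2_limit[where k = kp and B = Bp, OF locmin_continuous[OF lm] locmin_continuous[OF gp(1)] gp(2,3)])
      (rule gp(4))
  \<comment> \<open>In reversed time the left tail becomes a right tail, and it still follows
    \<open>bm\<close> because this sequence is even.\<close>
  define y' E' where "y' r = y (- r)" and "E' r = - E (- r)" for r
  have lm': "locmin (\<lambda>k. a (- k)) y' E'"
    unfolding y'_def[abs_def] E'_def[abs_def] by (rule locmin_reflect[OF lm])
  have good': "good (\<lambda>k. a (- k))"
    using good_a unfolding good_def
    by (metis (no_types, opaque_lifting) add.commute diff_minus_eq_add minus_add_distrib uminus_add_conv_diff)
  have agree': "a (- n) = bm n" if "int km * int Nm \<le> n" for n
    using agree_m[of "- n"] that M.even by simp
  have "act y' E' (real (km + j) * M.NN) (real (km + j + 1) * M.NN) = act y E (L (Suc j)) (L j)" for j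
  proof -
    have "- L j = real (km + j) * M.NN" "- L (Suc j) = real (km + j + 1) * M.NN" by (simp_all add: L_def algebra_simps)
    then show ?thesis using act_reflect[of y E "L j" "L (Suc j)"] by (simp only: y'_def[abs_def] E'_def[abs_def])
  qed
  then have lm_lim: "(\<lambda>j. act y' E' (real (km + j) * M.NN) (real (km + j + 1) * M.NN)) \<longlonglongrightarrow> M.c"
    using ll by simp
  obtain \<gamma> G B where g: "locmin bm \<gamma> G" "\<And>r. \<gamma> (r + M.NN) = \<gamma> r"
    "\<And>r. (\<lambda>j. y' (r + real j * M.NN)) \<longlonglongrightarrow> \<gamma> r" "\<And>r. real km * M.NN \<le> r \<Longrightarrow> \<bar>y' r\<bar> \<le> B"
    by (rule M.converges_to_periodic[where k = km, OF lm' good']) (use agree' lm_lim in blast)+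
  define \<gamma>m where "\<gamma>m r = \<gamma> (- r)" for r
  have "(\<lambda>k. bm (- k)) = bm" using M.even by auto
  then have gm: "locmin bm \<gamma>m (\<lambda>r. - G (- r))"
    using locmin_reflect[OF g(1)] by (simp add: \<gamma>m_def[abs_def])
  have gm_per: "\<gamma>m (r + M.NN) = \<gamma>m r" for r
    using g(2)[of "- r - M.NN"] by (simp add: \<gamma>m_def)
  have left': "((\<lambda>i::int. L2_norm_on {of_int i..of_int i + 1} (\<lambda>t. y' t - \<gamma> t)) \<longlongrightarrow> 0) at_top"
    by (rule M.L2_limit[where k = km and B = B, OF locmin_continuous[OF lm'] locmin_continuous[OF g(1)] g(2,3)])
      (rule g(4))
  have cont: "continuous_on {s..t} (\<lambda>t. y t - \<gamma>m t)" "continuous_on {s..t} (\<lambda>t. y' t - \<gamma> t)" for s t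
    by (intro continuous_intros locmin_continuous[OF lm] locmin_continuous[OF gm] locmin_continuous[OF lm'] locmin_continuous[OF g(1)])+
  have refl: "L2_norm_on {of_int i..of_int i + 1} (\<lambda>t. y t - \<gamma>m t)
      = L2_norm_on {of_int (- i - 1)..of_int (- i - 1) + 1} (\<lambda>t. y' t - \<gamma> t)" for i :: int
    using Henstock_Kurzweil_Integration.integral_reflect_real[of "of_int i + 1" "of_int i" "\<lambda>r. (y r - \<gamma>m r)\<^sup>2"]
    unfolding P.L2_norm_on_integral[OF cont(1)] P.L2_norm_on_integral[OF cont(2)]
    by (simp add: y'_def \<gamma>m_def)
  \<comment> \<open>Reflection takes the unit interval starting at i to the one starting at -i -
    1.\<close>
  have "filterlim (\<lambda>i::int. - i - 1) at_top at_bot"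
    unfolding filterlim_at_top eventually_at_bot_linorder
  proof
    fix Z :: int
    show "\<exists>N. \<forall>i\<le>N. Z \<le> - i - 1" by (intro exI[of _ "- Z - 1"]) auto
  qed
  then have left: "((\<lambda>i::int. L2_norm_on {of_int i..of_int i + 1} (\<lambda>t. y t - \<gamma>m t)) \<longlongrightarrow> 0) at_bot"
    unfolding refl by (rule filterlim_compose[OF left'])
  show ?thesis
    by (rule that[OF lm gp(1) gm gp(2) gm_per]) (simp add: connecting_orbit_def left right)
qed

end

subsection \<open>Local minimisers are orbits\<close>

lemma L2_loc_continuous:
  assumes "continuous_on UNIV f"
  shows "f \<in> L2_loc"
proof -
  have "set_integrable lborel {a..b} (\<lambda>t. (f t)\<^sup>2)" for a b :: real
    by (intro borel_integrable_atLeastAtMost' continuous_intros continuous_on_subset[OF assms]) auto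
  then show ?thesis using borel_measurable_continuous_onI[OF assms] by (simp add: L2_loc_def)
qed

text \<open>Integration by parts on a compact interval outside of which the test function vanishes
  together with its derivative.\<close>

lemma weak_derivative_C1:
  assumes dy: "\<And>t. (y has_real_derivative g t) (at t)" and cg: "continuous_on UNIV g"
  shows "weak_derivative y g"
  unfolding weak_derivative_def
proof (intro allI impI)
  fix \<phi> assume test: "test_function \<phi>"
  have "(deriv ^^ 0) \<phi> differentiable (at t)" "(deriv ^^ 1) \<phi> differentiable (at t)" for t
    using test unfolding test_function_def by blast+
  then have diff: "\<phi> differentiable (at t)" "deriv \<phi> differentiable (at t)" for t by simp_all
  obtain r where r: "\<And>t. \<bar>t\<bar> > r \<Longrightarrow> \<phi> t = 0" using test unfolding test_function_def by blast
  define K where "K = \<bar>r\<bar> + 1"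
  have K: "0 \<le> K" "r < K" by (auto simp: K_def)
  have d\<phi>: "(\<phi> has_real_derivative deriv \<phi> t) (at t)" for t
    using diff(1)[of t] by (simp add: DERIV_deriv_iff_real_differentiable)
  have cont: "isCont y t" "isCont g t" "isCont \<phi> t" "isCont (deriv \<phi>) t" for t
    using DERIV_isCont[OF dy] cg DERIV_isCont[OF d\<phi>] differentiable_imp_continuous_within[OF diff(2)]
    by (auto simp: continuous_on_eq_continuous_at)
  have d0: "deriv \<phi> t = 0" if "K < \<bar>t\<bar>" for t
  proof -
    have "open {t. r < \<bar>t\<bar>}" by (intro open_Collect_less continuous_intros)
    then have "\<forall>\<^sub>F s in nhds t. 0 = \<phi> s"
      unfolding eventually_nhds using that K r by (intro exI[of _ "{t. r < \<bar>t\<bar>}"]) auto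
    from DERIV_cong_ev[OF refl this refl, THEN iffD1, OF DERIV_const]
    have "(\<phi> has_real_derivative 0) (at t)" .
    then show ?thesis by (rule DERIV_imp_deriv)
  qed
  define I where "I = indicat_real {- K..K}"
  have ind: "(\<lambda>t. y t * deriv \<phi> t) = (\<lambda>t. y t * deriv \<phi> t * I t)" "(\<lambda>t. g t * \<phi> t) = (\<lambda>t. g t * \<phi> t * I t)"
    using d0 r K by (auto simp: fun_eq_iff I_def indicator_def abs_le_iff) (smt (verit))+
  have i1: "integrable lborel (\<lambda>t. y t * deriv \<phi> t * I t)" and i2: "integrable lborel (\<lambda>t. g t * \<phi> t * I t)"
    unfolding I_def by (intro borel_integrable_atLeastAtMost continuous_intros cont)+
  have "(LINT t|lborel. (g t * \<phi> t + y t * deriv \<phi> t) * I t) = y K * \<phi> K - y (- K) * \<phi> (- K)"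
    unfolding I_def
  proof (rule integral_FTC_Icc_real)
    show "- K \<le> K" using K by simp
    show "((\<lambda>t. y t * \<phi> t) has_real_derivative g t * \<phi> t + y t * deriv \<phi> t) (at t)" for t
      by (auto intro!: derivative_eq_intros dy d\<phi>)
    show "isCont (\<lambda>t. g t * \<phi> t + y t * deriv \<phi> t) t" for t by (intro continuous_intros cont)
  qed
  moreover have "\<phi> K = 0" "\<phi> (- K) = 0" using r[of K] r[of "- K"] K by auto
  ultimately have "(LINT t|lborel. g t * \<phi> t * I t + y t * deriv \<phi> t * I t) = 0" by (simp add: distrib_right)
  then have "(LINT t|lborel. g t * \<phi> t * I t) + (LINT t|lborel. y t * deriv \<phi> t * I t) = 0"
    using Bochner_Integration.integral_add[OF i2 i1] by simp
  then show "(LINT t|lborel. y t * deriv \<phi> t) = - (LINT t|lborel. g t * \<phi> t)"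
    unfolding ind by linarith
qed

lemma powr_three_halves:
  fixes A :: real
  assumes "0 < A"
  shows "A powr (3 / 2) = sqrt A ^ 3"
proof -
  have "sqrt A ^ 3 = (A powr (1 / 2)) powr real 3"
    using assms by (subst powr_realpow) (auto simp: powr_half_sqrt)
  then show ?thesis by (simp add: powr_powr)
qed

context sitnikov
begin

lemma locmin_orbit:
  assumes lm: "locmin a y E" and good: "good a"
  shows "y \<in> orbits x a"
proof -
  note ns = locmin_nonsingular[OF lm good]
  note eq = locmin_equation[OF lm ns]
  have cont: "continuous_on UNIV y" by (rule locmin_continuous_UNIV[OF lm])
  have contd: "continuous_on UNIV (deriv y)"
    using DERIV_isCont[OF eq(2)] by (simp add: continuous_on_eq_continuous_at)
  have "y \<in> H1_loc"
    using cont contd L2_loc_continuous weak_derivative_C1[OF eq(1) contd] by (auto simp: H1_loc_def)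
  moreover have "- force y t = - y t / ((x t)\<^sup>2 + (y t)\<^sup>2) powr (3 / 2)" for t
  proof -
    have "0 < (x t)\<^sup>2 + (y t)\<^sup>2" using ns[of t] by (metis sum_power2_gt_zero_iff sum_power2_eq_zero_iff)
    then show ?thesis by (simp add: force_def powr_three_halves)
  qed
  then have "sitnikov_solution x y"
    unfolding sitnikov_solution_def using ns eq by (intro conjI exI[of _ "deriv y"]) auto
  ultimately show ?thesis
    using locmin_no_collision[OF lm good] by (simp add: orbits_def Omega_def)
qed

lemma good_if_seqs_M:
  assumes "a \<in> seqs_M"
  shows "good a"
proof -
  obtain k :: "int \<Rightarrow> nat" and p :: "int \<Rightarrow> int" and c where c: "c \<in> {-1, 1}"
    and k: "\<And>j. 3 \<le> k j" and p: "\<And>j. p (j + 1) = p j + int (k j)"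
    and block: "\<And>j n. n \<in> {p j..<p (j + 1)} \<Longrightarrow> a n = (if even j then c else - c)"
    using assms unfolding seqs_M_def by blast
  have step: "p j + 3 \<le> p (j + 1)" for j using p[of j] k[of j] by linarith
  have grow: "p j + 3 * int m \<le> p (j + int m)" for j m
  proof (induction m)
    case (Suc m)
    show ?case using step[of "j + int m"] Suc by (simp add: add_ac)
  qed simp
  show ?thesis
    unfolding good_def
  proof
    fix n
    \<comment> \<open>Far enough to the left for block \<open>j0\<close> to start at or before n,
      since block starts advance by at least 3 with every index.\<close>
    define u j0 where "u = nat \<bar>n\<bar> + nat \<bar>p 0\<bar>" and "j0 = - int u"
    have "p 0 - n \<le> int u" by (simp add: u_def)
    then have low: "p j0 \<le> n" using grow[of j0 u] by (simp add: j0_def)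
    define K where "K = nat \<bar>n\<bar> + nat \<bar>p j0\<bar> + 1"
    have "n - p j0 < int K" by (simp add: K_def)
    then have "n < p (j0 + int K)" using grow[of j0 K] by simp
    then have ex: "\<exists>m. n < p (j0 + int m)" by blast
    define m where "m = (LEAST m. n < p (j0 + int m))"
    have m: "n < p (j0 + int m)" unfolding m_def by (rule LeastI_ex[OF ex])
    have m0: "m \<noteq> 0" using m low by (intro notI) simp
    then have "\<not> n < p (j0 + int (m - 1))" unfolding m_def by (intro not_less_Least) (simp add: m_def)
    moreover define j where "j = j0 + int (m - 1)"
    ultimately have j: "p j \<le> n" "n < p (j + 1)" using m m0 by (simp_all add: of_nat_diff)
    have n: "a n = (if even j then c else - c)" using block[of n j] j by simp
    \<comment> \<open>Unless n is the last position of its block, the next entry belongs to the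
      block; otherwise the previous one does, because of the block length.\<close>
    have "a n = a (n + 1) \<or> a n = a (n - 1)"
    proof (cases "n + 1 < p (j + 1)")
      case True
      then show ?thesis using block[of "n + 1" j] n j by simp
    next
      case False
      then show ?thesis using block[of "n - 1" j] n j step[of j] by simp
    qed
    then show "a n \<in> {1, - 1} \<and> (a n = a (n + 1) \<or> a n = a (n - 1))" using n c by auto
  qed
qed

lemma symmetric_sequence_if_seqs_S:
  assumes "b \<in> seqs_S N" "1 \<le> N"
  shows "symmetric_sequence x b N"
proof -
  have b: "b \<in> seqs_M" "b \<noteq> (\<lambda>_. 1)" "b \<noteq> (\<lambda>_. - 1)" "\<And>n. b n = b (n + int N)" "\<And>n. b n = b (- n)"
    using assms(1) unfolding seqs_S_def seqs_P_def by auto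
  note good = good_if_seqs_M[OF b(1)]
  have "\<exists>n. b n \<noteq> b (n + 1)"
  proof (rule ccontr)
    assume "\<not> ?thesis"
    then have step: "b (n + 1) = b n" for n by metis
    have "b n = b 0" for n
    proof (induction n rule: int_induct[where k = 0])
      case (step2 i)
      then show ?case using step[of "i - 1"] by simp
    qed (simp_all add: step)
    then have "b = (\<lambda>_. b 0)" by auto
    then show False using goodD(1)[OF good, of 0] b(2,3) by auto
  qed
  then show ?thesis using b(4,5) good assms(2) sitnikov_axioms
    by (intro symmetric_sequence.intro symmetric_sequence_axioms.intro) simp_all
qed

end

lemma of_nat_mult_ge: "1 \<le> n \<Longrightarrow> k \<le> int (nat \<bar>k\<bar>) * int n"
proof -
  assume "1 \<le> n"
  then have "\<bar>k\<bar> * 1 \<le> \<bar>k\<bar> * int n" by (intro mult_left_mono) auto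
  then show ?thesis by simp
qed

theorem theorem2:
  fixes x :: "real \<Rightarrow> real"
    and a bp bm :: "int \<Rightarrow> int"
    and Np Nm :: nat
    and Kp Km :: int
  assumes "primaries x"
    and "a \<in> seqs_M"
    and "Np \<ge> 1" and "Nm \<ge> 1"
    and "bp \<in> seqs_S Np" and "bm \<in> seqs_S Nm"
    and "Km < Kp"
    and "\<And>n. n \<ge> Kp + 1 \<Longrightarrow> a n = bp n"
    and "\<And>n. n \<le> Km - 1 \<Longrightarrow> a n = bm n"
  shows "\<exists>\<gamma>p \<in> periodic_orbits x Np bp. \<exists>\<gamma>m \<in> periodic_orbits x Nm bm. \<exists>y \<in> orbits x a.
      connecting_orbit y \<gamma>m \<gamma>p \<and>
      (\<forall>n. a n * a (n + 1) = 1 \<longrightarrow>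
         \<not> (\<exists>t\<in>{real_of_int n<..<real_of_int (n + 1)}. y t = 0)) \<and>
      (\<forall>n. a n * a (n + 1) = -1 \<longrightarrow>
         (\<exists>!t. t \<in> {real_of_int n<..<real_of_int (n + 1)} \<and> y t = 0))"
proof -
  interpret sitnikov x by unfold_locales (rule assms(1))
  interpret P: symmetric_sequence x bp Np by (rule symmetric_sequence_if_seqs_S[OF assms(5,3)])
  interpret M: symmetric_sequence x bm Nm by (rule symmetric_sequence_if_seqs_S[OF assms(6,4)])
  note good = good_if_seqs_M[OF assms(2)]
  \<comment> \<open>As the periods are at least 1, these numbers of periods reach beyond Kp and Km;
    \<open>Km < Kp\<close> then provides the gap between the tails.\<close>
  define kp km where "kp = nat \<bar>Kp + 1\<bar>" and "km = nat \<bar>1 - Km\<bar>"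
  have kp: "Kp + 1 \<le> int kp * int Np" and km: "1 - Km \<le> int km * int Nm"
    unfolding kp_def km_def by (rule of_nat_mult_ge[OF assms(3)], rule of_nat_mult_ge[OF assms(4)])
  interpret connection x bp Np bm Nm a kp km
  proof
    show "a n = bp n" if "int kp * int Np \<le> n" for n using assms(8) kp that by simp
    show "a n = bm n" if "n \<le> - (int km * int Nm)" for n using assms(9) km that by simp
  qed (use good kp km assms(7) in linarith)+
  obtain y E \<gamma>p Gp \<gamma>m Gm where lm: "locmin a y E" "locmin bp \<gamma>p Gp" "locmin bm \<gamma>m Gm"
    and per: "\<And>r. \<gamma>p (r + P.NN) = \<gamma>p r" "\<And>r. \<gamma>m (r + M.NN) = \<gamma>m r"
    and conn: "connecting_orbit y \<gamma>m \<gamma>p" by (rule connecting_minimiser) blast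
  show ?thesis
  proof (intro bexI conjI allI impI)
    show "\<gamma>p \<in> periodic_orbits x Np bp" "\<gamma>m \<in> periodic_orbits x Nm bm"
      using locmin_orbit[OF lm(2) P.good] locmin_orbit[OF lm(3) M.good] per
      by (simp_all add: periodic_orbits_def P.NN_def M.NN_def)
    show "y \<in> orbits x a" by (rule locmin_orbit[OF lm(1) good])
    show "connecting_orbit y \<gamma>m \<gamma>p" by (rule conn)
    show "\<not> (\<exists>t\<in>{real_of_int n<..<real_of_int (n + 1)}. y t = 0)" if "a n * a (n + 1) = 1" for n
      using locmin_no_zero[OF lm(1) good that] by auto
    show "\<exists>!t. t \<in> {real_of_int n<..<real_of_int (n + 1)} \<and> y t = 0" if "a n * a (n + 1) = - 1" for n
      using locmin_unique_zero[OF lm(1) good that] by simp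
  qed
qed

end
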